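(* Let $n\ge2$, let $A\in\mathbb{R}^{n\times n}$ be arbitrary, $\sigma_1,\dots,\sigma_n>0$, let $X(t)$ be the stochastic replicator dynamics on $\Delta$ with pay-off matrix $A$ and noise coefficients $\sigma_j$ (see context), and let $\mathbf{x}\in\Delta$. For $\varepsilon>0$ let $$\tau_\varepsilon=\inf\{t>0:X_k(t)\ge1-\varepsilon\text{ for some }k\in\{1,\dots,n\}\}.$$ Then $E_{\mathbf{x}}\tau_\varepsilon<\infty$ for every $\varepsilon>0$. Moreover, $$P_{\mathbf{x}}\Big\{\sup_{t>0}\max\{X_1(t),\dots,X_n(t)\}=1\Big\}=1.$$
   Context: $\Delta=\{\mathbf{y}\in(0,1)^n:\sum y_j=1\}$. The stochastic replicator dynamics is the solution $X(t)\in\Delta$ of $dX(t)=\mathbf{b}(X(t))dt+C(X(t))dW(t)$, with $W$ an $n$-dimensional standard Brownian motion, $\mathbf{b}(\mathbf{x})=[\mathrm{diag}(x_1,\dots,x_n)-\mathbf{x}\mathbf{x}^T][A-\mathrm{diag}(\sigma_1^2,\dots,\sigma_n^2)]\mathbf{x}$, $C(\mathbf{x})=[\mathrm{diag}(x_1,\dots,x_n)-\mathbf{x}\mathbf{x}^T]\mathrm{diag}(\sigma_1,\dots,\sigma_n)$; $P_{\mathbf{x}}$, $E_{\mathbf{x}}$ refer to the process with $X(0)=\mathbf{x}$. *)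

theory Defs
  imports "HOL-Probability.Probability"
begin

definition open_simplex :: "(real^'n) set" where
  "open_simplex = {y. (\<forall>j. 0 < y$j \<and> y$j < 1) \<and> (\<Sum>j\<in>UNIV. y$j) = 1}"

definition diagm :: "real^'n \<Rightarrow> real^'n^'n" where
  "diagm v = (\<chi> i j. if i = j then v$i else 0)"

definition outerp :: "real^'n \<Rightarrow> real^'n \<Rightarrow> real^'n^'n" where
  "outerp u v = (\<chi> i j. u$i * v$j)"

definition repl_drift :: "real^'n^'n \<Rightarrow> real^'n \<Rightarrow> real^'n \<Rightarrow> real^'n" where
  "repl_drift A \<sigma> x = (diagm x - outerp x x) *v ((A - diagm (\<chi> j. (\<sigma>$j)^2)) *v x)"

definition repl_diff :: "real^'n \<Rightarrow> real^'n \<Rightarrow> real^'n^'n" where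
  "repl_diff \<sigma> x = (diagm x - outerp x x) ** diagm \<sigma>"

definition is_filtration :: "'a measure \<Rightarrow> (real \<Rightarrow> 'a measure) \<Rightarrow> bool" where
  "is_filtration M F \<longleftrightarrow> (\<forall>t. subalgebra M (F t)) \<and> (\<forall>s t. s \<le> t \<longrightarrow> sets (F s) \<subseteq> sets (F t))"

text \<open>Standard n-dimensional (F-)Brownian motion: W(0)=0, continuous paths, adapted,
  increments W(t)-W(s) independent of F(s) and centred Gaussian with covariance (t-s) I
  (Gaussian vector: every projection u.(W t - W s) is N(0, |u|^2 (t-s))).\<close>
definition std_brownian :: "'a measure \<Rightarrow> (real \<Rightarrow> 'a measure) \<Rightarrow> (real \<Rightarrow> 'a \<Rightarrow> real^'n) \<Rightarrow> bool" where
  "std_brownian M F W \<longleftrightarrow>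
     prob_space M \<and> is_filtration M F \<and>
     (\<forall>\<omega>\<in>space M. W 0 \<omega> = 0 \<and> continuous_on {0..} (\<lambda>t. W t \<omega>)) \<and>
     (\<forall>t\<ge>0. W t \<in> borel_measurable (F t)) \<and>
     (\<forall>s t. 0 \<le> s \<and> s < t \<longrightarrow>
        (\<forall>u::real^'n. u \<noteq> 0 \<longrightarrow>
           distributed M lborel (\<lambda>\<omega>. u \<bullet> (W t \<omega> - W s \<omega>)) (normal_density 0 (norm u * sqrt (t - s)))) \<and>
        (\<forall>E\<in>sets (F s). \<forall>B\<in>sets (borel :: (real^'n) measure).
           measure M (E \<inter> {\<omega>\<in>space M. W t \<omega> - W s \<omega> \<in> B})
             = measure M E * measure M {\<omega>\<in>space M. W t \<omega> - W s \<omega> \<in> B}))"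

definition conv_in_prob :: "'a measure \<Rightarrow> (nat \<Rightarrow> 'a \<Rightarrow> real) \<Rightarrow> ('a \<Rightarrow> real) \<Rightarrow> bool" where
  "conv_in_prob M Y Z \<longleftrightarrow>
     (\<forall>e>0. (\<lambda>m. measure M {\<omega>\<in>space M. e < \<bar>Y m \<omega> - Z \<omega>\<bar>}) \<longlonglongrightarrow> 0)"

definition ito_sum :: "(real \<Rightarrow> 'a \<Rightarrow> real^'n) \<Rightarrow> (real \<Rightarrow> 'a \<Rightarrow> real) \<Rightarrow> 'n \<Rightarrow> real \<Rightarrow> nat \<Rightarrow> 'a \<Rightarrow> real" where
  "ito_sum W H j t m \<omega> =
     (\<Sum>k<2^m. H (t * real k / 2^m) \<omega> *
        (W (t * real (Suc k) / 2^m) \<omega> $ j - W (t * real k / 2^m) \<omega> $ j))"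

text \<open>Strong solution X of the stochastic replicator dynamics
  dX = b(X) dt + C(X) dW, X(0) = x, on the probability space M with filtration F and
  Brownian motion W; X takes values in the open simplex (as in the paper). The stochastic
  integral of the continuous adapted integrand C(X(s)) is the limit in probability of the
  left-point Riemann sums along dyadic partitions.\<close>
definition replicator_solution ::
  "'a measure \<Rightarrow> (real \<Rightarrow> 'a measure) \<Rightarrow> (real \<Rightarrow> 'a \<Rightarrow> real^'n) \<Rightarrow> real^'n^'n \<Rightarrow> real^'n
    \<Rightarrow> real^'n \<Rightarrow> (real \<Rightarrow> 'a \<Rightarrow> real^'n) \<Rightarrow> bool" where
  "replicator_solution M F W A \<sigma> x X \<longleftrightarrow>
     (\<forall>t\<ge>0. X t \<in> borel_measurable (F t)) \<and>
     (\<forall>\<omega>\<in>space M. X 0 \<omega> = x \<and> continuous_on {0..} (\<lambda>t. X t \<omega>) \<and> (\<forall>t\<ge>0. X t \<omega> \<in> open_simplex)) \<and>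
     (\<forall>t\<ge>0. \<forall>i. conv_in_prob M
        (\<lambda>m \<omega>. \<Sum>j\<in>UNIV. ito_sum W (\<lambda>s \<omega>'. repl_diff \<sigma> (X s \<omega>') $ i $ j) j t m \<omega>)
        (\<lambda>\<omega>. X t \<omega> $ i - x $ i - integral {0..t} (\<lambda>s. repl_drift A \<sigma> (X s \<omega>) $ i)))"

text \<open>tau_eps = inf{t > 0 : X_k(t) >= 1 - eps for some k}, valued in [0,infinity] (inf {} = infinity).\<close>
definition hit_time :: "(real \<Rightarrow> 'a \<Rightarrow> real^'n) \<Rightarrow> real \<Rightarrow> 'a \<Rightarrow> ennreal" where
  "hit_time X \<epsilon> \<omega> = (INF t\<in>{t. t > 0 \<and> (\<exists>k. X t \<omega> $ k \<ge> 1 - \<epsilon>)}. ennreal t)"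

end

theory Submission
  imports Defs
begin

text \<open>
  For large \<open>\<alpha>\<close> the function \<open>f(y) = \<Sum>\<^sub>i exp (\<alpha> y\<^sub>i)\<close> is a Lyapunov function: its drift under the
  generator of the dynamics is at least 1 wherever every coordinate is below \<open>1 - \<epsilon>\<close>. Instead of
  the Ito formula, time is discretised with a fixed step \<open>h\<close>. Given the past up to \<open>s\<close>,
  \<open>X(s + h) - X(s) = b(X(s)) h + C(X(s)) (W(s + h) - W(s)) + R\<close> with \<open>E[R\<^sup>2] = O(h\<^sup>2)\<close> and
  \<open>E[R] = O(h\<^sup>3\<^sup>/\<^sup>2)\<close>, so the conditional expectation of \<open>f(X(s + h)) - f(X(s))\<close> is \<open>h\<close> times
  the generator applied to \<open>f\<close>, up to \<open>O(h\<^sup>3\<^sup>/\<^sup>2)\<close>, and thus at least \<open>h/2\<close> for some small fixed \<open>h\<close>. As \<open>f\<close> is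
  bounded, the expected number of grid times before \<open>X\<close> comes close to a vertex is finite, and
  \<open>\<tau>\<^sub>\<epsilon>\<close> is at most \<open>h\<close> times that number.
\<close>

subsection \<open>Brownian increments\<close>

text \<open>The hypothesis describes the stochastic integral only as a limit in probability, one
  fixed time after another, of dyadic Riemann sums. So every estimate is first proved for explicit
  Euler sums and then carried to the limit by uniform L2 bounds. Conditional expectations are
  replaced by weights: an inequality between E[Z^2 ...] and E[Z^2] for every bounded
  \<open>F s\<close>-measurable \<open>Z\<close> says the same as the conditional one, and
  \<open>Z\<close> is finally chosen so that Z^2 is the indicator of not having left the region
  times exp(\<alpha> X_i(s)). The mean of R needs an argument of its own. From E[R^2] = O(h^2) alone
  one gets E[R] = O(h), which is as large as the gain from the generator. But the noise part of R
  has mean zero, and its drift part is h times a deviation of size sqrt h. The total error is then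
  smaller than h by a factor sqrt h, so one fixed small step suffices and no limit h -> 0 is taken.
  The claim on the supremum is the almost sure finiteness of the hitting times for \<epsilon> =
  1/(m+1), m = 0, 1, 2, and so on.\<close>

locale brownian_motion = prob_space M
  for M :: "'a measure" +
  fixes F :: "real \<Rightarrow> 'a measure" and W :: "real \<Rightarrow> 'a \<Rightarrow> real^'n"
  assumes BM: "std_brownian M F W"
begin

lemma space_F: "space (F t) = space M" and sets_F: "sets (F t) \<subseteq> sets M"
  using BM by (auto simp: std_brownian_def is_filtration_def subalgebra_def)

lemma F_mono: "s \<le> t \<Longrightarrow> sets (F s) \<subseteq> sets (F t)"
  using BM by (auto simp: std_brownian_def is_filtration_def)

lemma measurable_F_mono: "f \<in> measurable (F s) N \<Longrightarrow> s \<le> t \<Longrightarrow> f \<in> measurable (F t) N"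
  using F_mono[of s t] by (auto simp: measurable_def space_F)

lemma measurable_F_M: "f \<in> measurable (F s) N \<Longrightarrow> f \<in> measurable M N"
  using sets_F[of s] by (auto simp: measurable_def space_F)

lemma W_adapted: "0 \<le> t \<Longrightarrow> W t \<in> borel_measurable (F t)"
  using BM by (auto simp: std_brownian_def)

lemma W_measurable: "0 \<le> t \<Longrightarrow> W t \<in> borel_measurable M"
  by (rule measurable_F_M[OF W_adapted])

lemma incr_measurable:
  "0 \<le> s \<Longrightarrow> s \<le> t \<Longrightarrow> (\<lambda>\<omega>. W t \<omega> - W s \<omega>) \<in> borel_measurable M"
  by (intro borel_measurable_diff W_measurable) auto

text \<open>\<open>std_brownian\<close> provides only the product formula for one event of
  \<open>F s\<close> and one preimage under the increment. That suffices because the preimages of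
  Borel sets under the increment already form a sigma-algebra, and it contains everything generated
  by a Borel function \<open>g\<close> of the increment.\<close>

lemma incr_indep:
  fixes Z :: "'a \<Rightarrow> real" and g :: "real^'n \<Rightarrow> real"
  assumes st: "0 \<le> s" "s < t" and Z: "Z \<in> borel_measurable (F s)" and g: "g \<in> borel_measurable borel"
  shows "indep_var borel Z borel (\<lambda>\<omega>. g (W t \<omega> - W s \<omega>))"
proof -
  let ?D = "\<lambda>\<omega>. W t \<omega> - W s \<omega>"
  have D: "?D \<in> borel_measurable M" using incr_measurable st by simp
  have gD: "(\<lambda>\<omega>. g (?D \<omega>)) \<in> borel_measurable M" using D g by (rule measurable_compose)
  have 1: "sigma_sets (space M) {Z -` A \<inter> space M | A. A \<in> sets borel} \<subseteq> sets (F s)"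
    using sets.sigma_sets_subset[of "{Z -` A \<inter> space M | A. A \<in> sets borel}" "F s"] Z
    by (auto simp: space_F measurable_def)
  let ?V = "vimage_algebra (space M) ?D borel"
  have V: "sets ?V = {?D -` A \<inter> space M | A. A \<in> sets borel}"
    by (rule sets_vimage_algebra2) auto
  have "(\<lambda>\<omega>. g (?D \<omega>)) \<in> borel_measurable ?V"
    using measurable_compose[OF measurable_vimage_algebra1 g, of ?D "space M"] by simp
  hence "{(\<lambda>\<omega>. g (?D \<omega>)) -` A \<inter> space M | A. A \<in> sets borel} \<subseteq> sets ?V"
    unfolding measurable_def by auto
  hence 2: "sigma_sets (space M) {(\<lambda>\<omega>. g (?D \<omega>)) -` A \<inter> space M | A. A \<in> sets borel}
      \<subseteq> {?D -` A \<inter> space M | A. A \<in> sets borel}"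
    using sets.sigma_sets_subset[of _ ?V] V by simp
  have ind: "prob (E \<inter> (?D -` B \<inter> space M)) = prob E * prob (?D -` B \<inter> space M)"
    if "E \<in> sets (F s)" "B \<in> sets borel" for E B
  proof -
    have "?D -` B \<inter> space M = {\<omega>\<in>space M. ?D \<omega> \<in> B}" by auto
    thus ?thesis using BM that st unfolding std_brownian_def by auto
  qed
  show ?thesis
    unfolding indep_var_eq indep_sets2_eq
  proof (intro conjI ballI)
    show "random_variable borel Z" using Z by (rule measurable_F_M)
    show "random_variable borel (\<lambda>\<omega>. g (?D \<omega>))" by (rule gD)
    show "sigma_sets (space M) {Z -` A \<inter> space M |A. A \<in> sets borel} \<subseteq> events"
      using 1 sets_F by blast
    show "sigma_sets (space M) {(\<lambda>\<omega>. g (?D \<omega>)) -` A \<inter> space M |A. A \<in> sets borel} \<subseteq> events"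
      using 2 D by (auto simp: measurable_def)
  next
    fix a b assume a: "a \<in> sigma_sets (space M) {Z -` A \<inter> space M |A. A \<in> sets borel}"
      and b: "b \<in> sigma_sets (space M) {(\<lambda>\<omega>. g (?D \<omega>)) -` A \<inter> space M |A. A \<in> sets borel}"
    from 2 b obtain B where "B \<in> sets borel" "b = ?D -` B \<inter> space M" by blast
    thus "prob (a \<inter> b) = prob a * prob b" using 1 a ind by blast
  qed
qed

lemma incr_product:
  fixes Z :: "'a \<Rightarrow> real" and g :: "real^'n \<Rightarrow> real"
  assumes "0 \<le> s" "s < t" "Z \<in> borel_measurable (F s)" "g \<in> borel_measurable borel"
    and "integrable M Z" "integrable M (\<lambda>\<omega>. g (W t \<omega> - W s \<omega>))"
  shows "integrable M (\<lambda>\<omega>. Z \<omega> * g (W t \<omega> - W s \<omega>))"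
    and "expectation (\<lambda>\<omega>. Z \<omega> * g (W t \<omega> - W s \<omega>)) = expectation Z * expectation (\<lambda>\<omega>. g (W t \<omega> - W s \<omega>))"
  using indep_var_integrable[OF incr_indep[OF assms(1-4)] assms(5,6)]
    indep_var_lebesgue_integral[OF incr_indep[OF assms(1-4)] assms(5,6)] by auto

lemma incr_moment_integrable:
  assumes "0 \<le> s" "s < t"
  shows "integrable M (\<lambda>\<omega>. (u \<bullet> (W t \<omega> - W s \<omega>)) ^ k)"
proof (cases "u = 0")
  case False
  hence D: "distributed M lborel (\<lambda>\<omega>. u \<bullet> (W t \<omega> - W s \<omega>)) (normal_density 0 (norm u * sqrt (t - s)))"
    using BM assms unfolding std_brownian_def by auto
  show ?thesis
    using distributed_integrable[OF D, of "\<lambda>y. y ^ k"] integrable_normal_moment[of "norm u * sqrt (t - s)" 0 k] False assms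
    by simp
qed auto

lemma incr_moments:
  assumes "0 \<le> s" "s < t"
  shows "expectation (\<lambda>\<omega>. u \<bullet> (W t \<omega> - W s \<omega>)) = 0" (is ?m1)
    and "expectation (\<lambda>\<omega>. (u \<bullet> (W t \<omega> - W s \<omega>))\<^sup>2) = (t - s) * (u \<bullet> u)" (is ?m2)
    and "expectation (\<lambda>\<omega>. (u \<bullet> (W t \<omega> - W s \<omega>)) ^ 4) = 3 * (t - s)\<^sup>2 * (u \<bullet> u)\<^sup>2" (is ?m4)
proof -
  have "?m1 \<and> ?m2 \<and> ?m4"
  proof (cases "u = 0")
    case False
    define sd where "sd = norm u * sqrt (t - s)"
    have sd: "sd > 0" "sd\<^sup>2 = (t - s) * (u \<bullet> u)"
      using False assms by (auto simp: sd_def power_mult_distrib power2_norm_eq_inner)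
    have D: "distributed M lborel (\<lambda>\<omega>. u \<bullet> (W t \<omega> - W s \<omega>)) (normal_density 0 sd)"
      using BM assms False unfolding std_brownian_def sd_def by auto
    have E: "expectation (\<lambda>\<omega>. (u \<bullet> (W t \<omega> - W s \<omega>)) ^ k) = (\<integral>y. normal_density 0 sd y * y ^ k \<partial>lborel)" for k
      using distributed_integral[OF D, of "\<lambda>y. y ^ k"] by simp
    have 1: "?m1" using E[of 1] integral_normal_moment_odd[of sd 0 0] sd by simp
    have "(\<integral>y. normal_density 0 sd y * y\<^sup>2 \<partial>lborel) = sd\<^sup>2"
      using integral_normal_moment_even[of sd 0 1] sd(1) by simp
    hence 2: "?m2" using E[of 2] sd by simp
    have "expectation (\<lambda>\<omega>. (u \<bullet> (W t \<omega> - W s \<omega>)) ^ 4) = 3 * (sd\<^sup>2)\<^sup>2"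
      using E[of 4] integral_normal_moment_even[of sd 0 2] sd(1)
      by (simp add: field_simps fact_numeral power2_eq_square)
    thus ?thesis using 1 2 sd by (simp add: power_mult_distrib)
  qed auto
  thus ?m1 ?m2 ?m4 by auto
qed

text \<open>Polarization: the Gaussian law is assumed for one projection at a time, so the mixed
  moment is recovered from the squares along \<open>u + v\<close>, \<open>u\<close> and
  \<open>v\<close>.\<close>

lemma incr_covariance:
  assumes "0 \<le> s" "s < t"
  shows "integrable M (\<lambda>\<omega>. (u \<bullet> (W t \<omega> - W s \<omega>)) * (v \<bullet> (W t \<omega> - W s \<omega>)))"
    and "expectation (\<lambda>\<omega>. (u \<bullet> (W t \<omega> - W s \<omega>)) * (v \<bullet> (W t \<omega> - W s \<omega>))) = (t - s) * (u \<bullet> v)"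
proof -
  have eq: "(\<lambda>\<omega>. (u \<bullet> (W t \<omega> - W s \<omega>)) * (v \<bullet> (W t \<omega> - W s \<omega>))) =
    (\<lambda>\<omega>. (((u + v) \<bullet> (W t \<omega> - W s \<omega>))\<^sup>2 - (u \<bullet> (W t \<omega> - W s \<omega>))\<^sup>2 - (v \<bullet> (W t \<omega> - W s \<omega>))\<^sup>2) / 2)"
    by (auto simp: inner_add_left power2_eq_square field_simps)
  note I = incr_moment_integrable[OF assms, where k=2]
  show "integrable M (\<lambda>\<omega>. (u \<bullet> (W t \<omega> - W s \<omega>)) * (v \<bullet> (W t \<omega> - W s \<omega>)))"
    unfolding eq by (intro integrable_divide Bochner_Integration.integrable_diff I)
  have "expectation (\<lambda>\<omega>. (u \<bullet> (W t \<omega> - W s \<omega>)) * (v \<bullet> (W t \<omega> - W s \<omega>))) =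
     ((t - s) * ((u + v) \<bullet> (u + v)) - (t - s) * (u \<bullet> u) - (t - s) * (v \<bullet> v)) / 2"
    unfolding eq by (simp add: Bochner_Integration.integral_diff I incr_moments(2)[OF assms])
  thus "expectation (\<lambda>\<omega>. (u \<bullet> (W t \<omega> - W s \<omega>)) * (v \<bullet> (W t \<omega> - W s \<omega>))) = (t - s) * (u \<bullet> v)"
    by (simp add: inner_add_left inner_add_right inner_commute field_simps)
qed

lemma inner_axis_one: "(axis j 1 :: real^'n) \<bullet> y = y $ j"
  by (simp add: inner_axis')

text \<open>In coordinates each summand is an \<open>F s\<close>-measurable factor times a
  coordinate of the increment, so independence splits the expectation and the centred factor
  vanishes. \<open>Z\<close> is merely integrable, not bounded, because the partial sums in the
  isometry take its place.\<close>

lemma step_mean: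
  fixes Z :: "'a \<Rightarrow> real" and V :: "'a \<Rightarrow> real^'n"
  assumes st: "0 \<le> s" "s < t" and Z: "Z \<in> borel_measurable (F s)" "integrable M Z"
    and V: "V \<in> borel_measurable (F s)" "\<And>\<omega>. \<omega> \<in> space M \<Longrightarrow> norm (V \<omega>) \<le> B"
  shows "integrable M (\<lambda>\<omega>. Z \<omega> * (V \<omega> \<bullet> (W t \<omega> - W s \<omega>)))"
    and "expectation (\<lambda>\<omega>. Z \<omega> * (V \<omega> \<bullet> (W t \<omega> - W s \<omega>))) = 0"
proof -
  have eq: "(\<lambda>\<omega>. Z \<omega> * (V \<omega> \<bullet> (W t \<omega> - W s \<omega>))) =
     (\<lambda>\<omega>. \<Sum>j\<in>UNIV. (Z \<omega> * (V \<omega> \<bullet> axis j 1)) * (axis j 1 \<bullet> (W t \<omega> - W s \<omega>)))"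
    by (auto simp: inner_axis_one inner_commute[of _ "axis _ _"] inner_vec_def[of "V _"] sum_distrib_left mult.assoc)
  have m: "(\<lambda>\<omega>. Z \<omega> * (V \<omega> \<bullet> axis j 1)) \<in> borel_measurable (F s)" for j
    using Z V by measurable
  have i: "integrable M (\<lambda>\<omega>. Z \<omega> * (V \<omega> \<bullet> axis j 1))" for j
  proof (rule Bochner_Integration.integrable_bound[where f="\<lambda>\<omega>. B * Z \<omega>"])
    show "AE \<omega> in M. norm (Z \<omega> * (V \<omega> \<bullet> axis j 1)) \<le> norm (B * Z \<omega>)"
    proof (rule AE_I2)
      fix \<omega> assume w: "\<omega> \<in> space M"
      have "\<bar>V \<omega> \<bullet> axis j 1\<bar> \<le> B"
        using Cauchy_Schwarz_ineq2[of "V \<omega>" "axis j 1"] V(2)[OF w] by simp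
      thus "norm (Z \<omega> * (V \<omega> \<bullet> axis j 1)) \<le> norm (B * Z \<omega>)"
        by (simp add: abs_mult mult.commute[of "\<bar>Z \<omega>\<bar>"] mult_right_mono)
    qed
  qed (use Z measurable_F_M[OF m] in auto)
  note P = incr_product[OF st m _ i, where g="\<lambda>y. axis k 1 \<bullet> y" for k]
  note I = incr_moment_integrable[OF st, where k=1, simplified]
  show "integrable M (\<lambda>\<omega>. Z \<omega> * (V \<omega> \<bullet> (W t \<omega> - W s \<omega>)))"
    unfolding eq by (intro Bochner_Integration.integrable_sum P(1) I) auto
  show "expectation (\<lambda>\<omega>. Z \<omega> * (V \<omega> \<bullet> (W t \<omega> - W s \<omega>))) = 0"
    unfolding eq
    by (subst Bochner_Integration.integral_sum) (auto intro!: P(1) I simp: P(2) I incr_moments(1)[OF st])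
qed

text \<open>Expanding the square in coordinates leaves products of two coordinates of the increment.
  Their covariance matrix is \<open>t - s\<close> times the identity, so only the diagonal
  survives.\<close>

lemma step_square:
  fixes V :: "'a \<Rightarrow> real^'n"
  assumes st: "0 \<le> s" "s < t"
    and V: "V \<in> borel_measurable (F s)" "\<And>\<omega>. \<omega> \<in> space M \<Longrightarrow> norm (V \<omega>) \<le> B"
  shows "integrable M (\<lambda>\<omega>. (V \<omega> \<bullet> (W t \<omega> - W s \<omega>))\<^sup>2)"
    and "expectation (\<lambda>\<omega>. (V \<omega> \<bullet> (W t \<omega> - W s \<omega>))\<^sup>2) = (t - s) * expectation (\<lambda>\<omega>. V \<omega> \<bullet> V \<omega>)"
proof -
  have eq: "(\<lambda>\<omega>. (V \<omega> \<bullet> (W t \<omega> - W s \<omega>))\<^sup>2) =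
     (\<lambda>\<omega>. \<Sum>j\<in>UNIV. \<Sum>k\<in>UNIV. ((V \<omega> \<bullet> axis j 1) * (V \<omega> \<bullet> axis k 1)) *
        ((axis j 1 \<bullet> (W t \<omega> - W s \<omega>)) * (axis k 1 \<bullet> (W t \<omega> - W s \<omega>))))"
    by (auto simp: inner_axis_one inner_commute[of _ "axis _ _"] inner_vec_def[of "V _"] power2_eq_square sum_product ac_simps)
  have m: "(\<lambda>\<omega>. (V \<omega> \<bullet> axis j 1) * (V \<omega> \<bullet> axis k 1)) \<in> borel_measurable (F s)" for j k
    using V by measurable
  have b: "\<bar>V \<omega> \<bullet> axis j 1\<bar> \<le> B" if "\<omega> \<in> space M" for \<omega> j
    using Cauchy_Schwarz_ineq2[of "V \<omega>" "axis j 1"] V(2)[OF that] by simp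
  have i: "integrable M (\<lambda>\<omega>. (V \<omega> \<bullet> axis j 1) * (V \<omega> \<bullet> axis k 1))" for j k
  proof (rule integrable_const_bound[where B="B * B"])
    show "AE \<omega> in M. norm ((V \<omega> \<bullet> axis j 1) * (V \<omega> \<bullet> axis k 1)) \<le> B * B"
    proof (rule AE_I2)
      fix \<omega> assume w: "\<omega> \<in> space M"
      show "norm ((V \<omega> \<bullet> axis j 1) * (V \<omega> \<bullet> axis k 1)) \<le> B * B"
        using b[OF w, of j] b[OF w, of k] by (simp add: abs_mult) (intro mult_mono, auto)
    qed
  qed (use measurable_F_M[OF m] in auto)
  note P = incr_product[OF st m _ i, where g="\<lambda>y. (axis j 1 \<bullet> y) * (axis k 1 \<bullet> y)" for j k]
  note I = incr_covariance[OF st]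
  show "integrable M (\<lambda>\<omega>. (V \<omega> \<bullet> (W t \<omega> - W s \<omega>))\<^sup>2)"
    unfolding eq by (intro Bochner_Integration.integrable_sum P(1) I) auto
  have "expectation (\<lambda>\<omega>. (V \<omega> \<bullet> (W t \<omega> - W s \<omega>))\<^sup>2) =
    (\<Sum>j\<in>UNIV. \<Sum>k\<in>UNIV. expectation (\<lambda>\<omega>. (V \<omega> \<bullet> axis j 1) * (V \<omega> \<bullet> axis k 1)) *
       ((t - s) * ((axis j 1 :: real^'n) \<bullet> axis k 1)))"
    unfolding eq
    by (subst Bochner_Integration.integral_sum,
        (intro Bochner_Integration.integrable_sum P(1) I; simp),
        intro sum.cong refl,
        subst Bochner_Integration.integral_sum,
        (intro Bochner_Integration.integrable_sum P(1) I; simp),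
        intro sum.cong refl, subst P(2)) (auto simp: I)
  also have "\<dots> = (t - s) * (\<Sum>j\<in>UNIV. expectation (\<lambda>\<omega>. (V \<omega> \<bullet> axis j 1) * (V \<omega> \<bullet> axis j 1)))"
    by (simp add: inner_axis_axis if_distrib sum.delta sum_distrib_left mult.commute cong: if_cong)
  also have "\<dots> = (t - s) * expectation (\<lambda>\<omega>. V \<omega> \<bullet> V \<omega>)"
    by (subst Bochner_Integration.integral_sum[symmetric])
      (use i in \<open>auto simp: inner_axis_one inner_commute[of _ "axis _ _"] inner_vec_def[of "V _"]\<close>)
  finally show "expectation (\<lambda>\<omega>. (V \<omega> \<bullet> (W t \<omega> - W s \<omega>))\<^sup>2) = (t - s) * expectation (\<lambda>\<omega>. V \<omega> \<bullet> V \<omega>)" .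
qed

text \<open>Induction on the number of steps: the partial sum is measurable at the left end of the
  next step, so the cross term has mean zero by \<open>step_mean\<close> and the squares add
  up.\<close>

lemma ito_isometry:
  fixes V :: "nat \<Rightarrow> 'a \<Rightarrow> real^'n" and t :: "nat \<Rightarrow> real"
  assumes t: "0 \<le> t 0" "\<And>l. t l < t (Suc l)"
    and V: "\<And>l. l < N \<Longrightarrow> V l \<in> borel_measurable (F (t l))"
      "\<And>l \<omega>. l < N \<Longrightarrow> \<omega> \<in> space M \<Longrightarrow> norm (V l \<omega>) \<le> B"
  defines "S \<equiv> \<lambda>n \<omega>. \<Sum>l<n. V l \<omega> \<bullet> (W (t (Suc l)) \<omega> - W (t l) \<omega>)"
  shows "S N \<in> borel_measurable (F (t N))" (is ?m)
    and "integrable M (\<lambda>\<omega>. (S N \<omega>)\<^sup>2)" (is ?i)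
    and "expectation (\<lambda>\<omega>. (S N \<omega>)\<^sup>2) = (\<Sum>l<N. (t (Suc l) - t l) * expectation (\<lambda>\<omega>. V l \<omega> \<bullet> V l \<omega>))" (is ?e)
proof -
  have t0: "0 \<le> t l" for l
    using t by (induction l) (auto intro: order_trans less_imp_le)
  have "S n \<in> borel_measurable (F (t n)) \<and> integrable M (\<lambda>\<omega>. (S n \<omega>)\<^sup>2) \<and>
     expectation (\<lambda>\<omega>. (S n \<omega>)\<^sup>2) = (\<Sum>l<n. (t (Suc l) - t l) * expectation (\<lambda>\<omega>. V l \<omega> \<bullet> V l \<omega>))"
    if "n \<le> N" for n
    using that
  proof (induction n)
    case 0
    show ?case by (simp add: S_def)
  next
    case (Suc n)
    hence IH: "S n \<in> borel_measurable (F (t n))" "integrable M (\<lambda>\<omega>. (S n \<omega>)\<^sup>2)"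
      "expectation (\<lambda>\<omega>. (S n \<omega>)\<^sup>2) = (\<Sum>l<n. (t (Suc l) - t l) * expectation (\<lambda>\<omega>. V l \<omega> \<bullet> V l \<omega>))"
      and n: "n < N" by auto
    let ?D = "\<lambda>\<omega>. V n \<omega> \<bullet> (W (t (Suc n)) \<omega> - W (t n) \<omega>)"
    have [measurable]: "S n \<in> borel_measurable (F (t (Suc n)))" "V n \<in> borel_measurable (F (t (Suc n)))"
       "W (t n) \<in> borel_measurable (F (t (Suc n)))" "W (t (Suc n)) \<in> borel_measurable (F (t (Suc n)))"
      using measurable_F_mono[OF IH(1)] measurable_F_mono[OF V(1)[OF n]] measurable_F_mono[OF W_adapted[OF t0]]
        W_adapted[OF t0] t(2)[of n] by (auto simp: less_imp_le)
    have S: "S (Suc n) = (\<lambda>\<omega>. S n \<omega> + ?D \<omega>)" by (simp add: S_def)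
    have 1: "S (Suc n) \<in> borel_measurable (F (t (Suc n)))" unfolding S by measurable
    have SM: "S n \<in> borel_measurable M" using IH(1) by (rule measurable_F_M)
    have SI: "integrable M (S n)" by (rule square_integrable_imp_integrable[OF SM IH(2)])
    note sq = step_square[OF t0 t(2) V(1)[OF n] V(2)[OF n]]
    note mn = step_mean[OF t0 t(2) IH(1) SI V(1)[OF n] V(2)[OF n]]
    have eq: "(\<lambda>\<omega>. (S (Suc n) \<omega>)\<^sup>2) = (\<lambda>\<omega>. (S n \<omega>)\<^sup>2 + 2 * (S n \<omega> * ?D \<omega>) + (?D \<omega>)\<^sup>2)"
      unfolding S by (auto simp: power2_eq_square algebra_simps)
    have 2: "integrable M (\<lambda>\<omega>. (S (Suc n) \<omega>)\<^sup>2)"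
      unfolding eq by (intro Bochner_Integration.integrable_add integrable_mult_right IH sq mn)
    have 3: "expectation (\<lambda>\<omega>. (S (Suc n) \<omega>)\<^sup>2) = expectation (\<lambda>\<omega>. (S n \<omega>)\<^sup>2) + expectation (\<lambda>\<omega>. (?D \<omega>)\<^sup>2)"
      unfolding eq using mn(1) mn(2) sq(1) IH(2) by simp
    show ?case using 1 2 3 IH(3) sq(2) by simp
  qed
  thus ?m ?i ?e by auto
qed

end

subsection \<open>Limits in probability and Riemann sums\<close>

text \<open>Convergence in probability, in the metric form, which turns the limit laws into properties of the
  integral.\<close>

definition prob_lim :: "'a measure \<Rightarrow> (nat \<Rightarrow> 'a \<Rightarrow> real) \<Rightarrow> ('a \<Rightarrow> real) \<Rightarrow> bool" where
  "prob_lim M Y Z \<longleftrightarrow> (\<forall>p. Y p \<in> borel_measurable M) \<and> Z \<in> borel_measurable M \<and>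
     (\<lambda>p. \<integral>\<omega>. min 1 \<bar>Y p \<omega> - Z \<omega>\<bar> \<partial>M) \<longlonglongrightarrow> 0"

context prob_space
begin

lemma integrable_min_one:
  fixes f :: "'a \<Rightarrow> real"
  assumes "f \<in> borel_measurable M"
  shows "integrable M (\<lambda>\<omega>. min 1 \<bar>f \<omega>\<bar>)"
  using assms by (intro integrable_const_bound[where B=1]) auto

lemma prob_limI:
  assumes Y: "\<And>p. Y p \<in> borel_measurable M" and Z: "Z \<in> borel_measurable M"
    and le: "\<And>e. e > 0 \<Longrightarrow> eventually (\<lambda>p. expectation (\<lambda>\<omega>. min 1 \<bar>Y p \<omega> - Z \<omega>\<bar>) \<le> e) sequentially"
  shows "prob_lim M Y Z"
  unfolding prob_lim_def
proof (intro conjI allI Y Z)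
  show "(\<lambda>p. expectation (\<lambda>\<omega>. min 1 \<bar>Y p \<omega> - Z \<omega>\<bar>)) \<longlonglongrightarrow> 0"
  proof (rule tendstoI)
    fix e :: real assume "e > 0"
    hence "eventually (\<lambda>p. expectation (\<lambda>\<omega>. min 1 \<bar>Y p \<omega> - Z \<omega>\<bar>) \<le> e / 2) sequentially"
      by (intro le) simp
    thus "eventually (\<lambda>p. dist (expectation (\<lambda>\<omega>. min 1 \<bar>Y p \<omega> - Z \<omega>\<bar>)) 0 < e) sequentially"
    proof eventually_elim
      case (elim p)
      have "0 \<le> expectation (\<lambda>\<omega>. min 1 \<bar>Y p \<omega> - Z \<omega>\<bar>)" by (rule integral_nonneg_AE) auto
      thus ?case using elim \<open>e > 0\<close> by (simp add: dist_real_def)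
    qed
  qed
qed

text \<open>The truncated distance is at most \<open>e / 2\<close> off the exceptional event and at
  most 1 on it.\<close>

lemma prob_lim_if_conv_in_prob:
  assumes c: "conv_in_prob M Y Z" and [measurable]: "\<And>p. Y p \<in> borel_measurable M" "Z \<in> borel_measurable M"
  shows "prob_lim M Y Z"
proof (rule prob_limI)
  fix e :: real assume e: "e > 0"
  have "(\<lambda>p. prob {\<omega>\<in>space M. e / 2 < \<bar>Y p \<omega> - Z \<omega>\<bar>}) \<longlonglongrightarrow> 0"
    by (rule c[unfolded conv_in_prob_def, rule_format]) (use e in simp)
  hence "eventually (\<lambda>p. prob {\<omega>\<in>space M. e / 2 < \<bar>Y p \<omega> - Z \<omega>\<bar>} < e / 2) sequentially"
    using e by (intro order_tendstoD) auto
  thus "eventually (\<lambda>p. expectation (\<lambda>\<omega>. min 1 \<bar>Y p \<omega> - Z \<omega>\<bar>) \<le> e) sequentially"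
  proof eventually_elim
    case (elim p)
    let ?A = "{\<omega>\<in>space M. e / 2 < \<bar>Y p \<omega> - Z \<omega>\<bar>}"
    have A: "?A \<in> events" by measurable
    have i: "integrable M (indicat_real ?A)" using A by (simp add: less_top[symmetric])
    have "expectation (\<lambda>\<omega>. min 1 \<bar>Y p \<omega> - Z \<omega>\<bar>) \<le> expectation (\<lambda>\<omega>. e / 2 + indicator ?A \<omega>)"
      using e by (intro integral_mono integrable_min_one Bochner_Integration.integrable_add i)
        (auto simp: min_def split: split_indicator)
    also have "\<dots> = e / 2 + prob ?A" 
      using A by (subst Bochner_Integration.integral_add[OF _ i]) (auto simp: prob_space)
    finally show ?case using elim by simp
  qed
qed auto

lemma prob_lim_pointwise:
  assumes Y: "\<And>p. Y p \<in> borel_measurable M" and Z: "Z \<in> borel_measurable M"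
    and lim: "\<And>\<omega>. \<omega> \<in> space M \<Longrightarrow> (\<lambda>p. Y p \<omega>) \<longlonglongrightarrow> Z \<omega>"
  shows "prob_lim M Y Z"
proof -
  note [measurable] = Y Z
  have "(\<lambda>p. expectation (\<lambda>\<omega>. min 1 \<bar>Y p \<omega> - Z \<omega>\<bar>)) \<longlonglongrightarrow> expectation (\<lambda>\<omega>. 0)"
  proof (rule integral_dominated_convergence[where w="\<lambda>_. 1"])
    show "AE \<omega> in M. (\<lambda>p. min 1 \<bar>Y p \<omega> - Z \<omega>\<bar>) \<longlonglongrightarrow> 0"
    proof (rule AE_I2)
      fix \<omega> assume "\<omega> \<in> space M"
      hence "(\<lambda>p. min 1 \<bar>Y p \<omega> - Z \<omega>\<bar>) \<longlonglongrightarrow> min 1 \<bar>Z \<omega> - Z \<omega>\<bar>"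
        by (intro tendsto_intros lim)
      thus "(\<lambda>p. min 1 \<bar>Y p \<omega> - Z \<omega>\<bar>) \<longlonglongrightarrow> 0" by simp
    qed
  qed auto
  thus ?thesis unfolding prob_lim_def using Y Z by simp
qed

lemma prob_lim_diff:
  assumes "prob_lim M Y Z" "prob_lim M Y' Z'"
  shows "prob_lim M (\<lambda>p \<omega>. Y p \<omega> - Y' p \<omega>) (\<lambda>\<omega>. Z \<omega> - Z' \<omega>)"
proof -
  have [measurable]: "\<And>p. Y p \<in> borel_measurable M" "Z \<in> borel_measurable M"
     "\<And>p. Y' p \<in> borel_measurable M" "Z' \<in> borel_measurable M"
    using assms by (auto simp: prob_lim_def)
  have lim: "(\<lambda>p. expectation (\<lambda>\<omega>. min 1 \<bar>Y p \<omega> - Z \<omega>\<bar>) + expectation (\<lambda>\<omega>. min 1 \<bar>Y' p \<omega> - Z' \<omega>\<bar>)) \<longlonglongrightarrow> 0 + 0"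
    using assms by (intro tendsto_add) (auto simp: prob_lim_def)
  have le: "expectation (\<lambda>\<omega>. min 1 \<bar>Y p \<omega> - Y' p \<omega> - (Z \<omega> - Z' \<omega>)\<bar>) \<le>
     expectation (\<lambda>\<omega>. min 1 \<bar>Y p \<omega> - Z \<omega>\<bar>) + expectation (\<lambda>\<omega>. min 1 \<bar>Y' p \<omega> - Z' \<omega>\<bar>)" for p
    by (subst Bochner_Integration.integral_add[symmetric])
       (auto intro!: integral_mono Bochner_Integration.integrable_add integrable_min_one)
  show ?thesis
  proof (rule prob_limI)
    fix e :: real assume "e > 0"
    hence "eventually (\<lambda>p. expectation (\<lambda>\<omega>. min 1 \<bar>Y p \<omega> - Z \<omega>\<bar>) + expectation (\<lambda>\<omega>. min 1 \<bar>Y' p \<omega> - Z' \<omega>\<bar>) < e) sequentially"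
      using lim by (intro order_tendstoD) auto
    thus "eventually (\<lambda>p. expectation (\<lambda>\<omega>. min 1 \<bar>Y p \<omega> - Y' p \<omega> - (Z \<omega> - Z' \<omega>)\<bar>) \<le> e) sequentially"
    proof eventually_elim
      case (elim p)
      show ?case using elim le[of p] by linarith
    qed
  qed auto
qed

text \<open>Young's inequality |y| <= e/2 + y^2/(2e), applied as soon as the second moment is below
  e^2.\<close>

lemma prob_lim_L2:
  assumes [measurable]: "\<And>p. Y p \<in> borel_measurable M"
    and i: "\<And>p. integrable M (\<lambda>\<omega>. (Y p \<omega>)\<^sup>2)"
    and lim: "(\<lambda>p. expectation (\<lambda>\<omega>. (Y p \<omega>)\<^sup>2)) \<longlonglongrightarrow> 0"
  shows "prob_lim M Y (\<lambda>_. 0)"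
proof (rule prob_limI)
  fix e :: real assume e: "e > 0"
  hence "eventually (\<lambda>p. expectation (\<lambda>\<omega>. (Y p \<omega>)\<^sup>2) < e\<^sup>2) sequentially"
    using lim by (intro order_tendstoD) auto
  thus "eventually (\<lambda>p. expectation (\<lambda>\<omega>. min 1 \<bar>Y p \<omega> - 0\<bar>) \<le> e) sequentially"
  proof eventually_elim
    case (elim p)
    have "expectation (\<lambda>\<omega>. min 1 \<bar>Y p \<omega> - 0\<bar>) \<le> expectation (\<lambda>\<omega>. e / 2 + (Y p \<omega>)\<^sup>2 / (2 * e))"
    proof (intro integral_mono integrable_min_one Bochner_Integration.integrable_add integrable_divide i)
      fix \<omega>
      have "0 \<le> (\<bar>Y p \<omega>\<bar> - e)\<^sup>2" by simp
      hence "\<bar>Y p \<omega>\<bar> \<le> e / 2 + (Y p \<omega>)\<^sup>2 / (2 * e)"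
        using e by (simp add: power2_eq_square field_simps)
      thus "min 1 \<bar>Y p \<omega> - 0\<bar> \<le> e / 2 + (Y p \<omega>)\<^sup>2 / (2 * e)" by simp
    qed auto
    also have "\<dots> = e / 2 + expectation (\<lambda>\<omega>. (Y p \<omega>)\<^sup>2) / (2 * e)"
      using i by (simp add: prob_space)
    also have "\<dots> \<le> e / 2 + e\<^sup>2 / (2 * e)"
      using elim e by (intro add_left_mono divide_right_mono) auto
    also have "\<dots> = e" using e by (simp add: power2_eq_square)
    finally show ?case .
  qed
qed auto

lemma prob_lim_mult_bounded:
  assumes "prob_lim M Y Z" and Q[measurable]: "Q \<in> borel_measurable M" and B: "\<And>\<omega>. \<omega> \<in> space M \<Longrightarrow> \<bar>Q \<omega>\<bar> \<le> B"
  shows "prob_lim M (\<lambda>p \<omega>. Q \<omega> * Y p \<omega>) (\<lambda>\<omega>. Q \<omega> * Z \<omega>)"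
proof -
  have [measurable]: "\<And>p. Y p \<in> borel_measurable M" "Z \<in> borel_measurable M"
    using assms by (auto simp: prob_lim_def)
  \<comment> \<open>A factor below 1 could not be pulled out of the truncation:
    \<open>min 1 (C * r) \<le> C * min 1 r\<close> for all \<open>r \<ge> 0\<close> requires
    \<open>C \<ge> 1\<close>.\<close>
  define C where "C = max 1 B"
  have C: "C \<ge> 1" "\<And>\<omega>. \<omega> \<in> space M \<Longrightarrow> \<bar>Q \<omega>\<bar> \<le> C" using B by (auto simp: C_def le_max_iff_disj)
  have lim: "(\<lambda>p. C * expectation (\<lambda>\<omega>. min 1 \<bar>Y p \<omega> - Z \<omega>\<bar>)) \<longlonglongrightarrow> C * 0"
    using assms by (intro tendsto_intros) (auto simp: prob_lim_def)
  have le: "expectation (\<lambda>\<omega>. min 1 \<bar>Q \<omega> * Y p \<omega> - Q \<omega> * Z \<omega>\<bar>) \<le> C * expectation (\<lambda>\<omega>. min 1 \<bar>Y p \<omega> - Z \<omega>\<bar>)" for p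
  proof -
    have "expectation (\<lambda>\<omega>. min 1 \<bar>Q \<omega> * Y p \<omega> - Q \<omega> * Z \<omega>\<bar>) \<le> expectation (\<lambda>\<omega>. C * min 1 \<bar>Y p \<omega> - Z \<omega>\<bar>)"
    proof (intro integral_mono integrable_min_one integrable_mult_right)
      fix \<omega> assume w: "\<omega> \<in> space M"
      have "\<bar>Q \<omega> * Y p \<omega> - Q \<omega> * Z \<omega>\<bar> = \<bar>Q \<omega>\<bar> * \<bar>Y p \<omega> - Z \<omega>\<bar>"
        by (simp add: abs_mult[symmetric] right_diff_distrib)
      also have "\<dots> \<le> C * \<bar>Y p \<omega> - Z \<omega>\<bar>" using C(2)[OF w] by (intro mult_right_mono) auto
      finally show "min 1 \<bar>Q \<omega> * Y p \<omega> - Q \<omega> * Z \<omega>\<bar> \<le> C * min 1 \<bar>Y p \<omega> - Z \<omega>\<bar>"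
        using C(1) by (auto simp: min_def)
    qed auto
    thus ?thesis by simp
  qed
  show ?thesis
  proof (rule prob_limI)
    fix e :: real assume "e > 0"
    hence "eventually (\<lambda>p. C * expectation (\<lambda>\<omega>. min 1 \<bar>Y p \<omega> - Z \<omega>\<bar>) < e) sequentially"
      using lim by (intro order_tendstoD) auto
    thus "eventually (\<lambda>p. expectation (\<lambda>\<omega>. min 1 \<bar>Q \<omega> * Y p \<omega> - Q \<omega> * Z \<omega>\<bar>) \<le> e) sequentially"
    proof eventually_elim
      case (elim p)
      show ?case using elim le[of p] by linarith
    qed
  qed auto
qed

lemma prob_lim_add:
  assumes "prob_lim M Y Z" "prob_lim M Y' Z'"
  shows "prob_lim M (\<lambda>p \<omega>. Y p \<omega> + Y' p \<omega>) (\<lambda>\<omega>. Z \<omega> + Z' \<omega>)"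
  using prob_lim_diff[OF assms(1) prob_lim_mult_bounded[OF assms(2), of "\<lambda>_. -1" 1]] by simp

text \<open>Fatou's lemma along a subsequence that converges almost everywhere; L1 convergence of
  the truncated distance supplies the subsequence.\<close>

lemma prob_lim_square_bound:
  assumes l: "prob_lim M Y Z"
    and i: "\<And>p. integrable M (\<lambda>\<omega>. (Y p \<omega>)\<^sup>2)" and C: "\<And>p. expectation (\<lambda>\<omega>. (Y p \<omega>)\<^sup>2) \<le> C"
  shows "integrable M (\<lambda>\<omega>. (Z \<omega>)\<^sup>2)" and "expectation (\<lambda>\<omega>. (Z \<omega>)\<^sup>2) \<le> C"
proof -
  have [measurable]: "\<And>p. Y p \<in> borel_measurable M" "Z \<in> borel_measurable M"
    using l by (auto simp: prob_lim_def)
  have "\<exists>r::nat\<Rightarrow>nat. strict_mono r \<and> (AE \<omega> in M. (\<lambda>n. min 1 \<bar>Y (r n) \<omega> - Z \<omega>\<bar>) \<longlonglongrightarrow> 0)"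
    using l by (intro tendsto_L1_AE_subseq integrable_min_one) (auto simp: prob_lim_def)
  then obtain r :: "nat \<Rightarrow> nat" where r: "AE \<omega> in M. (\<lambda>n. min 1 \<bar>Y (r n) \<omega> - Z \<omega>\<bar>) \<longlonglongrightarrow> 0" by blast
  have Y: "(\<lambda>n. (Y (r n) \<omega>)\<^sup>2) \<longlonglongrightarrow> (Z \<omega>)\<^sup>2" if m: "(\<lambda>n. min 1 \<bar>Y (r n) \<omega> - Z \<omega>\<bar>) \<longlonglongrightarrow> 0" for \<omega>
  proof -
    have "eventually (\<lambda>n. min 1 \<bar>Y (r n) \<omega> - Z \<omega>\<bar> < 1) sequentially"
      using m by (intro order_tendstoD) auto
    hence "eventually (\<lambda>n. min 1 \<bar>Y (r n) \<omega> - Z \<omega>\<bar> = \<bar>Y (r n) \<omega> - Z \<omega>\<bar>) sequentially"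
      by eventually_elim auto
    hence "(\<lambda>n. \<bar>Y (r n) \<omega> - Z \<omega>\<bar>) \<longlonglongrightarrow> 0" using m tendsto_cong by fastforce
    hence "(\<lambda>n. Y (r n) \<omega>) \<longlonglongrightarrow> Z \<omega>" using LIM_zero_cancel tendsto_rabs_zero_iff by blast
    thus ?thesis by (intro tendsto_intros)
  qed
  have Cp: "0 \<le> C" using C[of 0] by (rule order_trans[rotated]) (auto intro: integral_nonneg_AE)
  have "(\<integral>\<^sup>+\<omega>. ennreal ((Z \<omega>)\<^sup>2) \<partial>M) = (\<integral>\<^sup>+\<omega>. liminf (\<lambda>n. ennreal ((Y (r n) \<omega>)\<^sup>2)) \<partial>M)"
  proof (rule nn_integral_cong_AE, use r in eventually_elim)
    case (elim \<omega>)
    have "(\<lambda>n. ennreal ((Y (r n) \<omega>)\<^sup>2)) \<longlonglongrightarrow> ennreal ((Z \<omega>)\<^sup>2)"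
      by (intro tendsto_ennrealI Y elim)
    thus ?case by (intro lim_imp_Liminf[symmetric]) auto
  qed
  also have "\<dots> \<le> liminf (\<lambda>n. \<integral>\<^sup>+\<omega>. ennreal ((Y (r n) \<omega>)\<^sup>2) \<partial>M)"
    by (rule nn_integral_liminf) auto
  also have "\<dots> = liminf (\<lambda>n. ennreal (expectation (\<lambda>\<omega>. (Y (r n) \<omega>)\<^sup>2)))"
    using i by (simp add: nn_integral_eq_integral)
  also have "\<dots> \<le> liminf (\<lambda>n. ennreal C)"
    using C by (intro Liminf_mono always_eventually allI ennreal_leI) auto
  also have "\<dots> = ennreal C" by (simp add: Liminf_const)
  finally have le: "(\<integral>\<^sup>+\<omega>. ennreal ((Z \<omega>)\<^sup>2) \<partial>M) \<le> ennreal C" .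
  show int: "integrable M (\<lambda>\<omega>. (Z \<omega>)\<^sup>2)"
    using le by (intro integrableI_nonneg) (auto simp: le_less_trans)
  have "ennreal (expectation (\<lambda>\<omega>. (Z \<omega>)\<^sup>2)) \<le> ennreal C"
    using le int by (simp add: nn_integral_eq_integral)
  thus "expectation (\<lambda>\<omega>. (Z \<omega>)\<^sup>2) \<le> C" using Cp by simp
qed

text \<open>The L2 bound gives uniform integrability, via
  \<open>\<bar>D\<bar> \<le> K min 1 \<bar>D\<bar> + D\<^sup>2/K\<close> for \<open>K \<ge> 1\<close>.\<close>

lemma prob_lim_expectation:
  assumes l: "prob_lim M Y Z"
    and i: "\<And>p. integrable M (\<lambda>\<omega>. (Y p \<omega>)\<^sup>2)" and C: "\<And>p. expectation (\<lambda>\<omega>. (Y p \<omega>)\<^sup>2) \<le> C"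
  shows "(\<lambda>p. expectation (Y p)) \<longlonglongrightarrow> expectation Z"
proof -
  have [measurable]: "\<And>p. Y p \<in> borel_measurable M" "Z \<in> borel_measurable M"
    using l by (auto simp: prob_lim_def)
  note Z = prob_lim_square_bound[OF assms]
  have i1: "integrable M (Y p)" "integrable M Z" for p
    using square_integrable_imp_integrable[OF _ i] square_integrable_imp_integrable[OF _ Z(1)] by simp_all
  have Cp: "0 \<le> C" using C[of 0] by (rule order_trans[rotated]) (auto intro: integral_nonneg_AE)
  have bd: "\<bar>expectation (Y p) - expectation Z\<bar> \<le> K * expectation (\<lambda>\<omega>. min 1 \<bar>Y p \<omega> - Z \<omega>\<bar>) + 4 * C / K"
    if K: "K \<ge> 1" for K p
  proof -
    have "\<bar>expectation (Y p) - expectation Z\<bar> = \<bar>expectation (\<lambda>\<omega>. Y p \<omega> - Z \<omega>)\<bar>"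
      using i1 by simp
    also have "\<dots> \<le> expectation (\<lambda>\<omega>. \<bar>Y p \<omega> - Z \<omega>\<bar>)" by (rule integral_abs_bound)
    also have "\<dots> \<le> expectation (\<lambda>\<omega>. K * min 1 \<bar>Y p \<omega> - Z \<omega>\<bar> + (2 * (Y p \<omega>)\<^sup>2 + 2 * (Z \<omega>)\<^sup>2) / K)"
    proof (intro integral_mono Bochner_Integration.integrable_add integrable_mult_right integrable_divide
        integrable_min_one i Z integrable_abs Bochner_Integration.integrable_diff i1)
      fix \<omega>
      let ?D = "\<bar>Y p \<omega> - Z \<omega>\<bar>"
      have "0 \<le> (Y p \<omega> + Z \<omega>)\<^sup>2" by simp
      hence "?D\<^sup>2 \<le> 2 * (Y p \<omega>)\<^sup>2 + 2 * (Z \<omega>)\<^sup>2" by (simp add: power2_eq_square algebra_simps)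
      hence "?D\<^sup>2 / K \<le> (2 * (Y p \<omega>)\<^sup>2 + 2 * (Z \<omega>)\<^sup>2) / K" using K by (intro divide_right_mono) auto
      moreover have "?D \<le> K * min 1 ?D + ?D\<^sup>2 / K"
      \<comment> \<open>Up to \<open>K\<close> the truncated term alone dominates, beyond
        \<open>K\<close> the quadratic one does.\<close>
      proof (cases "?D \<le> K")
        case True
        have "?D \<le> K * min 1 ?D"
          using True K mult_right_mono[OF K, of ?D] by (auto simp: min_def)
        thus ?thesis using K by (smt (verit) zero_le_power2 divide_nonneg_pos)
      next
        case False
        hence "?D * K \<le> ?D\<^sup>2" unfolding power2_eq_square by (intro mult_left_mono) auto
        hence "?D \<le> ?D\<^sup>2 / K" using K by (simp add: field_simps)
        moreover have "0 \<le> K * min 1 ?D" using K by auto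
        ultimately show ?thesis by linarith
      qed
      ultimately show "?D \<le> K * min 1 ?D + (2 * (Y p \<omega>)\<^sup>2 + 2 * (Z \<omega>)\<^sup>2) / K" by linarith
    qed auto
    also have "\<dots> = K * expectation (\<lambda>\<omega>. min 1 \<bar>Y p \<omega> - Z \<omega>\<bar>) +
        (2 * expectation (\<lambda>\<omega>. (Y p \<omega>)\<^sup>2) + 2 * expectation (\<lambda>\<omega>. (Z \<omega>)\<^sup>2)) / K"
      using i Z integrable_min_one[of "\<lambda>\<omega>. Y p \<omega> - Z \<omega>"] by simp
    also have "\<dots> \<le> K * expectation (\<lambda>\<omega>. min 1 \<bar>Y p \<omega> - Z \<omega>\<bar>) + (2 * C + 2 * C) / K"
      using C[of p] Z(2) K by (intro add_left_mono divide_right_mono add_mono mult_left_mono) auto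
    finally show ?thesis by simp
  qed
  show ?thesis
  proof (rule tendstoI)
    fix e :: real assume e: "e > 0"
    \<comment> \<open>In \<open>bd\<close> the quadratic part of the error is
      \<open>4 * C / K\<close>, since the squared difference costs \<open>2 * C\<close> for each of
      \<open>Y p\<close> and \<open>Z\<close>. This choice pushes it below
      \<open>e / 2\<close>.\<close>
    define K where "K = max 1 (8 * C / e + 1)"
    have K: "K \<ge> 1" "8 * C / e < K" by (auto simp: K_def)
    have "8 * C < e * K" using K e by (simp add: field_simps)
    hence K2: "4 * C / K < e / 2" using K(1) by (simp add: field_simps)
    have "(\<lambda>p. K * expectation (\<lambda>\<omega>. min 1 \<bar>Y p \<omega> - Z \<omega>\<bar>)) \<longlonglongrightarrow> K * 0"
      using l by (intro tendsto_intros) (auto simp: prob_lim_def)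
    hence "eventually (\<lambda>p. K * expectation (\<lambda>\<omega>. min 1 \<bar>Y p \<omega> - Z \<omega>\<bar>) < e / 2) sequentially"
      using e by (intro order_tendstoD) auto
    thus "eventually (\<lambda>p. dist (expectation (Y p)) (expectation Z) < e) sequentially"
    proof eventually_elim
      case (elim p)
      show ?case using bd[OF K(1), of p] elim K2 unfolding dist_real_def by linarith
    qed
  qed
qed

end

text \<open>Stated for all \<open>N\<close>, to be specialised to \<open>k * 2 ^ p\<close>. It
  presents the drift integral as a pointwise limit of Euler sums, from which its measurability
  follows as well.\<close>

lemma riemann_sum_tendsto:
  fixes g :: "real \<Rightarrow> real"
  assumes ab: "a \<le> b" and g: "continuous_on {a..b} g"
  shows "(\<lambda>N. \<Sum>l<N. g (a + real l * ((b - a) / N)) * ((b - a) / N)) \<longlonglongrightarrow> integral {a..b} g"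
proof (cases "a = b")
  case False
  with ab have ab: "a < b" by simp
  show ?thesis
  proof (rule LIMSEQ_I)
    fix r :: real assume r: "r > 0"
    define e where "e = r / (2 * (b - a))"
    have e: "e > 0" using r ab by (simp add: e_def)
    have "uniformly_continuous_on {a..b} g" by (rule compact_uniformly_continuous[OF g]) simp
    then obtain d where d: "d > 0" "\<And>u v. u \<in> {a..b} \<Longrightarrow> v \<in> {a..b} \<Longrightarrow> dist v u < d \<Longrightarrow> dist (g v) (g u) < e"
      unfolding uniformly_continuous_on_def using e by metis
    obtain N0 :: nat where N0: "(b - a) / d < N0" using reals_Archimedean2 by blast
    show "\<exists>no. \<forall>N\<ge>no. norm ((\<Sum>l<N. g (a + real l * ((b - a) / N)) * ((b - a) / N)) - integral {a..b} g) < r"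
    proof (intro exI[of _ "Suc N0"] allI impI)
      fix N assume N: "Suc N0 \<le> N"
      define q where "q = (b - a) / N"
      have q: "q > 0" "N * q = b - a" using N ab by (auto simp: q_def)
      have "b - a < N0 * d" using N0 d(1) by (simp add: field_simps)
      also have "\<dots> \<le> N * d" using N d(1) by (intro mult_right_mono) auto
      finally have qd: "q < d" using N by (simp add: q_def field_simps)
      have in_ab: "a + real l * q \<le> b" if "l \<le> N" for l
        using mult_right_mono[of "real l" "real N" q] that q by simp
      have int: "g integrable_on {u..v}" if "a \<le> u" "v \<le> b" for u v
        using g that by (intro integrable_continuous_real continuous_on_subset[OF g]) auto
      have split: "integral {a..a + real n * q} g = (\<Sum>l<n. integral {a + real l * q..a + real (Suc l) * q} g)" if "n \<le> N" for n
        using that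
      proof (induction n)
        case (Suc n)
        have "integral {a..a + real n * q} g + integral {a + real n * q..a + real (Suc n) * q} g = integral {a..a + real (Suc n) * q} g"
          using q in_ab[OF Suc.prems] by (intro Henstock_Kurzweil_Integration.integral_combine int) (auto simp: distrib_right)
        thus ?case using Suc by simp
      qed simp
      have cell: "\<bar>g (a + real l * q) * q - integral {a + real l * q..a + real (Suc l) * q} g\<bar> \<le> e * q" if "l < N" for l
      proof -
        let ?u = "a + real l * q" and ?v = "a + real (Suc l) * q"
        have uv: "a \<le> ?u" "?u \<le> ?v" "?v \<le> b" "?v - ?u = q"
          using q in_ab[of "Suc l"] that by (auto simp: distrib_right)
        have "norm (integral {?u..?v} (\<lambda>s. g s - g ?u)) \<le> e * (?v - ?u)"
        proof (rule integral_bound[OF uv(2)])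
          show "continuous_on {?u..?v} (\<lambda>s. g s - g ?u)"
            using uv by (intro continuous_intros continuous_on_subset[OF g]) auto
          fix s assume "s \<in> {?u..?v}"
          thus "norm (g s - g ?u) \<le> e" using d(2)[of ?u s] uv qd by (auto simp: dist_real_def)
        qed
        moreover have "integral {?u..?v} (\<lambda>s. g s - g ?u) = integral {?u..?v} g - g ?u * q"
          using uv int[of ?u ?v] by (subst integral_diff) auto
        ultimately show ?thesis using uv(4) by (simp add: abs_minus_commute)
      qed
      have "(\<Sum>l<N. g (a + real l * q) * q) - integral {a..b} g =
          (\<Sum>l<N. g (a + real l * q) * q - integral {a + real l * q..a + real (Suc l) * q} g)"
        using split[of N] q by (simp add: sum_subtractf)
      also have "\<bar>\<dots>\<bar> \<le> (\<Sum>l<N. e * q)"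
        by (rule order_trans[OF sum_abs]) (intro sum_mono cell, auto)
      also have "\<dots> = e * (b - a)" using q by simp
      also have "\<dots> < r" using ab r by (simp add: e_def field_simps)
      finally show "norm ((\<Sum>l<N. g (a + real l * ((b - a) / N)) * ((b - a) / N)) - integral {a..b} g) < r"
        unfolding q_def by simp
    qed
  qed
qed simp

subsection \<open>Bounded diffusions on a common grid\<close>

context brownian_motion
begin

lemma integrable_bounded_F:
  fixes f :: "'a \<Rightarrow> real"
  assumes "f \<in> borel_measurable (F s)" "\<And>\<omega>. \<omega> \<in> space M \<Longrightarrow> \<bar>f \<omega>\<bar> \<le> B"
  shows "integrable M f"
  using assms measurable_F_M[OF assms(1)] by (intro integrable_const_bound[where B=B]) auto

text \<open>A weighted Euler sum with bounded adapted coefficients. It is instantiated twice: with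
  the coefficients of the diffusion, which bounds the increments of \<open>X\<close>, and with their
  deviations from the values at the start of a step, which bounds the remainder. One constant
  \<open>B\<close> covers weight and coefficients alike.\<close>

context
  fixes s \<delta> B :: real and N :: nat and Z :: "'a \<Rightarrow> real"
    and \<beta> :: "nat \<Rightarrow> 'a \<Rightarrow> real" and V :: "nat \<Rightarrow> 'a \<Rightarrow> real^'n" and Y :: "'a \<Rightarrow> real"
  assumes s: "0 \<le> s" and \<delta>: "0 < \<delta>"
    and Z: "Z \<in> borel_measurable (F s)" "\<And>\<omega>. \<omega> \<in> space M \<Longrightarrow> \<bar>Z \<omega>\<bar> \<le> B"
    and \<beta>: "\<And>l. l < N \<Longrightarrow> \<beta> l \<in> borel_measurable (F (s + real l * \<delta>))"
      "\<And>l \<omega>. l < N \<Longrightarrow> \<omega> \<in> space M \<Longrightarrow> \<bar>\<beta> l \<omega>\<bar> \<le> B"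
    and V: "\<And>l. l < N \<Longrightarrow> V l \<in> borel_measurable (F (s + real l * \<delta>))"
      "\<And>l \<omega>. l < N \<Longrightarrow> \<omega> \<in> space M \<Longrightarrow> norm (V l \<omega>) \<le> B"
  defines "Y \<equiv> \<lambda>\<omega>. \<Sum>l<N. \<beta> l \<omega> * \<delta> + V l \<omega> \<bullet> (W (s + real (Suc l) * \<delta>) \<omega> - W (s + real l * \<delta>) \<omega>)"
begin

lemma Z_F: "Z \<in> borel_measurable (F (s + real l * \<delta>))"
  by (rule measurable_F_mono[OF Z(1)]) (use \<delta> in simp)

lemma step_integrable:
  assumes "l < N"
  shows "integrable M (\<lambda>\<omega>. Z \<omega> * \<beta> l \<omega>)" "integrable M (\<lambda>\<omega>. (Z \<omega> * \<beta> l \<omega>)\<^sup>2)"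
    "integrable M (\<lambda>\<omega>. (Z \<omega>)\<^sup>2 * (V l \<omega> \<bullet> V l \<omega>))"
proof -
  note [measurable] = Z_F[of l] \<beta>(1)[OF assms] V(1)[OF assms]
  have B: "0 \<le> B" if "\<omega> \<in> space M" for \<omega> using Z(2)[OF that] by linarith
  have zb: "\<bar>Z \<omega> * \<beta> l \<omega>\<bar> \<le> B * B" if "\<omega> \<in> space M" for \<omega>
    using that Z(2) \<beta>(2)[OF assms] B unfolding abs_mult by (intro mult_mono) auto
  show "integrable M (\<lambda>\<omega>. Z \<omega> * \<beta> l \<omega>)"
    by (rule integrable_bounded_F[where s="s + real l * \<delta>" and B="B * B", OF _ zb]) measurable
  show "integrable M (\<lambda>\<omega>. (Z \<omega> * \<beta> l \<omega>)\<^sup>2)"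
  proof (rule integrable_bounded_F[where s="s + real l * \<delta>" and B="(B * B)\<^sup>2"])
    fix \<omega> assume "\<omega> \<in> space M"
    thus "\<bar>(Z \<omega> * \<beta> l \<omega>)\<^sup>2\<bar> \<le> (B * B)\<^sup>2" using zb power_mono[of "\<bar>Z \<omega> * \<beta> l \<omega>\<bar>" "B * B" 2] by simp
  qed measurable
  show "integrable M (\<lambda>\<omega>. (Z \<omega>)\<^sup>2 * (V l \<omega> \<bullet> V l \<omega>))"
  proof (rule integrable_bounded_F[where s="s + real l * \<delta>" and B="B\<^sup>2 * B\<^sup>2"])
    fix \<omega> assume w: "\<omega> \<in> space M"
    have "(Z \<omega>)\<^sup>2 \<le> B\<^sup>2" using power_mono[OF Z(2)[OF w], of 2] by simp
    moreover have "V l \<omega> \<bullet> V l \<omega> \<le> B\<^sup>2"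
      using power_mono[OF V(2)[OF assms w], of 2] by (simp add: power2_norm_eq_inner)
    ultimately show "\<bar>(Z \<omega>)\<^sup>2 * (V l \<omega> \<bullet> V l \<omega>)\<bar> \<le> B\<^sup>2 * B\<^sup>2"
      unfolding abs_mult by (intro mult_mono) auto
  qed measurable
qed

lemma weighted_sum_measurable: "Y \<in> borel_measurable M"
  unfolding Y_def
proof (intro borel_measurable_sum)
  fix l assume "l \<in> {..<N}"
  hence l: "l < N" by simp
  note [measurable] = measurable_F_M[OF \<beta>(1)[OF l]] measurable_F_M[OF V(1)[OF l]]
  have [measurable]: "W (s + real (Suc l) * \<delta>) \<in> borel_measurable M" "W (s + real l * \<delta>) \<in> borel_measurable M"
    using s \<delta> by (auto intro!: W_measurable)
  show "(\<lambda>\<omega>. \<beta> l \<omega> * \<delta> + V l \<omega> \<bullet> (W (s + real (Suc l) * \<delta>) \<omega> - W (s + real l * \<delta>) \<omega>)) \<in> borel_measurable M"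
    by measurable
qed

text \<open>Cauchy-Schwarz bounds the drift part by \<open>C * (real N * \<delta>)\<^sup>2\<close>,
  the isometry bounds the noise part by \<open>C * (real N * \<delta>)\<close>. As the time span is
  at most 1, the first bound is absorbed by the second; the factor 4 comes from (u + v)^2 <= 2 u^2 +
  2 v^2.\<close>

lemma weighted_sum_square:
  assumes N: "real N * \<delta> \<le> 1"
    and C: "\<And>l. l < N \<Longrightarrow> expectation (\<lambda>\<omega>. (Z \<omega> * \<beta> l \<omega>)\<^sup>2) \<le> C"
      "\<And>l. l < N \<Longrightarrow> expectation (\<lambda>\<omega>. (Z \<omega>)\<^sup>2 * (V l \<omega> \<bullet> V l \<omega>)) \<le> C"
  shows "integrable M (\<lambda>\<omega>. (Z \<omega> * Y \<omega>)\<^sup>2)"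
    and "expectation (\<lambda>\<omega>. (Z \<omega> * Y \<omega>)\<^sup>2) \<le> 4 * C * (real N * \<delta>)"
proof -
  define t where "t l = s + real l * \<delta>" for l
  have t: "0 \<le> t 0" "\<And>l. t l < t (Suc l)" "\<And>l. t (Suc l) - t l = \<delta>"
    using s \<delta> by (auto simp: t_def algebra_simps)
  define D where "D \<omega> = (\<Sum>l<N. Z \<omega> * \<beta> l \<omega> * \<delta>)" for \<omega>
  define G where "G \<omega> = (\<Sum>l<N. (Z \<omega> *\<^sub>R V l \<omega>) \<bullet> (W (t (Suc l)) \<omega> - W (t l) \<omega>))" for \<omega>
  have ZY: "Z \<omega> * Y \<omega> = D \<omega> + G \<omega>" for \<omega>
    unfolding D_def G_def Y_def t_def sum_distrib_left sum.distrib[symmetric]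
    by (intro sum.cong) (auto simp: algebra_simps)
  have iso: "integrable M (\<lambda>\<omega>. (G \<omega>)\<^sup>2)"
    "expectation (\<lambda>\<omega>. (G \<omega>)\<^sup>2) = (\<Sum>l<N. (t (Suc l) - t l) * expectation (\<lambda>\<omega>. (Z \<omega> *\<^sub>R V l \<omega>) \<bullet> (Z \<omega> *\<^sub>R V l \<omega>)))"
  proof -
    have m: "(\<lambda>\<omega>. Z \<omega> *\<^sub>R V l \<omega>) \<in> borel_measurable (F (t l))" if "l < N" for l
      using Z_F[of l] V(1)[OF that] unfolding t_def by measurable
    have bd: "norm (Z \<omega> *\<^sub>R V l \<omega>) \<le> B * B" if "l < N" "\<omega> \<in> space M" for l \<omega>
      using Z(2)[OF that(2)] V(2)[OF that] by (simp, intro mult_mono) auto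
    note I = ito_isometry[OF t(1,2) m bd]
    show "integrable M (\<lambda>\<omega>. (G \<omega>)\<^sup>2)"
      "expectation (\<lambda>\<omega>. (G \<omega>)\<^sup>2) = (\<Sum>l<N. (t (Suc l) - t l) * expectation (\<lambda>\<omega>. (Z \<omega> *\<^sub>R V l \<omega>) \<bullet> (Z \<omega> *\<^sub>R V l \<omega>)))"
      unfolding G_def using I(2,3) by auto
  qed
  have ZV: "(Z \<omega> *\<^sub>R V l \<omega>) \<bullet> (Z \<omega> *\<^sub>R V l \<omega>) = (Z \<omega>)\<^sup>2 * (V l \<omega> \<bullet> V l \<omega>)" for l \<omega>
    by (simp add: power2_eq_square)
  have "expectation (\<lambda>\<omega>. (G \<omega>)\<^sup>2) \<le> (\<Sum>l<N. \<delta> * C)"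
    unfolding iso(2) ZV t(3) using C(2) \<delta> by (intro sum_mono mult_left_mono) auto
  hence EG: "expectation (\<lambda>\<omega>. (G \<omega>)\<^sup>2) \<le> C * (real N * \<delta>)" by (simp add: mult_ac)
  define D2 where "D2 \<omega> = (\<Sum>l<N. (Z \<omega> * \<beta> l \<omega>)\<^sup>2) * (real N * \<delta>\<^sup>2)" for \<omega>
  have D: "(D \<omega>)\<^sup>2 \<le> D2 \<omega>" for \<omega>
    using sum_squared_le_sum_of_squares[of "\<lambda>l. Z \<omega> * \<beta> l \<omega> * \<delta>" "{..<N}"]
    by (simp add: D_def D2_def power_mult_distrib sum_distrib_left sum_distrib_right mult_ac)
  have iD2: "integrable M D2"
    unfolding D2_def using step_integrable(2) by (intro integrable_mult_left Bochner_Integration.integrable_sum) auto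
  have "expectation D2 = (\<Sum>l<N. expectation (\<lambda>\<omega>. (Z \<omega> * \<beta> l \<omega>)\<^sup>2)) * (real N * \<delta>\<^sup>2)"
    unfolding D2_def using step_integrable(2)
    by (subst integral_mult_left_zero) (auto simp: Bochner_Integration.integral_sum)
  also have "\<dots> \<le> (\<Sum>l<N. C) * (real N * \<delta>\<^sup>2)" using C(1) by (intro mult_right_mono sum_mono) auto
  also have "\<dots> = C * (real N * \<delta>) * (real N * \<delta>)" by (simp add: power2_eq_square)
  also have "\<dots> \<le> C * (real N * \<delta>) * 1"
  \<comment> \<open>The sign of \<open>C\<close> is read off from its bound for the first step,
    which exists only for positive \<open>N\<close>.\<close>
  proof (cases "N = 0")
    case False
    have "0 \<le> expectation (\<lambda>\<omega>. (Z \<omega> * \<beta> 0 \<omega>)\<^sup>2)" by (rule integral_nonneg_AE) auto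
    also have "\<dots> \<le> C" using False by (intro C(1)) simp
    finally have "0 \<le> C" .
    thus ?thesis using N \<delta> by (intro mult_left_mono) auto
  qed simp
  finally have ED: "expectation D2 \<le> C * (real N * \<delta>)" by simp
  have le: "(Z \<omega> * Y \<omega>)\<^sup>2 \<le> 2 * D2 \<omega> + 2 * (G \<omega>)\<^sup>2" for \<omega>
  proof -
    have "0 \<le> (D \<omega> - G \<omega>)\<^sup>2" by simp
    hence "(Z \<omega> * Y \<omega>)\<^sup>2 \<le> 2 * (D \<omega>)\<^sup>2 + 2 * (G \<omega>)\<^sup>2" unfolding ZY by (simp add: power2_eq_square algebra_simps)
    thus ?thesis using D[of \<omega>] by linarith
  qed
  have [measurable]: "Y \<in> borel_measurable M" "Z \<in> borel_measurable M"
    using weighted_sum_measurable measurable_F_M[OF Z(1)] by auto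
  show i: "integrable M (\<lambda>\<omega>. (Z \<omega> * Y \<omega>)\<^sup>2)"
  proof (rule Bochner_Integration.integrable_bound[where f="\<lambda>\<omega>. 2 * D2 \<omega> + 2 * (G \<omega>)\<^sup>2"])
    show "AE \<omega> in M. norm ((Z \<omega> * Y \<omega>)\<^sup>2) \<le> norm (2 * D2 \<omega> + 2 * (G \<omega>)\<^sup>2)"
      using le by (intro AE_I2) (simp add: order_trans[OF _ abs_ge_self])
  qed (use iD2 iso in auto)
  have "expectation (\<lambda>\<omega>. (Z \<omega> * Y \<omega>)\<^sup>2) \<le> expectation (\<lambda>\<omega>. 2 * D2 \<omega> + 2 * (G \<omega>)\<^sup>2)"
    using i iD2 iso le by (intro integral_mono) auto
  also have "\<dots> = 2 * expectation D2 + 2 * expectation (\<lambda>\<omega>. (G \<omega>)\<^sup>2)" using iD2 iso by simp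
  finally show "expectation (\<lambda>\<omega>. (Z \<omega> * Y \<omega>)\<^sup>2) \<le> 4 * C * (real N * \<delta>)" using ED EG by simp
qed

text \<open>The noise terms have mean zero, so the mean sees the drift coefficients alone. This is
  what makes the mean of the remainder smaller than its L2 norm.\<close>

lemma weighted_sum_mean:
  "expectation (\<lambda>\<omega>. Z \<omega> * Y \<omega>) = (\<Sum>l<N. expectation (\<lambda>\<omega>. Z \<omega> * \<beta> l \<omega>)) * \<delta>"
proof -
  have iZ: "integrable M Z" using Z by (rule integrable_bounded_F)
  have eq: "(\<lambda>\<omega>. Z \<omega> * Y \<omega>) = (\<lambda>\<omega>. \<Sum>l<N. Z \<omega> * \<beta> l \<omega> * \<delta> +
      Z \<omega> * (V l \<omega> \<bullet> (W (s + real (Suc l) * \<delta>) \<omega> - W (s + real l * \<delta>) \<omega>)))"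
    unfolding Y_def sum_distrib_left by (simp add: distrib_left mult.assoc)
  have g: "integrable M (\<lambda>\<omega>. Z \<omega> * (V l \<omega> \<bullet> (W (s + real (Suc l) * \<delta>) \<omega> - W (s + real l * \<delta>) \<omega>)))"
    "expectation (\<lambda>\<omega>. Z \<omega> * (V l \<omega> \<bullet> (W (s + real (Suc l) * \<delta>) \<omega> - W (s + real l * \<delta>) \<omega>))) = 0" if "l < N" for l
    using s \<delta> step_mean[OF _ _ Z_F iZ V(1)[OF that] V(2)[OF that], of "s + real (Suc l) * \<delta>"]
    by (auto simp: distrib_right)
  have "expectation (\<lambda>\<omega>. Z \<omega> * Y \<omega>) = (\<Sum>l<N. expectation (\<lambda>\<omega>. Z \<omega> * \<beta> l \<omega> * \<delta> +
      Z \<omega> * (V l \<omega> \<bullet> (W (s + real (Suc l) * \<delta>) \<omega> - W (s + real l * \<delta>) \<omega>))))"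
    unfolding eq using step_integrable(1) g(1)
    by (intro Bochner_Integration.integral_sum Bochner_Integration.integrable_add integrable_mult_left) auto
  also have "\<dots> = (\<Sum>l<N. expectation (\<lambda>\<omega>. Z \<omega> * \<beta> l \<omega>) * \<delta>)"
  proof (intro sum.cong refl)
    fix l assume "l \<in> {..<N}"
    hence l: "l < N" by simp
    show "expectation (\<lambda>\<omega>. Z \<omega> * \<beta> l \<omega> * \<delta> + Z \<omega> * (V l \<omega> \<bullet> (W (s + real (Suc l) * \<delta>) \<omega> - W (s + real l * \<delta>) \<omega>))) =
       expectation (\<lambda>\<omega>. Z \<omega> * \<beta> l \<omega>) * \<delta>"
      using step_integrable(1)[OF l] g[OF l]
      by (subst Bochner_Integration.integral_add) auto
  qed
  finally show ?thesis by (simp add: sum_distrib_right)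
qed

end

end

section \<open>Diffusions as limits of Euler sums\<close>

text \<open>Bounds and Lipschitz estimates are required only on \<open>S\<close>, where the paths
  live, because the intended coefficients are polynomials. Continuity is global, so that
  compositions with \<open>X\<close> are measurable. \<open>c y $ i\<close> is a row of the
  diffusion matrix, to be paired with the Brownian increment.\<close>

locale ito_diffusion = brownian_motion M F W
  for M :: "'a measure" and F and W :: "real \<Rightarrow> 'a \<Rightarrow> real^'n" +
  fixes X :: "real \<Rightarrow> 'a \<Rightarrow> real^'n" and b :: "real^'n \<Rightarrow> real^'n" and c :: "real^'n \<Rightarrow> real^'n^'n"
    and S :: "(real^'n) set" and K :: real
  assumes X_adapted: "0 \<le> t \<Longrightarrow> X t \<in> borel_measurable (F t)"
    and X_cont: "\<omega> \<in> space M \<Longrightarrow> continuous_on {0..} (\<lambda>t. X t \<omega>)"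
    and X_in: "\<omega> \<in> space M \<Longrightarrow> 0 \<le> t \<Longrightarrow> X t \<omega> \<in> S"
    and b_cont: "continuous_on UNIV b" and c_cont: "continuous_on UNIV c"
    and b_bound: "y \<in> S \<Longrightarrow> \<bar>b y $ i\<bar> \<le> K"
    and b_lip: "y \<in> S \<Longrightarrow> z \<in> S \<Longrightarrow> \<bar>b y $ i - b z $ i\<bar> \<le> K * norm (y - z)"
    and c_bound: "y \<in> S \<Longrightarrow> norm (c y $ i) \<le> K"
    and c_lip: "y \<in> S \<Longrightarrow> z \<in> S \<Longrightarrow> norm (c y $ i - c z $ i) \<le> K * norm (y - z)"
    and equation: "0 \<le> t \<Longrightarrow> conv_in_prob M
        (\<lambda>m \<omega>. \<Sum>j\<in>UNIV. ito_sum W (\<lambda>s \<omega>'. c (X s \<omega>') $ i $ j) j t m \<omega>)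
        (\<lambda>\<omega>. X t \<omega> $ i - X 0 \<omega> $ i - integral {0..t} (\<lambda>s. b (X s \<omega>) $ i))"
begin

lemma b_measurable [measurable]: "(\<lambda>y. b y $ i) \<in> borel_measurable borel"
  and c_measurable [measurable]: "(\<lambda>y. c y $ i) \<in> borel_measurable borel"
  and nth_measurable [measurable]: "(\<lambda>y :: real^'n. y $ i) \<in> borel_measurable borel"
  by (intro borel_measurable_continuous_onI continuous_intros b_cont c_cont)+

lemma bX_F: "0 \<le> t \<Longrightarrow> (\<lambda>\<omega>. b (X t \<omega>) $ i) \<in> borel_measurable (F t)"
  and cX_F: "0 \<le> t \<Longrightarrow> (\<lambda>\<omega>. c (X t \<omega>) $ i) \<in> borel_measurable (F t)"
  and X_nth_F: "0 \<le> t \<Longrightarrow> (\<lambda>\<omega>. X t \<omega> $ i) \<in> borel_measurable (F t)"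
  using measurable_compose[OF X_adapted b_measurable] measurable_compose[OF X_adapted c_measurable]
    measurable_compose[OF X_adapted nth_measurable] by auto

text \<open>The assumption \<open>equation\<close> uses dyadic partitions of \<open>[0, t]\<close> for each \<open>t\<close> separately. For \<open>t = k h\<close>
  all these partitions are refined by the grid of mesh \<open>h / 2\<^sup>p\<close>, and passing to this common
  grid changes the sums by a term vanishing in L2.\<close>

lemma euler_sums_from_zero:
  assumes h: "0 < h"
  shows "prob_lim M (\<lambda>p \<omega>. \<Sum>l<k * 2 ^ p. b (X (real l * (h / 2 ^ p)) \<omega>) $ i * (h / 2 ^ p) +
      c (X (real l * (h / 2 ^ p)) \<omega>) $ i \<bullet> (W (real (Suc l) * (h / 2 ^ p)) \<omega> - W (real l * (h / 2 ^ p)) \<omega>))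
    (\<lambda>\<omega>. X (real k * h) \<omega> $ i - X 0 \<omega> $ i)"
proof (cases "k = 0")
  case True
  thus ?thesis by (simp add: prob_lim_pointwise)
next
  case False
  hence k: "k > 0" by simp
  define d where "d p = h / 2 ^ p" for p :: nat
  have d: "d p > 0" for p using h by (simp add: d_def)
  have kd: "real (k * 2 ^ p) * d p = real k * h" for p by (simp add: d_def)
  define T where "T = real k * h"
  have T: "T > 0" using k h by (simp add: T_def)
  have bX_M [measurable]: "(\<lambda>\<omega>. b (X t \<omega>) $ i) \<in> borel_measurable M" if "0 \<le> t" for t
    using measurable_F_M[OF bX_F[OF that]] .
  define R where "R p \<omega> = (\<Sum>l<k * 2 ^ p. b (X (real l * d p) \<omega>) $ i * d p)" for p \<omega>
  have R_M: "R p \<in> borel_measurable M" for p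
    unfolding R_def using d by (intro borel_measurable_sum borel_measurable_times bX_M) (auto simp: less_imp_le)
  \<comment> \<open>The grid of mesh \<open>d p\<close> is the uniform partition of
    \<open>[0, T]\<close> into \<open>k * 2 ^ p\<close> cells, so these sums are a subsequence of
    all uniform Riemann sums.\<close>
  have R_lim: "(\<lambda>p. R p \<omega>) \<longlonglongrightarrow> integral {0..T} (\<lambda>s. b (X s \<omega>) $ i)" if w: "\<omega> \<in> space M" for \<omega>
  proof -
    have "continuous_on {0..T} (\<lambda>s. b (X s \<omega>) $ i)"
      by (intro continuous_intros continuous_on_compose2[OF b_cont] continuous_on_subset[OF X_cont[OF w]]) auto
    from riemann_sum_tendsto[OF less_imp_le[OF T] this]
    have "(\<lambda>N. \<Sum>l<N. b (X (real l * (T / real N)) \<omega>) $ i * (T / real N)) \<longlonglongrightarrow> integral {0..T} (\<lambda>s. b (X s \<omega>) $ i)"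
      by simp
    moreover have "filterlim (\<lambda>p. k * 2 ^ p) at_top (at_top :: nat filter)"
      using k by (intro filterlim_subseq strict_monoI) auto
    ultimately have "(\<lambda>p. \<Sum>l<k * 2 ^ p. b (X (real l * (T / real (k * 2 ^ p))) \<omega>) $ i * (T / real (k * 2 ^ p))) \<longlonglongrightarrow> integral {0..T} (\<lambda>s. b (X s \<omega>) $ i)"
      by (rule filterlim_compose)
    moreover have "T / real (k * 2 ^ p) = d p" for p using k by (simp add: T_def d_def)
    ultimately show ?thesis by (simp only: R_def)
  qed
  have I_M: "(\<lambda>\<omega>. integral {0..T} (\<lambda>s. b (X s \<omega>) $ i)) \<in> borel_measurable M"
    by (rule borel_measurable_LIMSEQ_real[OF R_lim R_M])
  have limR: "prob_lim M R (\<lambda>\<omega>. integral {0..T} (\<lambda>s. b (X s \<omega>) $ i))"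
    by (rule prob_lim_pointwise[OF R_M I_M R_lim])

  define \<Delta> where "\<Delta> p l \<omega> = W (real (Suc l) * d p) \<omega> - W (real l * d p) \<omega>" for p l \<omega>
  \<comment> \<open>The dyadic Ito sum for \<open>[0, T]\<close>, rewritten on the fine grid: one
    dyadic cell consists of \<open>k\<close> fine ones, and \<open>k * (l div k)\<close> is the
    index of its left end, where the integrand is frozen. \<open>J\<close> below evaluates the
    integrand at every fine grid point instead.\<close>
  define I where "I p \<omega> = (\<Sum>l<k * 2 ^ p. c (X (real (k * (l div k)) * d p) \<omega>) $ i \<bullet> \<Delta> p l \<omega>)" for p \<omega>
  define J where "J p \<omega> = (\<Sum>l<k * 2 ^ p. c (X (real l * d p) \<omega>) $ i \<bullet> \<Delta> p l \<omega>)" for p \<omega>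
  have I_eq: "(\<Sum>j\<in>UNIV. ito_sum W (\<lambda>s \<omega>'. c (X s \<omega>') $ i $ j) j T p \<omega>) = I p \<omega>" for p \<omega>
  proof -
    have time: "T * real m / 2 ^ p = real (k * m) * d p" for m by (simp add: T_def d_def)
    have "(\<Sum>j\<in>UNIV. ito_sum W (\<lambda>s \<omega>'. c (X s \<omega>') $ i $ j) j T p \<omega>) =
      (\<Sum>m<2 ^ p. c (X (real (k * m) * d p) \<omega>) $ i \<bullet> (W (real (k * Suc m) * d p) \<omega> - W (real (k * m) * d p) \<omega>))"
      unfolding ito_sum_def time by (subst sum.swap) (simp add: inner_vec_def)
    also have "\<dots> = (\<Sum>m<2 ^ p. \<Sum>l\<in>{m * k..<m * k + k}. c (X (real (k * (l div k)) * d p) \<omega>) $ i \<bullet> \<Delta> p l \<omega>)"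
    proof (intro sum.cong refl)
      fix m
      have dv: "l div k = m" if "l \<in> {m * k..<m * k + k}" for l
        using that k by (intro div_nat_eqI) (auto simp: mult.commute)
      have "(\<Sum>l\<in>{m * k..<m * k + k}. c (X (real (k * (l div k)) * d p) \<omega>) $ i \<bullet> \<Delta> p l \<omega>) =
        (\<Sum>l\<in>{m * k..<m * k + k}. c (X (real (k * m) * d p) \<omega>) $ i \<bullet> \<Delta> p l \<omega>)"
        using dv by (intro sum.cong) auto
      also have "\<dots> = c (X (real (k * m) * d p) \<omega>) $ i \<bullet> (\<Sum>l\<in>{m * k..<m * k + k}. \<Delta> p l \<omega>)"
        by (simp add: inner_sum_right)
      also have "(\<Sum>l\<in>{m * k..<m * k + k}. \<Delta> p l \<omega>) = W (real (k * Suc m) * d p) \<omega> - W (real (k * m) * d p) \<omega>"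
        unfolding \<Delta>_def using sum_Suc_diff'[of "m * k" "m * k + k" "\<lambda>l. W (real l * d p) \<omega>"]
        by (simp add: mult.commute add.commute)
      finally show "c (X (real (k * m) * d p) \<omega>) $ i \<bullet> (W (real (k * Suc m) * d p) \<omega> - W (real (k * m) * d p) \<omega>) =
        (\<Sum>l\<in>{m * k..<m * k + k}. c (X (real (k * (l div k)) * d p) \<omega>) $ i \<bullet> \<Delta> p l \<omega>)" by simp
    qed
    also have "\<dots> = I p \<omega>" unfolding I_def by (subst sum.nat_group) (simp add: mult.commute)
    finally show ?thesis .
  qed
  have \<Delta>_M: "\<Delta> p l \<in> borel_measurable M" for p l
    unfolding \<Delta>_def using d[of p] by (intro borel_measurable_diff W_measurable) auto
  have cX_M: "(\<lambda>\<omega>. c (X t \<omega>) $ i) \<in> borel_measurable M" if "0 \<le> t" for t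
    using measurable_F_M[OF cX_F[OF that]] .
  have I_M': "I p \<in> borel_measurable M" and J_M: "J p \<in> borel_measurable M" for p
    unfolding I_def J_def using d[of p] by (intro borel_measurable_sum borel_measurable_inner \<Delta>_M cX_M; simp)+
  have X_M: "(\<lambda>\<omega>. X t \<omega> $ i) \<in> borel_measurable M" if "0 \<le> t" for t
    using measurable_F_M[OF X_nth_F[OF that]] .
  have limI: "prob_lim M I (\<lambda>\<omega>. X T \<omega> $ i - X 0 \<omega> $ i - integral {0..T} (\<lambda>s. b (X s \<omega>) $ i))"
    using equation[of T i] T unfolding I_eq
    by (intro prob_lim_if_conv_in_prob I_M' borel_measurable_diff X_M I_M) (auto simp: less_imp_le)

  define V where "V p l \<omega> = c (X (real l * d p) \<omega>) $ i - c (X (real (k * (l div k)) * d p) \<omega>) $ i" for p l \<omega>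
  have kl: "real (k * (l div k)) \<le> real l" "real l - real (k * (l div k)) \<le> real k" for l
  proof -
    have "k * (l div k) \<le> l" "l \<le> k * (l div k) + k"
      using k mod_less_divisor[of k l] mult_div_mod_eq[of k l] by linarith+
    thus "real (k * (l div k)) \<le> real l" "real l - real (k * (l div k)) \<le> real k"
      by (simp only: of_nat_le_iff, simp only: of_nat_add[symmetric] of_nat_le_iff diff_le_eq add.commute)
  qed
  have V_F: "V p l \<in> borel_measurable (F (real l * d p))" for p l
  proof -
    have "0 \<le> real (k * (l div k)) * d p" "real (k * (l div k)) * d p \<le> real l * d p"
      using d[of p] kl(1)[of l] by (auto intro: mult_right_mono simp del: of_nat_mult)
    thus ?thesis unfolding V_def using measurable_F_mono[OF cX_F] cX_F by (intro borel_measurable_diff) auto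
  qed
  have V_le: "norm (V p l \<omega>) \<le> 2 * K" if "\<omega> \<in> space M" for p l \<omega>
    unfolding V_def using d[of p] that
    by (intro order_trans[OF norm_triangle_ineq4] order_trans[OF add_mono[OF c_bound c_bound]] X_in) auto
  have JI: "J p \<omega> - I p \<omega> = (\<Sum>l<k * 2 ^ p. V p l \<omega> \<bullet> (W (real (Suc l) * d p) \<omega> - W (real l * d p) \<omega>))" for p \<omega>
    unfolding J_def I_def V_def sum_subtractf[symmetric] \<Delta>_def[symmetric] by (simp add: inner_diff_left)
  have iso: "integrable M (\<lambda>\<omega>. (J p \<omega> - I p \<omega>)\<^sup>2)"
    "expectation (\<lambda>\<omega>. (J p \<omega> - I p \<omega>)\<^sup>2) = (\<Sum>l<k * 2 ^ p. d p * expectation (\<lambda>\<omega>. V p l \<omega> \<bullet> V p l \<omega>))" for p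
  proof -
    have t: "(0::real) \<le> real 0 * d p" "\<And>l. real l * d p < real (Suc l) * d p"
      "\<And>l. real (Suc l) * d p - real l * d p = d p"
      using d[of p] by (auto simp: algebra_simps)
    note I = ito_isometry[where t="\<lambda>l. real l * d p" and V="V p" and N="k * 2 ^ p", OF t(1,2) V_F V_le]
    show "integrable M (\<lambda>\<omega>. (J p \<omega> - I p \<omega>)\<^sup>2)"
      "expectation (\<lambda>\<omega>. (J p \<omega> - I p \<omega>)\<^sup>2) = (\<Sum>l<k * 2 ^ p. d p * expectation (\<lambda>\<omega>. V p l \<omega> \<bullet> V p l \<omega>))"
      using I(2,3) unfolding JI t(3) by auto
  qed
  \<comment> \<open>Pathwise counterpart of the isometry: its mean is the squared L2 distance of
    \<open>J p\<close> and \<open>I p\<close>, and it is accessible to continuity of the paths and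
    dominated convergence.\<close>
  define \<psi> where "\<psi> p \<omega> = (\<Sum>l<k * 2 ^ p. d p * (V p l \<omega> \<bullet> V p l \<omega>))" for p \<omega>
  have V_M: "V p l \<in> borel_measurable M" for p l by (rule measurable_F_M[OF V_F])
  have VV: "V p l \<omega> \<bullet> V p l \<omega> \<le> r\<^sup>2" if "norm (V p l \<omega>) \<le> r" for p l \<omega> r
    using power_mono[OF that, of 2] by (simp add: power2_norm_eq_inner)
  have \<psi>_le: "\<psi> p \<omega> \<le> T * r\<^sup>2" if "\<And>l. l < k * 2 ^ p \<Longrightarrow> norm (V p l \<omega>) \<le> r" for p \<omega> r
  proof -
    have "\<psi> p \<omega> \<le> (\<Sum>l<k * 2 ^ p. d p * r\<^sup>2)"
      unfolding \<psi>_def using d[of p] that by (intro sum_mono mult_left_mono VV) auto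
    also have "\<dots> = T * r\<^sup>2" by (simp add: T_def d_def)
    finally show ?thesis .
  qed
  have \<psi>_nonneg: "0 \<le> \<psi> p \<omega>" for p \<omega>
    unfolding \<psi>_def using d[of p] by (intro sum_nonneg mult_nonneg_nonneg) auto
  have E\<psi>: "expectation (\<lambda>\<omega>. (J p \<omega> - I p \<omega>)\<^sup>2) = expectation (\<psi> p)" for p
  proof -
    have "integrable M (\<lambda>\<omega>. V p l \<omega> \<bullet> V p l \<omega>)" for l
      using V_M VV[OF V_le] by (intro integrable_const_bound[where B="(2 * K)\<^sup>2"]) auto
    thus ?thesis unfolding iso(2) \<psi>_def by (subst Bochner_Integration.integral_sum) auto
  qed
  have \<psi>_lim: "(\<lambda>p. \<psi> p \<omega>) \<longlonglongrightarrow> 0" if w: "\<omega> \<in> space M" for \<omega>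
  proof (rule tendstoI)
    fix e :: real assume e: "e > 0"
    define r where "r = sqrt (e / (2 * T))"
    have r: "r > 0" "T * r\<^sup>2 < e" using e T by (auto simp: r_def)
    have "uniformly_continuous_on {0..T} (\<lambda>s. c (X s \<omega>) $ i)"
      by (rule compact_uniformly_continuous)
        (auto intro!: continuous_intros continuous_on_compose2[OF c_cont] continuous_on_subset[OF X_cont[OF w]])
    then obtain q where q: "q > 0" "\<And>u v. u \<in> {0..T} \<Longrightarrow> v \<in> {0..T} \<Longrightarrow> dist v u < q \<Longrightarrow> dist (c (X v \<omega>) $ i) (c (X u \<omega>) $ i) < r"
      unfolding uniformly_continuous_on_def using r(1) by metis
    have "(\<lambda>p. T * (1 / 2) ^ p) \<longlonglongrightarrow> T * 0" by (intro tendsto_intros) auto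
    hence "(\<lambda>p. real k * d p) \<longlonglongrightarrow> 0" by (simp add: T_def d_def power_divide)
    hence "eventually (\<lambda>p. real k * d p < q) sequentially" using q(1) by (rule order_tendstoD)
    thus "eventually (\<lambda>p. dist (\<psi> p \<omega>) 0 < e) sequentially"
    proof eventually_elim
      case (elim p)
      have "\<psi> p \<omega> \<le> T * r\<^sup>2"
      proof (rule \<psi>_le)
        fix l assume l: "l < k * 2 ^ p"
        let ?u = "real (k * (l div k)) * d p" and ?v = "real l * d p"
        have uv: "?u \<le> ?v" "?v - ?u \<le> real k * d p" "0 \<le> ?u"
          using d[of p] kl[of l] by (auto simp: left_diff_distrib[symmetric] simp del: of_nat_mult intro!: mult_right_mono)
        have "?v \<le> real (k * 2 ^ p) * d p" using l d[of p] by (intro mult_right_mono) (auto simp del: of_nat_mult)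
        hence "?v \<le> T" by (simp only: kd T_def)
        hence "dist (c (X ?v \<omega>) $ i) (c (X ?u \<omega>) $ i) < r"
          using uv elim by (intro q(2)) (auto simp: dist_real_def simp del: of_nat_mult)
        thus "norm (V p l \<omega>) \<le> r" by (simp add: V_def dist_norm)
      qed
      thus ?case using r \<psi>_nonneg[of p \<omega>] by simp
    qed
  qed
  have "(\<lambda>p. expectation (\<psi> p)) \<longlonglongrightarrow> expectation (\<lambda>_. 0)"
  proof (rule integral_dominated_convergence[where w="\<lambda>_. T * (2 * K)\<^sup>2"])
    show "\<psi> p \<in> borel_measurable M" for p
      unfolding \<psi>_def using V_M by (intro borel_measurable_sum) auto
    show "AE \<omega> in M. norm (\<psi> p \<omega>) \<le> T * (2 * K)\<^sup>2" for p
      using \<psi>_le[OF V_le] \<psi>_nonneg by (intro AE_I2) auto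
  qed (use \<psi>_lim in auto)
  hence "prob_lim M (\<lambda>p \<omega>. J p \<omega> - I p \<omega>) (\<lambda>_. 0)"
    using iso I_M' J_M by (intro prob_lim_L2) (auto simp: E\<psi>)
  \<comment> \<open>Adding \<open>J - I\<close> exchanges the two noise sums; in the limits the
    drift integral cancels.\<close>
  from prob_lim_add[OF limR prob_lim_add[OF limI this]]
  have "prob_lim M (\<lambda>p \<omega>. R p \<omega> + J p \<omega>) (\<lambda>\<omega>. X T \<omega> $ i - X 0 \<omega> $ i)" by simp
  thus ?thesis by (simp add: R_def J_def \<Delta>_def d_def T_def sum.distrib)
qed

end

lemma sum_lessThan_diff:
  fixes f :: "nat \<Rightarrow> 'b::ab_group_add"
  shows "(\<Sum>l<m + k. f l) - (\<Sum>l<m. f l) = (\<Sum>l<k. f (m + l))"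
  by (induction k) (auto simp: algebra_simps)

text \<open>One factor \<open>CARD('n)\<close> is Cauchy-Schwarz for the square of the sum of
  squared coordinates, the other counts the coordinates; 3 is the Gaussian fourth moment.\<close>

lemma (in brownian_motion) incr_norm_power4:
  assumes st: "0 \<le> s" "s < t"
  shows "integrable M (\<lambda>\<omega>. norm (W t \<omega> - W s \<omega>) ^ 4)"
    and "expectation (\<lambda>\<omega>. norm (W t \<omega> - W s \<omega>) ^ 4) \<le> 3 * (real CARD('n))\<^sup>2 * (t - s)\<^sup>2"
proof -
  let ?D = "\<lambda>\<omega>. W t \<omega> - W s \<omega>"
  let ?U = "\<lambda>\<omega>. real CARD('n) * (\<Sum>j\<in>UNIV. (axis j 1 \<bullet> ?D \<omega>) ^ 4)"
  have le: "norm (?D \<omega>) ^ 4 \<le> ?U \<omega>" for \<omega>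
  proof -
    have "norm (?D \<omega>) ^ 4 = (\<Sum>j\<in>UNIV. (?D \<omega> $ j)\<^sup>2)\<^sup>2"
      unfolding power2_norm_eq_inner[of "?D \<omega>", unfolded inner_vec_def inner_real_def, folded power2_eq_square, symmetric]
      by simp
    also have "\<dots> \<le> ?U \<omega>"
      using sum_squared_le_sum_of_squares[of "\<lambda>j. (?D \<omega> $ j)\<^sup>2" UNIV]
      by (simp add: inner_axis_one mult.commute)
    finally show ?thesis .
  qed
  note I = incr_moment_integrable[OF st, where k=4]
  have iU: "integrable M ?U"
    by (intro integrable_mult_right Bochner_Integration.integrable_sum I)
  have EU: "expectation ?U = 3 * (real CARD('n))\<^sup>2 * (t - s)\<^sup>2"
    using I by (subst integral_mult_right_zero, subst Bochner_Integration.integral_sum)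
      (auto simp: incr_moments(3)[OF st] inner_axis_axis power2_eq_square)
  have m: "?D \<in> borel_measurable M" using st by (intro incr_measurable) auto
  show i: "integrable M (\<lambda>\<omega>. norm (?D \<omega>) ^ 4)"
  proof (rule Bochner_Integration.integrable_bound[OF iU])
    show "AE \<omega> in M. norm (norm (?D \<omega>) ^ 4) \<le> norm (?U \<omega>)"
      using le by (intro AE_I2) (simp add: order_trans[OF _ abs_ge_self])
  qed (use m in measurable)
  show "expectation (\<lambda>\<omega>. norm (?D \<omega>) ^ 4) \<le> 3 * (real CARD('n))\<^sup>2 * (t - s)\<^sup>2"
    unfolding EU[symmetric] using i iU le by (intro integral_mono) auto
qed

context ito_diffusion
begin

lemma K_nonneg: "0 \<le> K"
proof -
  obtain \<omega> where "\<omega> \<in> space M" using not_empty by blast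
  thus ?thesis using b_bound[OF X_in[of \<omega> 0]] by (force intro: order_trans[OF abs_ge_zero])
qed

lemma X_F: "0 \<le> t \<Longrightarrow> t \<le> u \<Longrightarrow> X t \<in> borel_measurable (F u)"
  by (rule measurable_F_mono[OF X_adapted])

lemma X_M: "0 \<le> t \<Longrightarrow> X t \<in> borel_measurable M"
  by (rule measurable_F_M[OF X_adapted])

text \<open>Subtract the sums up to \<open>s\<close> from those up to \<open>s + real n * h\<close>.
  Both times are multiples of \<open>h\<close>, so the two families of sums live on the same
  grids.\<close>

lemma euler_sums:
  assumes h: "0 < h" and s: "s = real a * h"
  shows "prob_lim M (\<lambda>p \<omega>. \<Sum>l<n * 2 ^ p. b (X (s + real l * (h / 2 ^ p)) \<omega>) $ i * (h / 2 ^ p) +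
      c (X (s + real l * (h / 2 ^ p)) \<omega>) $ i \<bullet>
        (W (s + real (Suc l) * (h / 2 ^ p)) \<omega> - W (s + real l * (h / 2 ^ p)) \<omega>))
    (\<lambda>\<omega>. X (s + real n * h) \<omega> $ i - X s \<omega> $ i)"
proof -
  define f where "f p \<omega> t = b (X t \<omega>) $ i * (h / 2 ^ p) + c (X t \<omega>) $ i \<bullet> (W (t + h / 2 ^ p) \<omega> - W t \<omega>)" for p \<omega> t
  have Suc_eq: "real (Suc l) * r = real l * r + r" for l r by (simp add: algebra_simps)
  have time: "real (a * 2 ^ p + l) * (h / 2 ^ p) = s + real l * (h / 2 ^ p)" for p l
    by (simp add: s field_simps)
  have "prob_lim M (\<lambda>p \<omega>. (\<Sum>l<(a + n) * 2 ^ p. f p \<omega> (real l * (h / 2 ^ p))) - (\<Sum>l<a * 2 ^ p. f p \<omega> (real l * (h / 2 ^ p))))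
     (\<lambda>\<omega>. (X (real (a + n) * h) \<omega> $ i - X 0 \<omega> $ i) - (X (real a * h) \<omega> $ i - X 0 \<omega> $ i))"
    unfolding f_def using prob_lim_diff[OF euler_sums_from_zero[OF h, where k="a + n"] euler_sums_from_zero[OF h, where k=a]]
    unfolding Suc_eq .
  thus ?thesis
    unfolding distrib_right[of a n] sum_lessThan_diff time
    unfolding f_def s Suc_eq by (simp add: distrib_right add.assoc)
qed

text \<open>As \<open>Z\<close> is an arbitrary bounded \<open>F s\<close>-measurable weight, this
  is the conditional estimate E[(increment)^2 | F(s)] <= 4 K^2 n h. The number \<open>n\<close> of
  grid steps is free so that, with \<open>h / 2 ^ p\<close> as mesh, every intermediate time of a
  step of length \<open>h\<close> is covered.\<close>

lemma increment_square:
  assumes h: "0 < h" and s: "s = real a * h" and n: "real n * h \<le> 1"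
    and Z: "Z \<in> borel_measurable (F s)" "\<And>\<omega>. \<omega> \<in> space M \<Longrightarrow> \<bar>Z \<omega>\<bar> \<le> B"
  shows "integrable M (\<lambda>\<omega>. (Z \<omega> * (X (s + real n * h) \<omega> $ i - X s \<omega> $ i))\<^sup>2)"
    and "expectation (\<lambda>\<omega>. (Z \<omega> * (X (s + real n * h) \<omega> $ i - X s \<omega> $ i))\<^sup>2) \<le> 4 * K\<^sup>2 * (real n * h) * expectation (\<lambda>\<omega>. (Z \<omega>)\<^sup>2)"
proof -
  have s0: "0 \<le> s" using h s by simp
  define Y where "Y p \<omega> = (\<Sum>l<n * 2 ^ p. b (X (s + real l * (h / 2 ^ p)) \<omega>) $ i * (h / 2 ^ p) +
      c (X (s + real l * (h / 2 ^ p)) \<omega>) $ i \<bullet>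
        (W (s + real (Suc l) * (h / 2 ^ p)) \<omega> - W (s + real l * (h / 2 ^ p)) \<omega>))" for p \<omega>
  have ZM: "Z \<in> borel_measurable M" by (rule measurable_F_M[OF Z(1)])
  have lim: "prob_lim M (\<lambda>p \<omega>. Z \<omega> * Y p \<omega>) (\<lambda>\<omega>. Z \<omega> * (X (s + real n * h) \<omega> $ i - X s \<omega> $ i))"
    unfolding Y_def by (rule prob_lim_mult_bounded[OF euler_sums[OF h s] ZM Z(2)])
  have iZ: "integrable M (\<lambda>\<omega>. (Z \<omega>)\<^sup>2)"
  proof (rule integrable_bounded_F[where s=s and B="B\<^sup>2"])
    fix \<omega> assume "\<omega> \<in> space M"
    thus "\<bar>(Z \<omega>)\<^sup>2\<bar> \<le> B\<^sup>2" using power_mono[OF Z(2), of \<omega> 2] by simp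
  qed (use Z in measurable)
  let ?C = "K\<^sup>2 * expectation (\<lambda>\<omega>. (Z \<omega>)\<^sup>2)"
  have sq: "integrable M (\<lambda>\<omega>. (Z \<omega> * Y p \<omega>)\<^sup>2)" "expectation (\<lambda>\<omega>. (Z \<omega> * Y p \<omega>)\<^sup>2) \<le> 4 * ?C * (real n * h)" for p
  proof -
    have d: "0 < h / 2 ^ p" using h by simp
    have t: "0 \<le> s + real l * (h / 2 ^ p)" for l using s0 h by simp
    have Nd: "real (n * 2 ^ p) * (h / 2 ^ p) = real n * h" by simp
    have Z': "\<bar>Z \<omega>\<bar> \<le> max B K" if "\<omega> \<in> space M" for \<omega> using Z(2)[OF that] by simp
    have b': "\<bar>b (X (s + real l * (h / 2 ^ p)) \<omega>) $ i\<bar> \<le> K" if "\<omega> \<in> space M" for \<omega> l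
      using b_bound X_in[OF that t] by blast
    have c': "norm (c (X (s + real l * (h / 2 ^ p)) \<omega>) $ i) \<le> K" if "\<omega> \<in> space M" for \<omega> l
      using c_bound X_in[OF that t] by blast
    have b'': "\<bar>b (X (s + real l * (h / 2 ^ p)) \<omega>) $ i\<bar> \<le> max B K" if "\<omega> \<in> space M" for \<omega> l
      using b'[OF that] by (simp add: le_max_iff_disj)
    have c'': "norm (c (X (s + real l * (h / 2 ^ p)) \<omega>) $ i) \<le> max B K" if "\<omega> \<in> space M" for \<omega> l
      using c'[OF that] by (simp add: le_max_iff_disj)
    note st = step_integrable[where s=s and \<delta>="h / 2 ^ p" and B="max B K" and N="n * 2 ^ p" and Z=Z
        and \<beta>="\<lambda>l \<omega>. b (X (s + real l * (h / 2 ^ p)) \<omega>) $ i" and V="\<lambda>l \<omega>. c (X (s + real l * (h / 2 ^ p)) \<omega>) $ i",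
        OF s0 d Z(1) Z' bX_F[OF t] b'' cX_F[OF t] c'']
    have C1: "expectation (\<lambda>\<omega>. (Z \<omega> * b (X (s + real l * (h / 2 ^ p)) \<omega>) $ i)\<^sup>2) \<le> ?C" if "l < n * 2 ^ p" for l
    proof -
      have "expectation (\<lambda>\<omega>. (Z \<omega> * b (X (s + real l * (h / 2 ^ p)) \<omega>) $ i)\<^sup>2) \<le> expectation (\<lambda>\<omega>. K\<^sup>2 * (Z \<omega>)\<^sup>2)"
      proof (intro integral_mono integrable_mult_right iZ st(2) that)
        fix \<omega> assume "\<omega> \<in> space M"
        from power_mono[OF b'[OF this, of l], of 2]
        show "(Z \<omega> * b (X (s + real l * (h / 2 ^ p)) \<omega>) $ i)\<^sup>2 \<le> K\<^sup>2 * (Z \<omega>)\<^sup>2"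
          by (simp add: power_mult_distrib mult.commute[of "K\<^sup>2"] mult_left_mono)
      qed
      thus ?thesis by simp
    qed
    have C2: "expectation (\<lambda>\<omega>. (Z \<omega>)\<^sup>2 * (c (X (s + real l * (h / 2 ^ p)) \<omega>) $ i \<bullet> c (X (s + real l * (h / 2 ^ p)) \<omega>) $ i)) \<le> ?C"
      if "l < n * 2 ^ p" for l
    proof -
      have "expectation (\<lambda>\<omega>. (Z \<omega>)\<^sup>2 * (c (X (s + real l * (h / 2 ^ p)) \<omega>) $ i \<bullet> c (X (s + real l * (h / 2 ^ p)) \<omega>) $ i)) \<le> expectation (\<lambda>\<omega>. K\<^sup>2 * (Z \<omega>)\<^sup>2)"
      proof (intro integral_mono integrable_mult_right iZ st(3) that)
        fix \<omega> assume "\<omega> \<in> space M"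
        from power_mono[OF c'[OF this, of l], of 2]
        show "(Z \<omega>)\<^sup>2 * (c (X (s + real l * (h / 2 ^ p)) \<omega>) $ i \<bullet> c (X (s + real l * (h / 2 ^ p)) \<omega>) $ i) \<le> K\<^sup>2 * (Z \<omega>)\<^sup>2"
          by (simp add: power2_norm_eq_inner mult.commute[of "K\<^sup>2"] mult_left_mono)
      qed
      thus ?thesis by simp
    qed
    have N1: "real (n * 2 ^ p) * (h / 2 ^ p) \<le> 1" using n Nd by simp
    note q = weighted_sum_square[where s=s and \<delta>="h / 2 ^ p" and B="max B K" and N="n * 2 ^ p" and Z=Z
        and \<beta>="\<lambda>l \<omega>. b (X (s + real l * (h / 2 ^ p)) \<omega>) $ i" and V="\<lambda>l \<omega>. c (X (s + real l * (h / 2 ^ p)) \<omega>) $ i",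
        OF s0 d Z(1) Z' bX_F[OF t] b'' cX_F[OF t] c'' N1 C1 C2]
    show "integrable M (\<lambda>\<omega>. (Z \<omega> * Y p \<omega>)\<^sup>2)" unfolding Y_def using q(1) by simp
    show "expectation (\<lambda>\<omega>. (Z \<omega> * Y p \<omega>)\<^sup>2) \<le> 4 * ?C * (real n * h)"
      unfolding Y_def using q(2) unfolding Nd by simp
  qed
  from prob_lim_square_bound[OF lim sq]
  show "integrable M (\<lambda>\<omega>. (Z \<omega> * (X (s + real n * h) \<omega> $ i - X s \<omega> $ i))\<^sup>2)"
    "expectation (\<lambda>\<omega>. (Z \<omega> * (X (s + real n * h) \<omega> $ i - X s \<omega> $ i))\<^sup>2) \<le> 4 * K\<^sup>2 * (real n * h) * expectation (\<lambda>\<omega>. (Z \<omega>)\<^sup>2)"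
    by (auto simp: mult_ac)
qed

lemma increment_norm_square:
  assumes "0 < h" "s = real a * h" "real n * h \<le> 1"
    and "Z \<in> borel_measurable (F s)" "\<And>\<omega>. \<omega> \<in> space M \<Longrightarrow> \<bar>Z \<omega>\<bar> \<le> B"
  shows "integrable M (\<lambda>\<omega>. (Z \<omega> * norm (X (s + real n * h) \<omega> - X s \<omega>))\<^sup>2)"
    and "expectation (\<lambda>\<omega>. (Z \<omega> * norm (X (s + real n * h) \<omega> - X s \<omega>))\<^sup>2)
      \<le> 4 * real CARD('n) * K\<^sup>2 * (real n * h) * expectation (\<lambda>\<omega>. (Z \<omega>)\<^sup>2)"
proof -
  note I = increment_square[OF assms]
  have eq: "(\<lambda>\<omega>. (Z \<omega> * norm (X (s + real n * h) \<omega> - X s \<omega>))\<^sup>2) =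
     (\<lambda>\<omega>. \<Sum>i\<in>UNIV. (Z \<omega> * (X (s + real n * h) \<omega> $ i - X s \<omega> $ i))\<^sup>2)"
    unfolding power_mult_distrib power2_norm_eq_inner inner_vec_def
    by (auto simp: sum_distrib_left power2_eq_square)
  show "integrable M (\<lambda>\<omega>. (Z \<omega> * norm (X (s + real n * h) \<omega> - X s \<omega>))\<^sup>2)"
    unfolding eq by (intro Bochner_Integration.integrable_sum I)
  have "expectation (\<lambda>\<omega>. (Z \<omega> * norm (X (s + real n * h) \<omega> - X s \<omega>))\<^sup>2) =
     (\<Sum>i\<in>UNIV. expectation (\<lambda>\<omega>. (Z \<omega> * (X (s + real n * h) \<omega> $ i - X s \<omega> $ i))\<^sup>2))"
    unfolding eq by (intro Bochner_Integration.integral_sum I)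
  also have "\<dots> \<le> (\<Sum>i\<in>(UNIV :: 'n set). 4 * K\<^sup>2 * (real n * h) * expectation (\<lambda>\<omega>. (Z \<omega>)\<^sup>2))"
    by (intro sum_mono I)
  finally show "expectation (\<lambda>\<omega>. (Z \<omega> * norm (X (s + real n * h) \<omega> - X s \<omega>))\<^sup>2)
      \<le> 4 * real CARD('n) * K\<^sup>2 * (real n * h) * expectation (\<lambda>\<omega>. (Z \<omega>)\<^sup>2)"
    by (simp add: mult_ac)
qed

end

subsection \<open>The one-step expansion\<close>

context ito_diffusion
begin

text \<open>The error of one Euler-Maruyama step.\<close>

definition remainder :: "'n \<Rightarrow> real \<Rightarrow> real \<Rightarrow> 'a \<Rightarrow> real" where
  "remainder i s h \<omega> = X (s + h) \<omega> $ i - X s \<omega> $ i - b (X s \<omega>) $ i * h - c (X s \<omega>) $ i \<bullet> (W (s + h) \<omega> - W s \<omega>)"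

text \<open>The remainder is the limit of Euler sums whose coefficients are the deviations from the
  values at \<open>s\<close>. By the Lipschitz bounds these deviations have conditional second
  moment at most \<open>C * h\<close>: a factor \<open>K\<^sup>2\<close> is the squared Lipschitz
  constant, and \<open>4 * CARD('n) * K\<^sup>2\<close> comes from the increment of
  \<open>X\<close>. Summation over a time span \<open>h\<close> gives the order
  \<open>h\<^sup>2\<close> for the square, while in the mean only the drift deviations, of size
  \<open>sqrt h\<close>, survive.\<close>

lemma remainder_bounds:
  assumes h: "0 < h" "h \<le> 1" and s: "s = real a * h"
    and Z: "Z \<in> borel_measurable (F s)" "\<And>\<omega>. \<omega> \<in> space M \<Longrightarrow> \<bar>Z \<omega>\<bar> \<le> B"
  defines "C \<equiv> 4 * real CARD('n) * K ^ 4"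
  shows "integrable M (\<lambda>\<omega>. (Z \<omega> * remainder i s h \<omega>)\<^sup>2)"
    and "expectation (\<lambda>\<omega>. (Z \<omega> * remainder i s h \<omega>)\<^sup>2) \<le> 4 * C * h\<^sup>2 * expectation (\<lambda>\<omega>. (Z \<omega>)\<^sup>2)"
    and "\<bar>expectation (\<lambda>\<omega>. (Z \<omega>)\<^sup>2 * remainder i s h \<omega>)\<bar> \<le> (1 + C) * (h * sqrt h) * expectation (\<lambda>\<omega>. (Z \<omega>)\<^sup>2)"
proof -
  have s0: "0 \<le> s" using h s by simp
  have C0: "0 \<le> C" by (simp add: C_def)
  define \<tau> where "\<tau> p l = s + real l * (h / 2 ^ p)" for p l :: nat
  have \<tau>0: "0 \<le> \<tau> p l" "s \<le> \<tau> p l" for p l using s0 h by (auto simp: \<tau>_def)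
  define \<beta> where "\<beta> p l \<omega> = b (X (\<tau> p l) \<omega>) $ i - b (X s \<omega>) $ i" for p l \<omega>
  define V where "V p l \<omega> = c (X (\<tau> p l) \<omega>) $ i - c (X s \<omega>) $ i" for p l \<omega>
  define R where "R p \<omega> = (\<Sum>l<2 ^ p. \<beta> p l \<omega> * (h / 2 ^ p) + V p l \<omega> \<bullet> (W (s + real (Suc l) * (h / 2 ^ p)) \<omega> - W (s + real l * (h / 2 ^ p)) \<omega>))" for p \<omega>
  have \<beta>_F: "\<beta> p l \<in> borel_measurable (F (s + real l * (h / 2 ^ p)))"
    and V_F: "V p l \<in> borel_measurable (F (s + real l * (h / 2 ^ p)))" for p l
    unfolding \<beta>_def V_def \<tau>_def[symmetric] using \<tau>0[of p l] s0
    by (auto intro!: borel_measurable_diff bX_F cX_F measurable_F_mono[OF bX_F] measurable_F_mono[OF cX_F])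
  have \<beta>_b: "\<bar>\<beta> p l \<omega>\<bar> \<le> 2 * K" and V_b: "norm (V p l \<omega>) \<le> 2 * K" if "\<omega> \<in> space M" for p l \<omega>
    unfolding \<beta>_def V_def
    using b_bound[OF X_in[OF that \<tau>0(1)], of p l i] b_bound[OF X_in[OF that s0], of i]
      c_bound[OF X_in[OF that \<tau>0(1)], of p l i] c_bound[OF X_in[OF that s0], of i]
      norm_triangle_ineq4[of "c (X (\<tau> p l) \<omega>) $ i" "c (X s \<omega>) $ i"] by linarith+
  have \<beta>_l: "\<bar>\<beta> p l \<omega>\<bar> \<le> K * norm (X (\<tau> p l) \<omega> - X s \<omega>)"
    and V_l: "norm (V p l \<omega>) \<le> K * norm (X (\<tau> p l) \<omega> - X s \<omega>)" if "\<omega> \<in> space M" for p l \<omega>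
    unfolding \<beta>_def V_def using b_lip c_lip X_in[OF that \<tau>0(1)] X_in[OF that s0] by auto

  have cM: "(\<lambda>\<omega>. b (X s \<omega>) $ i * h + c (X s \<omega>) $ i \<bullet> (W (s + h) \<omega> - W s \<omega>)) \<in> borel_measurable M"
    using s0 h measurable_F_M[OF bX_F[OF s0]] measurable_F_M[OF cX_F[OF s0]]
    by (intro borel_measurable_add borel_measurable_times borel_measurable_inner incr_measurable) auto
  have Req: "R p \<omega> = (\<Sum>l<1 * 2 ^ p. b (X (s + real l * (h / 2 ^ p)) \<omega>) $ i * (h / 2 ^ p) +
      c (X (s + real l * (h / 2 ^ p)) \<omega>) $ i \<bullet>
        (W (s + real (Suc l) * (h / 2 ^ p)) \<omega> - W (s + real l * (h / 2 ^ p)) \<omega>)) -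
      (b (X s \<omega>) $ i * h + c (X s \<omega>) $ i \<bullet> (W (s + h) \<omega> - W s \<omega>))" for p \<omega>
  proof -
    have "(\<Sum>l<2 ^ p. W (s + real (Suc l) * (h / 2 ^ p)) \<omega> - W (s + real l * (h / 2 ^ p)) \<omega>) = W (s + h) \<omega> - W s \<omega>"
      using sum_lessThan_telescope[of "\<lambda>l. W (s + real l * (h / 2 ^ p)) \<omega>" "2 ^ p"] by simp
    hence e0: "b (X s \<omega>) $ i * h + c (X s \<omega>) $ i \<bullet> (W (s + h) \<omega> - W s \<omega>) =
      (\<Sum>l<2 ^ p. b (X s \<omega>) $ i * (h / 2 ^ p) + c (X s \<omega>) $ i \<bullet> (W (s + real (Suc l) * (h / 2 ^ p)) \<omega> - W (s + real l * (h / 2 ^ p)) \<omega>))"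
      unfolding sum.distrib inner_sum_right[symmetric] by simp
    show ?thesis
      unfolding R_def \<beta>_def V_def \<tau>_def mult_1 e0 sum_subtractf[symmetric]
      by (intro sum.cong refl) (simp add: inner_diff_left left_diff_distrib diff_divide_distrib)
  qed
  have limR: "prob_lim M R (remainder i s h)"
  proof -
    have "prob_lim M (\<lambda>p. \<lambda>\<omega>. b (X s \<omega>) $ i * h + c (X s \<omega>) $ i \<bullet> (W (s + h) \<omega> - W s \<omega>))
        (\<lambda>\<omega>. b (X s \<omega>) $ i * h + c (X s \<omega>) $ i \<bullet> (W (s + h) \<omega> - W s \<omega>))"
      by (rule prob_lim_pointwise[OF cM cM]) simp
    from prob_lim_diff[OF euler_sums[OF h(1) s, where n=1] this]
    have "prob_lim M (\<lambda>p \<omega>. R p \<omega>) (\<lambda>\<omega>. X (s + real 1 * h) \<omega> $ i - X s \<omega> $ i - (b (X s \<omega>) $ i * h + c (X s \<omega>) $ i \<bullet> (W (s + h) \<omega> - W s \<omega>)))"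
      unfolding Req .
    thus ?thesis by (simp add: remainder_def[abs_def] diff_diff_eq add.assoc)
  qed

  have sq: "integrable M (\<lambda>\<omega>. (U \<omega> * \<beta> p l \<omega>)\<^sup>2)" (is ?i1)
      "expectation (\<lambda>\<omega>. (U \<omega> * \<beta> p l \<omega>)\<^sup>2) \<le> C * h * expectation (\<lambda>\<omega>. (U \<omega>)\<^sup>2)" (is ?e1)
      "expectation (\<lambda>\<omega>. (U \<omega>)\<^sup>2 * (V p l \<omega> \<bullet> V p l \<omega>)) \<le> C * h * expectation (\<lambda>\<omega>. (U \<omega>)\<^sup>2)" (is ?e2)
    if l: "l < 2 ^ p" and U: "U \<in> borel_measurable (F s)" "\<And>\<omega>. \<omega> \<in> space M \<Longrightarrow> \<bar>U \<omega>\<bar> \<le> B'" for U B' p l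
  proof -
    have d: "0 < h / 2 ^ p" using h by simp
    \<comment> \<open>On the refined grid \<open>s\<close> is again a grid point and
      \<open>\<tau> p l\<close> lies \<open>l\<close> fine steps after it, so the increment bound
      applies with mesh \<open>h / 2 ^ p\<close>.\<close>
    have sd: "s = real (a * 2 ^ p) * (h / 2 ^ p)" by (simp add: s)
    have "real l \<le> 2 ^ p" using l by (metis less_imp_le of_nat_le_iff of_nat_numeral of_nat_power)
    hence lh: "real l * (h / 2 ^ p) \<le> h" using h by (simp add: field_simps)
    hence l1: "real l * (h / 2 ^ p) \<le> 1" using h(2) by (rule order_trans)
    note N = increment_norm_square[OF d sd l1 U, folded \<tau>_def]
    have "K\<^sup>2 * expectation (\<lambda>\<omega>. (U \<omega> * norm (X (\<tau> p l) \<omega> - X s \<omega>))\<^sup>2) \<le>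
        K\<^sup>2 * (4 * real CARD('n) * K\<^sup>2 * (real l * (h / 2 ^ p)) * expectation (\<lambda>\<omega>. (U \<omega>)\<^sup>2))"
      by (intro mult_left_mono N) auto
    also have "\<dots> = (4 * real CARD('n) * K ^ 4 * expectation (\<lambda>\<omega>. (U \<omega>)\<^sup>2)) * (real l * (h / 2 ^ p))"
      by (simp add: power4_eq_xxxx power2_eq_square)
    also have "\<dots> \<le> (4 * real CARD('n) * K ^ 4 * expectation (\<lambda>\<omega>. (U \<omega>)\<^sup>2)) * h"
      by (intro mult_left_mono lh mult_nonneg_nonneg integral_nonneg_AE) auto
    finally have KN: "expectation (\<lambda>\<omega>. K\<^sup>2 * (U \<omega> * norm (X (\<tau> p l) \<omega> - X s \<omega>))\<^sup>2) \<le> C * h * expectation (\<lambda>\<omega>. (U \<omega>)\<^sup>2)"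
      by (simp add: C_def mult_ac)
    have U': "\<bar>U \<omega>\<bar> \<le> max B' (2 * K)" if "\<omega> \<in> space M" for \<omega> using U(2)[OF that] by simp
    have \<beta>': "\<bar>\<beta> p l \<omega>\<bar> \<le> max B' (2 * K)" if "\<omega> \<in> space M" for \<omega> l using \<beta>_b[OF that, of p l] by simp
    have V': "norm (V p l \<omega>) \<le> max B' (2 * K)" if "\<omega> \<in> space M" for \<omega> l using V_b[OF that, of p l] by simp
    note st = step_integrable[where \<beta>="\<beta> p" and V="V p" and N="2 ^ p", OF s0 d U(1) U' \<beta>_F \<beta>' V_F V' l]
    show ?i1 by (rule st(2))
    have "expectation (\<lambda>\<omega>. (U \<omega> * \<beta> p l \<omega>)\<^sup>2) \<le> expectation (\<lambda>\<omega>. K\<^sup>2 * (U \<omega> * norm (X (\<tau> p l) \<omega> - X s \<omega>))\<^sup>2)"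
    proof (intro integral_mono integrable_mult_right N(1) st(2))
      fix \<omega> assume "\<omega> \<in> space M"
      from power_mono[OF \<beta>_l[OF this, of p l], of 2]
      have "(\<beta> p l \<omega>)\<^sup>2 \<le> K\<^sup>2 * (norm (X (\<tau> p l) \<omega> - X s \<omega>))\<^sup>2" by (simp add: power_mult_distrib)
      from mult_left_mono[OF this, of "(U \<omega>)\<^sup>2"]
      show "(U \<omega> * \<beta> p l \<omega>)\<^sup>2 \<le> K\<^sup>2 * (U \<omega> * norm (X (\<tau> p l) \<omega> - X s \<omega>))\<^sup>2"
        by (simp add: power_mult_distrib mult_ac)
    qed
    thus ?e1 using KN by linarith
    have "expectation (\<lambda>\<omega>. (U \<omega>)\<^sup>2 * (V p l \<omega> \<bullet> V p l \<omega>)) \<le> expectation (\<lambda>\<omega>. K\<^sup>2 * (U \<omega> * norm (X (\<tau> p l) \<omega> - X s \<omega>))\<^sup>2)"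
    proof (intro integral_mono integrable_mult_right N(1) st(3))
      fix \<omega> assume "\<omega> \<in> space M"
      from power_mono[OF V_l[OF this, of p l], of 2]
      have "V p l \<omega> \<bullet> V p l \<omega> \<le> K\<^sup>2 * (norm (X (\<tau> p l) \<omega> - X s \<omega>))\<^sup>2"
        by (simp add: power_mult_distrib power2_norm_eq_inner)
      from mult_left_mono[OF this, of "(U \<omega>)\<^sup>2"]
      show "(U \<omega>)\<^sup>2 * (V p l \<omega> \<bullet> V p l \<omega>) \<le> K\<^sup>2 * (U \<omega> * norm (X (\<tau> p l) \<omega> - X s \<omega>))\<^sup>2"
        by (simp add: power_mult_distrib mult_ac)
    qed
    thus ?e2 using KN by linarith
  qed
  have RU: "integrable M (\<lambda>\<omega>. (U \<omega> * R p \<omega>)\<^sup>2)" (is ?i)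
     "expectation (\<lambda>\<omega>. (U \<omega> * R p \<omega>)\<^sup>2) \<le> 4 * C * h\<^sup>2 * expectation (\<lambda>\<omega>. (U \<omega>)\<^sup>2)" (is ?e)
     "expectation (\<lambda>\<omega>. U \<omega> * R p \<omega>) = (\<Sum>l<2 ^ p. expectation (\<lambda>\<omega>. U \<omega> * \<beta> p l \<omega>)) * (h / 2 ^ p)" (is ?m)
     "\<And>l. l < 2 ^ p \<Longrightarrow> integrable M (\<lambda>\<omega>. U \<omega> * \<beta> p l \<omega>)"
    if U: "U \<in> borel_measurable (F s)" "\<And>\<omega>. \<omega> \<in> space M \<Longrightarrow> \<bar>U \<omega>\<bar> \<le> B'" for U B' p
  proof -
    have d: "0 < h / 2 ^ p" using h by simp
    have U': "\<bar>U \<omega>\<bar> \<le> max B' (2 * K)" if "\<omega> \<in> space M" for \<omega> using U(2)[OF that] by simp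
    have \<beta>': "\<bar>\<beta> p l \<omega>\<bar> \<le> max B' (2 * K)" if "\<omega> \<in> space M" for \<omega> l using \<beta>_b[OF that, of p l] by simp
    have V': "norm (V p l \<omega>) \<le> max B' (2 * K)" if "\<omega> \<in> space M" for \<omega> l using V_b[OF that, of p l] by simp
    have N1: "real (2 ^ p) * (h / 2 ^ p) \<le> 1" using h by simp
    note q = weighted_sum_square[where \<beta>="\<beta> p" and V="V p" and N="2 ^ p", OF s0 d U(1) U' \<beta>_F \<beta>' V_F V' N1 sq(2)[OF _ U] sq(3)[OF _ U]]
    show ?i unfolding R_def using q(1) by simp
    show ?e unfolding R_def using q(2) by (simp add: power2_eq_square mult_ac)
    show ?m unfolding R_def
      by (rule weighted_sum_mean[where \<beta>="\<beta> p" and V="V p" and N="2 ^ p", OF s0 d U(1) U' \<beta>_F \<beta>' V_F V'])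
    show "integrable M (\<lambda>\<omega>. U \<omega> * \<beta> p l \<omega>)" if "l < 2 ^ p" for l
      by (rule step_integrable[where \<beta>="\<beta> p" and V="V p" and N="2 ^ p", OF s0 d U(1) U' \<beta>_F \<beta>' V_F V' that])
  qed
  note limZ = prob_lim_mult_bounded[OF limR measurable_F_M[OF Z(1)] Z(2)]
  note ZR = prob_lim_square_bound[OF limZ RU(1)[OF Z] RU(2)[OF Z]]
  show "integrable M (\<lambda>\<omega>. (Z \<omega> * remainder i s h \<omega>)\<^sup>2)" by (rule ZR(1))
  show "expectation (\<lambda>\<omega>. (Z \<omega> * remainder i s h \<omega>)\<^sup>2) \<le> 4 * C * h\<^sup>2 * expectation (\<lambda>\<omega>. (Z \<omega>)\<^sup>2)"
    by (rule ZR(2))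

  \<comment> \<open>The remainder enters the third claim linearly, so there the whole weight
    \<open>Z\<^sup>2\<close>, itself bounded and \<open>F s\<close>-measurable, takes the role of
    \<open>U\<close>.\<close>
  have Z2: "(\<lambda>\<omega>. (Z \<omega>)\<^sup>2) \<in> borel_measurable (F s)" "\<And>\<omega>. \<omega> \<in> space M \<Longrightarrow> \<bar>(Z \<omega>)\<^sup>2\<bar> \<le> B\<^sup>2"
    using Z(1) power_mono[OF Z(2), of _ 2] by (auto simp: borel_measurable_power)
  have iZ: "integrable M (\<lambda>\<omega>. (Z \<omega>)\<^sup>2)" using Z2 by (rule integrable_bounded_F)
  let ?E = "expectation (\<lambda>\<omega>. (Z \<omega>)\<^sup>2)"
  have mean: "\<bar>expectation (\<lambda>\<omega>. (Z \<omega>)\<^sup>2 * R p \<omega>)\<bar> \<le> (1 + C) * (h * sqrt h) * ?E" for p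
  proof -
    have b1: "\<bar>expectation (\<lambda>\<omega>. (Z \<omega>)\<^sup>2 * \<beta> p l \<omega>)\<bar> \<le> (1 + C) * sqrt h * ?E" if l: "l < 2 ^ p" for l
    proof -
      have r: "0 < sqrt h" using h by simp
      have "\<bar>expectation (\<lambda>\<omega>. (Z \<omega>)\<^sup>2 * \<beta> p l \<omega>)\<bar> \<le> expectation (\<lambda>\<omega>. \<bar>(Z \<omega>)\<^sup>2 * \<beta> p l \<omega>\<bar>)"
        by (rule integral_abs_bound)
      also have "\<dots> \<le> expectation (\<lambda>\<omega>. sqrt h * (Z \<omega>)\<^sup>2 + (Z \<omega> * \<beta> p l \<omega>)\<^sup>2 / sqrt h)"
      proof (intro integral_mono integrable_abs RU(4)[OF Z2] l Bochner_Integration.integrable_add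
          integrable_mult_right iZ integrable_divide sq(1)[OF l Z])
        fix \<omega>
        \<comment> \<open>Young's inequality with weight \<open>sqrt h\<close>: the first moment of
          the deviation is traded for its second, which is of order \<open>h\<close>, and both
          resulting terms are of order \<open>sqrt h\<close>.\<close>
        have "2 * sqrt h * \<bar>\<beta> p l \<omega>\<bar> \<le> (sqrt h)\<^sup>2 + (\<beta> p l \<omega>)\<^sup>2"
          using sum_squares_bound[of "sqrt h" "\<bar>\<beta> p l \<omega>\<bar>"] by simp
        moreover have "0 \<le> sqrt h * \<bar>\<beta> p l \<omega>\<bar>" using r by simp
        ultimately have "\<bar>\<beta> p l \<omega>\<bar> * sqrt h \<le> (sqrt h)\<^sup>2 + (\<beta> p l \<omega>)\<^sup>2"
          unfolding mult.commute[of "\<bar>_\<bar>"] by linarith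
        hence "\<bar>\<beta> p l \<omega>\<bar> \<le> ((sqrt h)\<^sup>2 + (\<beta> p l \<omega>)\<^sup>2) / sqrt h" using r by (simp only: pos_le_divide_eq)
        also have "\<dots> = sqrt h + (\<beta> p l \<omega>)\<^sup>2 / sqrt h"
          using h by (simp add: add_divide_distrib real_div_sqrt)
        finally have "\<bar>\<beta> p l \<omega>\<bar> \<le> sqrt h + (\<beta> p l \<omega>)\<^sup>2 / sqrt h" .
        from mult_left_mono[OF this, of "(Z \<omega>)\<^sup>2"]
        show "\<bar>(Z \<omega>)\<^sup>2 * \<beta> p l \<omega>\<bar> \<le> sqrt h * (Z \<omega>)\<^sup>2 + (Z \<omega> * \<beta> p l \<omega>)\<^sup>2 / sqrt h"
          by (simp add: abs_mult power_mult_distrib distrib_left mult_ac)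
      qed
      also have "\<dots> = sqrt h * ?E + expectation (\<lambda>\<omega>. (Z \<omega> * \<beta> p l \<omega>)\<^sup>2) / sqrt h"
        using iZ sq(1)[OF l Z] by simp
      also have "\<dots> \<le> sqrt h * ?E + C * h * ?E / sqrt h"
        using r sq(2)[OF l Z] by (intro add_left_mono divide_right_mono) auto
      also have "\<dots> = sqrt h * ?E + C * (h / sqrt h) * ?E" by simp
      also have "\<dots> = (1 + C) * sqrt h * ?E" using h by (simp add: real_div_sqrt algebra_simps)
      finally show ?thesis .
    qed
    have "\<bar>\<Sum>l<2 ^ p. expectation (\<lambda>\<omega>. (Z \<omega>)\<^sup>2 * \<beta> p l \<omega>)\<bar> \<le> (\<Sum>l<(2::nat) ^ p. (1 + C) * sqrt h * ?E)"
      by (rule order_trans[OF sum_abs]) (intro sum_mono b1, auto)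
    hence "\<bar>\<Sum>l<2 ^ p. expectation (\<lambda>\<omega>. (Z \<omega>)\<^sup>2 * \<beta> p l \<omega>)\<bar> * (h / 2 ^ p) \<le> 2 ^ p * ((1 + C) * sqrt h * ?E) * (h / 2 ^ p)"
      using h by (intro mult_right_mono) auto
    hence "\<bar>(\<Sum>l<2 ^ p. expectation (\<lambda>\<omega>. (Z \<omega>)\<^sup>2 * \<beta> p l \<omega>)) * (h / 2 ^ p)\<bar> \<le> (1 + C) * (h * sqrt h) * ?E"
      unfolding abs_mult using h by (simp add: mult_ac)
    moreover have "expectation (\<lambda>\<omega>. (Z \<omega>)\<^sup>2 * R p \<omega>) = (\<Sum>l<2 ^ p. expectation (\<lambda>\<omega>. (Z \<omega>)\<^sup>2 * \<beta> p l \<omega>)) * (h / 2 ^ p)"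
      by (rule RU(3)[OF Z2])
    ultimately show ?thesis by simp
  qed
  have lim: "(\<lambda>p. expectation (\<lambda>\<omega>. (Z \<omega>)\<^sup>2 * R p \<omega>)) \<longlonglongrightarrow> expectation (\<lambda>\<omega>. (Z \<omega>)\<^sup>2 * remainder i s h \<omega>)"
    by (rule prob_lim_expectation[OF prob_lim_mult_bounded[OF limR measurable_F_M[OF Z2(1)] Z2(2)] RU(1)[OF Z2] RU(2)[OF Z2]])
  show "\<bar>expectation (\<lambda>\<omega>. (Z \<omega>)\<^sup>2 * remainder i s h \<omega>)\<bar> \<le> (1 + C) * (h * sqrt h) * ?E"
    using tendsto_rabs[OF lim] mean by (intro LIMSEQ_le_const2) auto
qed

end

section \<open>Taylor estimates for the exponential of an increment\<close>

text \<open>Stopping after an odd power leaves a remainder with an even power, which is nonnegative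
  whatever the sign of \<open>x\<close>.\<close>

lemma exp_ge_cubic: "1 + x + x\<^sup>2 / 2 + x ^ 3 / 6 \<le> exp (x::real)"
proof -
  obtain t where "exp x = (\<Sum>m<4. x ^ m / fact m) + exp t / fact 4 * x ^ 4"
    using Maclaurin_exp_le[of x 4] by blast
  moreover have "0 \<le> exp t / fact 4 * x ^ 4" by simp
  moreover have "(\<Sum>m<4. x ^ m / fact m) = 1 + x + x\<^sup>2 / 2 + x ^ 3 / 6"
    by (simp add: eval_nat_numeral)
  ultimately show ?thesis by linarith
qed

text \<open>\<open>r\<close> stands for \<open>sqrt h\<close>, \<open>\<beta>\<close> for the drift,
  \<open>G\<close> for the noise of typical size \<open>r\<close>, and \<open>R\<close> for the
  remainder of typical size \<open>r\<^sup>2\<close>. The terms outside \<open>T\<close> are those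
  whose means are computed or estimated directly. \<open>T\<close> collects the rest and is of order
  \<open>r ^ 3\<close> in mean; it involves only \<open>G\<^sup>2\<close>, \<open>G ^ 4\<close> and
  \<open>R\<^sup>2\<close>, the moments under control.\<close>

lemma exp_increment_pointwise:
  fixes \<alpha> \<beta> G R r K d :: real
  assumes \<alpha>: "0 \<le> \<alpha>" and r: "0 < r" "r \<le> 1" and \<beta>: "\<bar>\<beta>\<bar> \<le> K"
    and d: "d = \<beta> * r\<^sup>2 + G + R" "\<bar>d\<bar> \<le> 1"
  defines "T \<equiv> (2 * K\<^sup>2 + 64 * K ^ 4) * r ^ 3 + 2 * r * G\<^sup>2 + 3 * (R\<^sup>2 / r) + 64 * (G ^ 4 / r)"
  shows "\<alpha> * \<beta> * r\<^sup>2 + (\<alpha> + \<alpha>\<^sup>2 * \<beta> * r\<^sup>2) * G + \<alpha> * R + \<alpha>\<^sup>2 / 2 * G\<^sup>2 - (\<alpha>\<^sup>2 / 2 + \<alpha> ^ 3 / 6) * T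
    \<le> exp (\<alpha> * d) - 1"
proof -
  define q where "q = \<beta> * r\<^sup>2 + G"
  have dq: "d = q + R" by (simp add: q_def d)
  have sq_add: "(u + v)\<^sup>2 \<le> 2 * u\<^sup>2 + 2 * v\<^sup>2" for u v :: real
    using sum_squares_bound[of u v] by (simp add: power2_sum)
  have p4: "u ^ 4 = (u\<^sup>2)\<^sup>2" for u :: real by simp
  have K2: "\<beta>\<^sup>2 \<le> K\<^sup>2" using power_mono[OF \<beta>, of 2] by simp
  have K4: "\<beta> ^ 4 \<le> K ^ 4" unfolding p4 using power_mono[OF K2, of 2] by simp
  have rp: "r ^ m \<le> r ^ 3" if "3 \<le> m" for m
    using r that by (intro power_decreasing) auto
  have rq2: "r * q\<^sup>2 \<le> 2 * K\<^sup>2 * r ^ 3 + 2 * r * G\<^sup>2"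
  proof -
    have "r * q\<^sup>2 \<le> r * (2 * (\<beta> * r\<^sup>2)\<^sup>2 + 2 * G\<^sup>2)"
      unfolding q_def using r by (intro mult_left_mono sq_add) auto
    also have "\<dots> = 2 * (\<beta>\<^sup>2 * r ^ 5) + 2 * r * G\<^sup>2"
      by (simp add: power_mult_distrib algebra_simps eval_nat_numeral)
    also have "\<beta>\<^sup>2 * r ^ 5 \<le> K\<^sup>2 * r ^ 3" using K2 rp[of 5] r by (intro mult_mono) auto
    finally show ?thesis by simp
  qed
  have q4: "8 * (q ^ 4 / r) \<le> 64 * K ^ 4 * r ^ 3 + 64 * (G ^ 4 / r)"
  proof -
    have "q ^ 4 \<le> (2 * (\<beta> * r\<^sup>2)\<^sup>2 + 2 * G\<^sup>2)\<^sup>2"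
      unfolding p4 q_def by (intro power_mono sq_add) auto
    also have "\<dots> \<le> 2 * (2 * (\<beta> * r\<^sup>2)\<^sup>2)\<^sup>2 + 2 * (2 * G\<^sup>2)\<^sup>2" by (rule sq_add)
    also have "\<dots> = 8 * (\<beta> ^ 4 * r ^ 8) + 8 * G ^ 4"
      by (simp add: power_mult_distrib eval_nat_numeral)
    finally have "q ^ 4 / r \<le> (8 * (\<beta> ^ 4 * r ^ 8) + 8 * G ^ 4) / r"
      using r by (intro divide_right_mono) auto
    also have "\<dots> = 8 * (\<beta> ^ 4 * r ^ 7) + 8 * (G ^ 4 / r)"
      using r by (simp add: field_simps eval_nat_numeral)
    also have "\<beta> ^ 4 * r ^ 7 \<le> K ^ 4 * r ^ 3" using K4 rp[of 7] r by (intro mult_mono) auto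
    finally show ?thesis by simp
  qed
  \<comment> \<open>Young's inequality with weight \<open>r\<close> for the cross term of
    \<open>q\<close> and \<open>R\<close>, whose typical size \<open>r * r\<^sup>2\<close> is that
    of the error.\<close>
  have d2: "q\<^sup>2 - d\<^sup>2 \<le> r * q\<^sup>2 + R\<^sup>2 / r"
  proof -
    have "0 \<le> (r * q + R)\<^sup>2" by simp
    hence "- 2 * (q * R) * r \<le> (r * q\<^sup>2 + R\<^sup>2 / r) * r"
      using r by (simp add: power2_eq_square algebra_simps)
    hence "- 2 * (q * R) \<le> r * q\<^sup>2 + R\<^sup>2 / r" using r(1) by (simp only: mult_le_cancel_right_pos)
    moreover have "q\<^sup>2 - d\<^sup>2 \<le> - 2 * (q * R)" by (simp add: dq power2_eq_square algebra_simps)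
    ultimately show ?thesis by linarith
  qed
  \<comment> \<open>Only the second moment of \<open>R\<close> is under control, so where
    \<open>R\<close> dominates, two powers are given up by means of
    \<open>\<bar>d\<bar> \<le> 1\<close>.\<close>
  have d4: "d ^ 4 \<le> 4 * R\<^sup>2 + 16 * q ^ 4"
  proof (cases "\<bar>q\<bar> \<le> \<bar>R\<bar>")
    case True
    hence "\<bar>d\<bar> \<le> 2 * \<bar>R\<bar>" by (simp add: dq)
    from power_mono[OF this, of 2] have "d\<^sup>2 \<le> 4 * R\<^sup>2" by (simp add: power_mult_distrib)
    moreover have "d ^ 4 \<le> d\<^sup>2" using d(2) power_decreasing[of 2 4 "\<bar>d\<bar>"] by simp
    moreover have "0 \<le> q ^ 4" by simp
    ultimately show ?thesis by linarith
  next
    case False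
    hence "\<bar>d\<bar> \<le> 2 * \<bar>q\<bar>" by (simp add: dq)
    from power_mono[OF this, of 4] have "d ^ 4 \<le> 16 * q ^ 4" by (simp add: power_mult_distrib)
    thus ?thesis by (smt (verit) zero_le_power2)
  qed
  \<comment> \<open>The cubic term has no sign; it is interpolated between the second and the fourth
    power, with weight \<open>r\<close>.\<close>
  have d3: "\<bar>d\<bar> ^ 3 \<le> r * q\<^sup>2 + 3 * (R\<^sup>2 / r) + 8 * (q ^ 4 / r)"
  proof -
    have "0 \<le> d\<^sup>2 * (r - \<bar>d\<bar>)\<^sup>2" by simp
    also have "\<dots> = r\<^sup>2 * d\<^sup>2 + d ^ 4 - 2 * r * \<bar>d\<bar> ^ 3"
    proof -
      have "e\<^sup>2 * (r - e)\<^sup>2 = r\<^sup>2 * e\<^sup>2 + e ^ 4 - 2 * r * e ^ 3" for e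
        by (simp add: power2_eq_square power3_eq_cube power4_eq_xxxx algebra_simps)
      from this[of "\<bar>d\<bar>"] show ?thesis by simp
    qed
    finally have "2 * r * \<bar>d\<bar> ^ 3 \<le> r\<^sup>2 * d\<^sup>2 + d ^ 4" by simp
    also have "\<dots> \<le> r\<^sup>2 * (2 * q\<^sup>2 + 2 * R\<^sup>2) + (4 * R\<^sup>2 + 16 * q ^ 4)"
      unfolding dq[symmetric] using sq_add[of q R] d4 dq by (intro add_mono mult_left_mono) auto
    also have "\<dots> \<le> 2 * r\<^sup>2 * q\<^sup>2 + 6 * R\<^sup>2 + 16 * q ^ 4"
      using mult_right_mono[of "r\<^sup>2" 1 "2 * R\<^sup>2"] r by (simp add: algebra_simps power_le_one)
    also have "\<dots> = (r * q\<^sup>2 + 3 * (R\<^sup>2 / r) + 8 * (q ^ 4 / r)) * (2 * r)"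
      using r by (simp add: field_simps power2_eq_square)
    finally have "\<bar>d\<bar> ^ 3 * (2 * r) \<le> (r * q\<^sup>2 + 3 * (R\<^sup>2 / r) + 8 * (q ^ 4 / r)) * (2 * r)"
      by (simp add: mult_ac)
    thus ?thesis using r(1) by (simp only: mult_le_cancel_right_pos zero_less_mult_iff zero_less_numeral simp_thms)
  qed
  have pos: "0 \<le> R\<^sup>2 / r" "0 \<le> G ^ 4 / r" "0 \<le> K ^ 4 * r ^ 3" using r by auto
  have "r * q\<^sup>2 + 3 * (R\<^sup>2 / r) + 8 * (q ^ 4 / r) \<le> T"
    using rq2 q4 by (simp add: T_def algebra_simps)
  hence T3: "\<bar>d\<bar> ^ 3 \<le> T" using d3 by linarith
  have "T = 2 * K\<^sup>2 * r ^ 3 + 64 * (K ^ 4 * r ^ 3) + 2 * r * G\<^sup>2 + 3 * (R\<^sup>2 / r) + 64 * (G ^ 4 / r)"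
    by (simp add: T_def distrib_right)
  hence "q\<^sup>2 - d\<^sup>2 \<le> T" using d2 rq2 pos by linarith
  moreover have "2 * \<beta> * r\<^sup>2 * G + G\<^sup>2 \<le> q\<^sup>2" by (simp add: q_def power2_sum)
  ultimately have "2 * \<beta> * r\<^sup>2 * G + G\<^sup>2 - T \<le> d\<^sup>2" by linarith
  hence 2: "\<alpha>\<^sup>2 / 2 * (2 * \<beta> * r\<^sup>2 * G + G\<^sup>2 - T) \<le> \<alpha>\<^sup>2 / 2 * d\<^sup>2" by (intro mult_left_mono) auto
  have "- T \<le> d ^ 3" using T3 by (simp add: power_abs[symmetric] abs_le_iff)
  hence 3: "\<alpha> ^ 3 / 6 * (- T) \<le> \<alpha> ^ 3 / 6 * d ^ 3" using \<alpha> by (intro mult_left_mono) auto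
  have "\<alpha> * d + \<alpha>\<^sup>2 / 2 * d\<^sup>2 + \<alpha> ^ 3 / 6 * d ^ 3 \<le> exp (\<alpha> * d) - 1"
    using exp_ge_cubic[of "\<alpha> * d"] by (simp add: power_mult_distrib)
  moreover have "\<alpha> * \<beta> * r\<^sup>2 + (\<alpha> + \<alpha>\<^sup>2 * \<beta> * r\<^sup>2) * G + \<alpha> * R + \<alpha>\<^sup>2 / 2 * G\<^sup>2 - (\<alpha>\<^sup>2 / 2 + \<alpha> ^ 3 / 6) * T =
    \<alpha> * d + \<alpha>\<^sup>2 / 2 * (2 * \<beta> * r\<^sup>2 * G + G\<^sup>2 - T) + \<alpha> ^ 3 / 6 * (- T)"
    by (simp add: d(1) field_simps)
  ultimately show ?thesis using 2 3 by linarith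
qed

context ito_diffusion
begin

text \<open>Multiply the pointwise bound by \<open>Z\<^sup>2\<close> and integrate; this is the
  generator inequality conditional on \<open>F s\<close>. In \<open>D\<close>, the summand
  \<open>\<alpha> * (1 + C)\<close> stems from the mean of the remainder. In the second bracket,
  \<open>4 * K\<^sup>2\<close> joins the \<open>2 * K\<^sup>2\<close> of the pointwise error with
  the mean of \<open>2 * r * G\<^sup>2\<close>, \<open>12 * C\<close> is 3 times the constant
  \<open>4 * C\<close> for the square of the remainder, and 192 is 64 times the Gaussian factor
  3.\<close>

lemma exp_increment:
  assumes \<alpha>: "0 \<le> \<alpha>" and diam: "\<And>y z. y \<in> S \<Longrightarrow> z \<in> S \<Longrightarrow> \<bar>y $ i - z $ i\<bar> \<le> 1"
    and h: "0 < h" "h \<le> 1" and s: "s = real a * h"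
    and Z: "Z \<in> borel_measurable (F s)" "\<And>\<omega>. \<omega> \<in> space M \<Longrightarrow> \<bar>Z \<omega>\<bar> \<le> B"
  defines "C \<equiv> 4 * real CARD('n) * K ^ 4"
  defines "D \<equiv> \<alpha> * (1 + C) + (\<alpha>\<^sup>2 / 2 + \<alpha> ^ 3 / 6) * (4 * K\<^sup>2 + 64 * K ^ 4 + 12 * C + 192 * (real CARD('n))\<^sup>2 * K ^ 4)"
  shows "integrable M (\<lambda>\<omega>. (Z \<omega>)\<^sup>2 * (\<alpha> * b (X s \<omega>) $ i + \<alpha>\<^sup>2 / 2 * (c (X s \<omega>) $ i \<bullet> c (X s \<omega>) $ i)))"
    and "integrable M (\<lambda>\<omega>. (Z \<omega>)\<^sup>2 * (exp (\<alpha> * (X (s + h) \<omega> $ i - X s \<omega> $ i)) - 1))"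
    and "h * expectation (\<lambda>\<omega>. (Z \<omega>)\<^sup>2 * (\<alpha> * b (X s \<omega>) $ i + \<alpha>\<^sup>2 / 2 * (c (X s \<omega>) $ i \<bullet> c (X s \<omega>) $ i)))
        - D * (h * sqrt h) * expectation (\<lambda>\<omega>. (Z \<omega>)\<^sup>2)
      \<le> expectation (\<lambda>\<omega>. (Z \<omega>)\<^sup>2 * (exp (\<alpha> * (X (s + h) \<omega> $ i - X s \<omega> $ i)) - 1))"
proof -
  have s0: "0 \<le> s" "s < s + h" using h s by auto
  define r where "r = sqrt h"
  have r: "0 < r" "r \<le> 1" "r\<^sup>2 = h" using h by (auto simp: r_def)
  define \<beta> where "\<beta> \<omega> = b (X s \<omega>) $ i" for \<omega>
  define u where "u \<omega> = c (X s \<omega>) $ i" for \<omega>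
  define G where "G \<omega> = u \<omega> \<bullet> (W (s + h) \<omega> - W s \<omega>)" for \<omega>
  define R where "R \<omega> = remainder i s h \<omega>" for \<omega>
  define d where "d \<omega> = X (s + h) \<omega> $ i - X s \<omega> $ i" for \<omega>
  define P where "P = \<alpha>\<^sup>2 / 2 + \<alpha> ^ 3 / 6"
  have P0: "0 \<le> P" using \<alpha> by (simp add: P_def)
  let ?E = "expectation (\<lambda>\<omega>. (Z \<omega>)\<^sup>2)"
  have E0: "0 \<le> ?E" by (rule integral_nonneg_AE) auto
  have mF [measurable]: "\<beta> \<in> borel_measurable (F s)" "u \<in> borel_measurable (F s)" "Z \<in> borel_measurable (F s)"
    unfolding \<beta>_def u_def using bX_F[OF s0(1)] cX_F[OF s0(1)] Z(1) by auto
  have \<beta>K: "\<bar>\<beta> \<omega>\<bar> \<le> K" and uK: "norm (u \<omega>) \<le> K" if "\<omega> \<in> space M" for \<omega>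
    unfolding \<beta>_def u_def using b_bound c_bound X_in[OF that s0(1)] by auto
  have uu: "u \<omega> \<bullet> u \<omega> \<le> K\<^sup>2" if "\<omega> \<in> space M" for \<omega>
    using power_mono[OF uK[OF that], of 2] by (simp add: power2_norm_eq_inner)
  have Z2: "(Z \<omega>)\<^sup>2 \<le> B\<^sup>2" if "\<omega> \<in> space M" for \<omega>
    using power_mono[OF Z(2)[OF that], of 2] by simp
  have bint: "integrable M (\<lambda>\<omega>. (Z \<omega>)\<^sup>2 * f \<omega>)" if [measurable]: "f \<in> borel_measurable (F t)" and "s \<le> t" "\<And>\<omega>. \<omega> \<in> space M \<Longrightarrow> \<bar>f \<omega>\<bar> \<le> B'" for f B' t
  proof (rule integrable_bounded_F[where s=t and B="B\<^sup>2 * B'"])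
    have [measurable]: "Z \<in> borel_measurable (F t)" by (rule measurable_F_mono[OF Z(1) that(2)])
    show "(\<lambda>\<omega>. (Z \<omega>)\<^sup>2 * f \<omega>) \<in> borel_measurable (F t)" by measurable
    fix \<omega> assume "\<omega> \<in> space M"
    thus "\<bar>(Z \<omega>)\<^sup>2 * f \<omega>\<bar> \<le> B\<^sup>2 * B'" unfolding abs_mult using Z2 that(3) by (intro mult_mono) auto
  qed
  have iZ: "integrable M (\<lambda>\<omega>. (Z \<omega>)\<^sup>2)" using bint[of "\<lambda>_. 1" s 1] by simp
  have i\<beta>: "integrable M (\<lambda>\<omega>. (Z \<omega>)\<^sup>2 * \<beta> \<omega>)" by (rule bint[OF _ order_refl \<beta>K]) measurable
  have iu: "integrable M (\<lambda>\<omega>. (Z \<omega>)\<^sup>2 * (u \<omega> \<bullet> u \<omega>))"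
    by (rule bint[of _ s "K\<^sup>2"]) (use uu in auto)
  have iL: "integrable M (\<lambda>\<omega>. (Z \<omega>)\<^sup>2 * (\<alpha> * \<beta> \<omega> + \<alpha>\<^sup>2 / 2 * (u \<omega> \<bullet> u \<omega>)))"
    and EL: "expectation (\<lambda>\<omega>. (Z \<omega>)\<^sup>2 * (\<alpha> * \<beta> \<omega> + \<alpha>\<^sup>2 / 2 * (u \<omega> \<bullet> u \<omega>))) =
      \<alpha> * expectation (\<lambda>\<omega>. (Z \<omega>)\<^sup>2 * \<beta> \<omega>) + \<alpha>\<^sup>2 / 2 * expectation (\<lambda>\<omega>. (Z \<omega>)\<^sup>2 * (u \<omega> \<bullet> u \<omega>))"
  proof -
    have eq: "(\<lambda>\<omega>. (Z \<omega>)\<^sup>2 * (\<alpha> * \<beta> \<omega> + \<alpha>\<^sup>2 / 2 * (u \<omega> \<bullet> u \<omega>))) = (\<lambda>\<omega>. \<alpha> * ((Z \<omega>)\<^sup>2 * \<beta> \<omega>) + \<alpha>\<^sup>2 / 2 * ((Z \<omega>)\<^sup>2 * (u \<omega> \<bullet> u \<omega>)))"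
      by (auto simp: algebra_simps)
    show "integrable M (\<lambda>\<omega>. (Z \<omega>)\<^sup>2 * (\<alpha> * \<beta> \<omega> + \<alpha>\<^sup>2 / 2 * (u \<omega> \<bullet> u \<omega>)))"
      unfolding eq by (intro Bochner_Integration.integrable_add integrable_mult_right i\<beta> iu)
    show "expectation (\<lambda>\<omega>. (Z \<omega>)\<^sup>2 * (\<alpha> * \<beta> \<omega> + \<alpha>\<^sup>2 / 2 * (u \<omega> \<bullet> u \<omega>))) =
      \<alpha> * expectation (\<lambda>\<omega>. (Z \<omega>)\<^sup>2 * \<beta> \<omega>) + \<alpha>\<^sup>2 / 2 * expectation (\<lambda>\<omega>. (Z \<omega>)\<^sup>2 * (u \<omega> \<bullet> u \<omega>))"
      unfolding eq using i\<beta> iu by simp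
  qed
  show "integrable M (\<lambda>\<omega>. (Z \<omega>)\<^sup>2 * (\<alpha> * b (X s \<omega>) $ i + \<alpha>\<^sup>2 / 2 * (c (X s \<omega>) $ i \<bullet> c (X s \<omega>) $ i)))"
    using iL unfolding \<beta>_def u_def .

  have dle: "\<bar>d \<omega>\<bar> \<le> 1" if "\<omega> \<in> space M" for \<omega>
    unfolding d_def using s0 by (intro diam X_in that) auto
  have d_F: "d \<in> borel_measurable (F (s + h))"
    unfolding d_def using s0 h by (auto intro!: borel_measurable_diff X_nth_F measurable_F_mono[OF X_nth_F])
  have iexp: "integrable M (\<lambda>\<omega>. (Z \<omega>)\<^sup>2 * (exp (\<alpha> * d \<omega>) - 1))"
  proof (rule bint[of _ "s + h" "exp \<alpha> + 1"])
    show "(\<lambda>\<omega>. exp (\<alpha> * d \<omega>) - 1) \<in> borel_measurable (F (s + h))" using d_F by measurable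
    fix \<omega> assume "\<omega> \<in> space M"
    hence "\<alpha> * d \<omega> \<le> \<alpha> * 1" using dle[of \<omega>] \<alpha> by (intro mult_left_mono) auto
    thus "\<bar>exp (\<alpha> * d \<omega>) - 1\<bar> \<le> exp \<alpha> + 1" by (intro order_trans[OF abs_triangle_ineq4]) auto
  qed (use h in simp)
  show "integrable M (\<lambda>\<omega>. (Z \<omega>)\<^sup>2 * (exp (\<alpha> * (X (s + h) \<omega> $ i - X s \<omega> $ i)) - 1))"
    using iexp unfolding d_def .

  \<comment> \<open>This covers the linear noise term together with the cross term of drift and
    noise: their common coefficient is \<open>F s\<close>-measurable.\<close>
  have G1: "integrable M (\<lambda>\<omega>. ((Z \<omega>)\<^sup>2 * (\<alpha> + \<alpha>\<^sup>2 * \<beta> \<omega> * h)) * G \<omega>)"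
    "expectation (\<lambda>\<omega>. ((Z \<omega>)\<^sup>2 * (\<alpha> + \<alpha>\<^sup>2 * \<beta> \<omega> * h)) * G \<omega>) = 0"
  proof -
    have "integrable M (\<lambda>\<omega>. \<alpha> * (Z \<omega>)\<^sup>2 + \<alpha>\<^sup>2 * h * ((Z \<omega>)\<^sup>2 * \<beta> \<omega>))"
      by (intro Bochner_Integration.integrable_add integrable_mult_right i\<beta> iZ)
    hence i: "integrable M (\<lambda>\<omega>. (Z \<omega>)\<^sup>2 * (\<alpha> + \<alpha>\<^sup>2 * \<beta> \<omega> * h))" by (simp add: algebra_simps)
    have m: "(\<lambda>\<omega>. (Z \<omega>)\<^sup>2 * (\<alpha> + \<alpha>\<^sup>2 * \<beta> \<omega> * h)) \<in> borel_measurable (F s)" by measurable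
    show "integrable M (\<lambda>\<omega>. ((Z \<omega>)\<^sup>2 * (\<alpha> + \<alpha>\<^sup>2 * \<beta> \<omega> * h)) * G \<omega>)"
      "expectation (\<lambda>\<omega>. ((Z \<omega>)\<^sup>2 * (\<alpha> + \<alpha>\<^sup>2 * \<beta> \<omega> * h)) * G \<omega>) = 0"
      unfolding G_def using step_mean[OF s0 m i mF(2) uK] by auto
  qed
  \<comment> \<open>The weight is moved into the integrand, so that \<open>step_square\<close>
    yields the exact variance of the noise.\<close>
  have G2: "integrable M (\<lambda>\<omega>. (Z \<omega>)\<^sup>2 * (G \<omega>)\<^sup>2)"
    "expectation (\<lambda>\<omega>. (Z \<omega>)\<^sup>2 * (G \<omega>)\<^sup>2) = h * expectation (\<lambda>\<omega>. (Z \<omega>)\<^sup>2 * (u \<omega> \<bullet> u \<omega>))"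
  proof -
    have m: "(\<lambda>\<omega>. Z \<omega> *\<^sub>R u \<omega>) \<in> borel_measurable (F s)" by measurable
    have bd: "norm (Z \<omega> *\<^sub>R u \<omega>) \<le> B * K" if "\<omega> \<in> space M" for \<omega>
      using Z(2)[OF that] uK[OF that] by (simp, intro mult_mono) auto
    have e: "((Z \<omega> *\<^sub>R u \<omega>) \<bullet> (W (s + h) \<omega> - W s \<omega>))\<^sup>2 = (Z \<omega>)\<^sup>2 * (G \<omega>)\<^sup>2"
      "(Z \<omega> *\<^sub>R u \<omega>) \<bullet> (Z \<omega> *\<^sub>R u \<omega>) = (Z \<omega>)\<^sup>2 * (u \<omega> \<bullet> u \<omega>)" for \<omega>
      by (auto simp: G_def power_mult_distrib power2_eq_square)
    show "integrable M (\<lambda>\<omega>. (Z \<omega>)\<^sup>2 * (G \<omega>)\<^sup>2)"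
      "expectation (\<lambda>\<omega>. (Z \<omega>)\<^sup>2 * (G \<omega>)\<^sup>2) = h * expectation (\<lambda>\<omega>. (Z \<omega>)\<^sup>2 * (u \<omega> \<bullet> u \<omega>))"
      using step_square[OF s0 m bd] unfolding e by auto
  qed
  have "expectation (\<lambda>\<omega>. (Z \<omega>)\<^sup>2 * (u \<omega> \<bullet> u \<omega>)) \<le> expectation (\<lambda>\<omega>. K\<^sup>2 * (Z \<omega>)\<^sup>2)"
    using uu by (intro integral_mono iu integrable_mult_right iZ) (simp add: mult.commute mult_right_mono)
  hence Eu: "expectation (\<lambda>\<omega>. (Z \<omega>)\<^sup>2 * (u \<omega> \<bullet> u \<omega>)) \<le> K\<^sup>2 * ?E" by simp
  have G4: "integrable M (\<lambda>\<omega>. (Z \<omega>)\<^sup>2 * G \<omega> ^ 4)" (is ?i4)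
    "expectation (\<lambda>\<omega>. (Z \<omega>)\<^sup>2 * G \<omega> ^ 4) \<le> 3 * (real CARD('n))\<^sup>2 * K ^ 4 * h\<^sup>2 * ?E" (is ?e4)
  proof -
    note n4 = incr_norm_power4[OF s0]
    have mZ: "(\<lambda>\<omega>. (Z \<omega>)\<^sup>2) \<in> borel_measurable (F s)" by measurable
    have gm: "(\<lambda>y :: real^'n. norm y ^ 4) \<in> borel_measurable borel" by measurable
    note pr = incr_product[OF s0 mZ gm iZ n4(1)]
    have le: "(Z \<omega>)\<^sup>2 * G \<omega> ^ 4 \<le> K ^ 4 * ((Z \<omega>)\<^sup>2 * norm (W (s + h) \<omega> - W s \<omega>) ^ 4)" if "\<omega> \<in> space M" for \<omega>
    proof -
      have "\<bar>G \<omega>\<bar> \<le> K * norm (W (s + h) \<omega> - W s \<omega>)"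
        unfolding G_def using uK[OF that]
        by (intro order_trans[OF Cauchy_Schwarz_ineq2] mult_right_mono) auto
      from power_mono[OF this, of 4] have "G \<omega> ^ 4 \<le> K ^ 4 * norm (W (s + h) \<omega> - W s \<omega>) ^ 4"
        by (simp add: power_mult_distrib)
      from mult_left_mono[OF this, of "(Z \<omega>)\<^sup>2"] show ?thesis by (simp add: mult_ac)
    qed
    have iK: "integrable M (\<lambda>\<omega>. K ^ 4 * ((Z \<omega>)\<^sup>2 * norm (W (s + h) \<omega> - W s \<omega>) ^ 4))"
      by (intro integrable_mult_right pr)
    show ?i4
    proof (rule Bochner_Integration.integrable_bound[OF iK])
      show "AE \<omega> in M. norm ((Z \<omega>)\<^sup>2 * G \<omega> ^ 4) \<le> norm (K ^ 4 * ((Z \<omega>)\<^sup>2 * norm (W (s + h) \<omega> - W s \<omega>) ^ 4))"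
        using le by (intro AE_I2) simp
      have [measurable]: "W (s + h) \<in> borel_measurable M" "W s \<in> borel_measurable M" "u \<in> borel_measurable M" "Z \<in> borel_measurable M"
        using s0 h W_measurable measurable_F_M[OF mF(2)] measurable_F_M[OF Z(1)] by auto
      show "(\<lambda>\<omega>. (Z \<omega>)\<^sup>2 * G \<omega> ^ 4) \<in> borel_measurable M" unfolding G_def by measurable
    qed
    have "expectation (\<lambda>\<omega>. (Z \<omega>)\<^sup>2 * G \<omega> ^ 4) \<le> expectation (\<lambda>\<omega>. K ^ 4 * ((Z \<omega>)\<^sup>2 * norm (W (s + h) \<omega> - W s \<omega>) ^ 4))"
      by (intro integral_mono \<open>?i4\<close> iK le)
    also have "\<dots> = K ^ 4 * (?E * expectation (\<lambda>\<omega>. norm (W (s + h) \<omega> - W s \<omega>) ^ 4))" using pr(2) by simp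
    also have "\<dots> \<le> K ^ 4 * (?E * (3 * (real CARD('n))\<^sup>2 * (s + h - s)\<^sup>2))"
      using E0 by (intro mult_left_mono n4(2)) auto
    finally show ?e4 by (simp add: mult_ac)
  qed
  note rb = remainder_bounds[OF h s Z, of i, folded C_def R_def]
  have R2: "integrable M (\<lambda>\<omega>. (Z \<omega>)\<^sup>2 * (R \<omega>)\<^sup>2)" "expectation (\<lambda>\<omega>. (Z \<omega>)\<^sup>2 * (R \<omega>)\<^sup>2) \<le> 4 * C * h\<^sup>2 * ?E"
    using rb(1,2) by (simp_all add: power_mult_distrib)
  have RM: "R \<in> borel_measurable M"
  proof -
    have [measurable]: "W (s + h) \<in> borel_measurable M" "W s \<in> borel_measurable M" "u \<in> borel_measurable M" "\<beta> \<in> borel_measurable M" "d \<in> borel_measurable M"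
      using s0 h W_measurable measurable_F_M[OF mF(1)] measurable_F_M[OF mF(2)] measurable_F_M[OF d_F] by auto
    have "R = (\<lambda>\<omega>. d \<omega> - \<beta> \<omega> * h - u \<omega> \<bullet> (W (s + h) \<omega> - W s \<omega>))"
      by (auto simp: R_def remainder_def d_def \<beta>_def u_def)
    thus ?thesis by simp
  qed
  have R1: "integrable M (\<lambda>\<omega>. (Z \<omega>)\<^sup>2 * R \<omega>)"
  proof (rule Bochner_Integration.integrable_bound[OF Bochner_Integration.integrable_add[OF iZ R2(1)]])
    show "(\<lambda>\<omega>. (Z \<omega>)\<^sup>2 * R \<omega>) \<in> borel_measurable M"
      using RM measurable_F_M[OF Z(1)] by measurable
    show "AE \<omega> in M. norm ((Z \<omega>)\<^sup>2 * R \<omega>) \<le> norm ((Z \<omega>)\<^sup>2 + (Z \<omega>)\<^sup>2 * (R \<omega>)\<^sup>2)"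
    proof (rule AE_I2)
      fix \<omega>
      have "\<bar>R \<omega>\<bar> \<le> 1 + (R \<omega>)\<^sup>2" using sum_squares_bound[of 1 "\<bar>R \<omega>\<bar>"] by simp
      from mult_left_mono[OF this, of "(Z \<omega>)\<^sup>2"]
      show "norm ((Z \<omega>)\<^sup>2 * R \<omega>) \<le> norm ((Z \<omega>)\<^sup>2 + (Z \<omega>)\<^sup>2 * (R \<omega>)\<^sup>2)"
        by (simp add: abs_mult distrib_left)
    qed
  qed
  \<comment> \<open>The pointwise lower bound times \<open>Z\<^sup>2\<close>, sorted by the
    expectations available.\<close>
  define L where "L \<omega> = \<alpha> * h * ((Z \<omega>)\<^sup>2 * \<beta> \<omega>) + ((Z \<omega>)\<^sup>2 * (\<alpha> + \<alpha>\<^sup>2 * \<beta> \<omega> * h)) * G \<omega> + \<alpha> * ((Z \<omega>)\<^sup>2 * R \<omega>)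
     + \<alpha>\<^sup>2 / 2 * ((Z \<omega>)\<^sup>2 * (G \<omega>)\<^sup>2)
     - P * ((2 * K\<^sup>2 + 64 * K ^ 4) * r ^ 3 * (Z \<omega>)\<^sup>2 + 2 * r * ((Z \<omega>)\<^sup>2 * (G \<omega>)\<^sup>2) + 3 / r * ((Z \<omega>)\<^sup>2 * (R \<omega>)\<^sup>2) + 64 / r * ((Z \<omega>)\<^sup>2 * G \<omega> ^ 4))" for \<omega>
  have L_le: "L \<omega> \<le> (Z \<omega>)\<^sup>2 * (exp (\<alpha> * d \<omega>) - 1)" if "\<omega> \<in> space M" for \<omega>
  proof -
    have "d \<omega> = \<beta> \<omega> * r\<^sup>2 + G \<omega> + R \<omega>" unfolding r(3) by (simp add: d_def \<beta>_def G_def R_def remainder_def u_def)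
    from exp_increment_pointwise[OF \<alpha> r(1,2) \<beta>K[OF that] this dle[OF that], folded P_def]
    have "(Z \<omega>)\<^sup>2 * (\<alpha> * \<beta> \<omega> * r\<^sup>2 + (\<alpha> + \<alpha>\<^sup>2 * \<beta> \<omega> * r\<^sup>2) * G \<omega> + \<alpha> * R \<omega> + \<alpha>\<^sup>2 / 2 * (G \<omega>)\<^sup>2
        - P * ((2 * K\<^sup>2 + 64 * K ^ 4) * r ^ 3 + 2 * r * (G \<omega>)\<^sup>2 + 3 * ((R \<omega>)\<^sup>2 / r) + 64 * (G \<omega> ^ 4 / r)))
       \<le> (Z \<omega>)\<^sup>2 * (exp (\<alpha> * d \<omega>) - 1)" by (intro mult_left_mono) auto
    also have "(Z \<omega>)\<^sup>2 * (\<alpha> * \<beta> \<omega> * r\<^sup>2 + (\<alpha> + \<alpha>\<^sup>2 * \<beta> \<omega> * r\<^sup>2) * G \<omega> + \<alpha> * R \<omega> + \<alpha>\<^sup>2 / 2 * (G \<omega>)\<^sup>2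
        - P * ((2 * K\<^sup>2 + 64 * K ^ 4) * r ^ 3 + 2 * r * (G \<omega>)\<^sup>2 + 3 * ((R \<omega>)\<^sup>2 / r) + 64 * (G \<omega> ^ 4 / r))) = L \<omega>"
      unfolding L_def r(3) by (simp add: algebra_simps)
    finally show ?thesis .
  qed
  have iLL: "integrable M L"
    unfolding L_def by (intro Bochner_Integration.integrable_add Bochner_Integration.integrable_diff integrable_mult_right i\<beta> iZ G1 G2 G4 R1 R2)
  have ELL: "expectation L = \<alpha> * h * expectation (\<lambda>\<omega>. (Z \<omega>)\<^sup>2 * \<beta> \<omega>) + \<alpha> * expectation (\<lambda>\<omega>. (Z \<omega>)\<^sup>2 * R \<omega>)
     + \<alpha>\<^sup>2 / 2 * expectation (\<lambda>\<omega>. (Z \<omega>)\<^sup>2 * (G \<omega>)\<^sup>2)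
     - P * ((2 * K\<^sup>2 + 64 * K ^ 4) * r ^ 3 * ?E + 2 * r * expectation (\<lambda>\<omega>. (Z \<omega>)\<^sup>2 * (G \<omega>)\<^sup>2)
         + 3 / r * expectation (\<lambda>\<omega>. (Z \<omega>)\<^sup>2 * (R \<omega>)\<^sup>2) + 64 / r * expectation (\<lambda>\<omega>. (Z \<omega>)\<^sup>2 * G \<omega> ^ 4))"
    unfolding L_def
    by (simp add: i\<beta> iZ G1 G2(1) G4(1) R1 R2(1) Bochner_Integration.integrable_add Bochner_Integration.integrable_diff
        Bochner_Integration.integral_add Bochner_Integration.integral_diff del: G2(2))
  have r3: "h * sqrt h = r ^ 3" 
    using r(3) unfolding r_def[symmetric] by (simp add: power2_eq_square power3_eq_cube)
  have b1: "- ((1 + C) * r ^ 3 * ?E) \<le> expectation (\<lambda>\<omega>. (Z \<omega>)\<^sup>2 * R \<omega>)"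
    using rb(3) unfolding r3 by linarith
  have b2: "2 * r * expectation (\<lambda>\<omega>. (Z \<omega>)\<^sup>2 * (G \<omega>)\<^sup>2) \<le> 2 * K\<^sup>2 * r ^ 3 * ?E"
  proof -
    have "2 * r * (h * expectation (\<lambda>\<omega>. (Z \<omega>)\<^sup>2 * (u \<omega> \<bullet> u \<omega>))) \<le> 2 * r * (h * (K\<^sup>2 * ?E))"
      using r(1) h by (intro mult_left_mono Eu) auto
    thus ?thesis unfolding G2(2) r(3)[symmetric] by (simp add: eval_nat_numeral mult_ac)
  qed
  have b3: "3 / r * expectation (\<lambda>\<omega>. (Z \<omega>)\<^sup>2 * (R \<omega>)\<^sup>2) \<le> 12 * C * r ^ 3 * ?E"
  proof -
    have "3 / r * expectation (\<lambda>\<omega>. (Z \<omega>)\<^sup>2 * (R \<omega>)\<^sup>2) \<le> 3 / r * (4 * C * h\<^sup>2 * ?E)"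
      using r(1) by (intro mult_left_mono R2(2)) auto
    also have "\<dots> = 12 * C * r ^ 3 * ?E" unfolding r(3)[symmetric] using r(1) by (simp add: eval_nat_numeral field_simps)
    finally show ?thesis .
  qed
  have b4: "64 / r * expectation (\<lambda>\<omega>. (Z \<omega>)\<^sup>2 * G \<omega> ^ 4) \<le> 192 * (real CARD('n))\<^sup>2 * K ^ 4 * r ^ 3 * ?E"
  proof -
    have "64 / r * expectation (\<lambda>\<omega>. (Z \<omega>)\<^sup>2 * G \<omega> ^ 4) \<le> 64 / r * (3 * (real CARD('n))\<^sup>2 * K ^ 4 * h\<^sup>2 * ?E)"
      using r(1) by (intro mult_left_mono G4(2)) auto
    also have "\<dots> = 192 * (real CARD('n))\<^sup>2 * K ^ 4 * r ^ 3 * ?E" unfolding r(3)[symmetric] using r(1) by (simp add: eval_nat_numeral field_simps)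
    finally show ?thesis .
  qed
  have "P * ((2 * K\<^sup>2 + 64 * K ^ 4) * r ^ 3 * ?E + 2 * r * expectation (\<lambda>\<omega>. (Z \<omega>)\<^sup>2 * (G \<omega>)\<^sup>2)
         + 3 / r * expectation (\<lambda>\<omega>. (Z \<omega>)\<^sup>2 * (R \<omega>)\<^sup>2) + 64 / r * expectation (\<lambda>\<omega>. (Z \<omega>)\<^sup>2 * G \<omega> ^ 4))
     \<le> P * ((2 * K\<^sup>2 + 64 * K ^ 4) * r ^ 3 * ?E + 2 * K\<^sup>2 * r ^ 3 * ?E + 12 * C * r ^ 3 * ?E + 192 * (real CARD('n))\<^sup>2 * K ^ 4 * r ^ 3 * ?E)"
    by (intro mult_left_mono add_mono b2 b3 b4 order_refl P0)
  moreover have "\<alpha> * (- ((1 + C) * r ^ 3 * ?E)) \<le> \<alpha> * expectation (\<lambda>\<omega>. (Z \<omega>)\<^sup>2 * R \<omega>)"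
    using \<alpha> by (intro mult_left_mono b1)
  moreover have "D * (h * sqrt h) * ?E = \<alpha> * ((1 + C) * r ^ 3 * ?E) + P * ((2 * K\<^sup>2 + 64 * K ^ 4) * r ^ 3 * ?E + 2 * K\<^sup>2 * r ^ 3 * ?E + 12 * C * r ^ 3 * ?E + 192 * (real CARD('n))\<^sup>2 * K ^ 4 * r ^ 3 * ?E)"
    unfolding r3 D_def P_def[symmetric] by algebra
  moreover have "h * expectation (\<lambda>\<omega>. (Z \<omega>)\<^sup>2 * (\<alpha> * \<beta> \<omega> + \<alpha>\<^sup>2 / 2 * (u \<omega> \<bullet> u \<omega>))) =
     \<alpha> * h * expectation (\<lambda>\<omega>. (Z \<omega>)\<^sup>2 * \<beta> \<omega>) + \<alpha>\<^sup>2 / 2 * expectation (\<lambda>\<omega>. (Z \<omega>)\<^sup>2 * (G \<omega>)\<^sup>2)"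
    unfolding EL G2(2) by (simp add: algebra_simps)
  ultimately have "h * expectation (\<lambda>\<omega>. (Z \<omega>)\<^sup>2 * (\<alpha> * \<beta> \<omega> + \<alpha>\<^sup>2 / 2 * (u \<omega> \<bullet> u \<omega>))) - D * (h * sqrt h) * ?E \<le> expectation L"
    unfolding ELL by linarith
  also have "\<dots> \<le> expectation (\<lambda>\<omega>. (Z \<omega>)\<^sup>2 * (exp (\<alpha> * d \<omega>) - 1))"
    by (intro integral_mono iLL iexp L_le)
  finally show "h * expectation (\<lambda>\<omega>. (Z \<omega>)\<^sup>2 * (\<alpha> * b (X s \<omega>) $ i + \<alpha>\<^sup>2 / 2 * (c (X s \<omega>) $ i \<bullet> c (X s \<omega>) $ i)))
        - D * (h * sqrt h) * ?E
      \<le> expectation (\<lambda>\<omega>. (Z \<omega>)\<^sup>2 * (exp (\<alpha> * (X (s + h) \<omega> $ i - X s \<omega> $ i)) - 1))"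
    unfolding \<beta>_def u_def d_def .
qed

end

subsection \<open>Exit from a region with positive Lyapunov drift\<close>

context ito_diffusion
begin

text \<open>Time 0 is excluded because the starting point need not lie in \<open>U\<close>.\<close>

definition stay :: "(real^'n) set \<Rightarrow> real \<Rightarrow> nat \<Rightarrow> 'a set" where
  "stay U h k = {\<omega> \<in> space M. \<forall>j\<in>{1..k}. X (real j * h) \<omega> \<in> U}"

lemma stay_F:
  assumes "U \<in> sets borel" "0 \<le> h"
  shows "stay U h k \<in> sets (F (real k * h))"
proof -
  have "{\<omega> \<in> space (F (real k * h)). \<forall>j\<in>{1..k}. X (real j * h) \<omega> \<in> U} \<in> sets (F (real k * h))"
  proof (intro sets.sets_Collect_finite_All)
    fix j assume "j \<in> {1..k}"
    hence "X (real j * h) \<in> borel_measurable (F (real k * h))"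
      using assms by (intro X_F mult_right_mono) auto
    from measurable_sets[OF this assms(1)]
    show "{\<omega> \<in> space (F (real k * h)). X (real j * h) \<omega> \<in> U} \<in> sets (F (real k * h))"
      by (simp add: vimage_def Int_def conj_commute)
  qed auto
  thus ?thesis by (simp add: stay_def space_F)
qed

lemma stay_events: "U \<in> sets borel \<Longrightarrow> 0 \<le> h \<Longrightarrow> stay U h k \<in> events"
  using stay_F sets_F by blast

lemma summable_stay:
  assumes \<alpha>: "0 \<le> \<alpha>" and S: "\<And>y i. y \<in> S \<Longrightarrow> 0 \<le> y $ i \<and> y $ i \<le> 1" and U: "U \<in> sets borel"
    and drift: "\<And>y. y \<in> S \<Longrightarrow> y \<in> U \<Longrightarrow>
      1 \<le> (\<Sum>i\<in>UNIV. exp (\<alpha> * y $ i) * (\<alpha> * b y $ i + \<alpha>\<^sup>2 / 2 * (c y $ i \<bullet> c y $ i)))"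
  shows "\<exists>h>0. \<exists>C. \<forall>N. (\<Sum>k<N. prob (stay U h (Suc k))) \<le> C"
proof -
  define C1 where "C1 = 4 * real CARD('n) * K ^ 4"
  define D where "D = \<alpha> * (1 + C1) + (\<alpha>\<^sup>2 / 2 + \<alpha> ^ 3 / 6) * (4 * K\<^sup>2 + 64 * K ^ 4 + 12 * C1 + 192 * (real CARD('n))\<^sup>2 * K ^ 4)"
  have D0: "0 \<le> D" using \<alpha> K_nonneg by (auto simp: D_def C1_def intro!: add_nonneg_nonneg mult_nonneg_nonneg)
  define H where "H = real CARD('n) * exp \<alpha>"
  have H0: "0 \<le> H" by (simp add: H_def)
  \<comment> \<open>\<open>r\<close> is going to be \<open>sqrt h\<close>. The error of one step,
    relative to \<open>h * prob (E k)\<close>, is \<open>D * r * H\<close>; this choice makes it at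
    most one half, so half of the drift gain is left. The \<open>+ 1\<close> keeps \<open>r\<close>
    between 0 and 1.\<close>
  define r where "r = 1 / (2 * D * H + 1)"
  have r: "0 < r" "r \<le> 1" "D * r * H \<le> 1 / 2"
    using mult_nonneg_nonneg[OF D0 H0] by (auto simp: r_def field_simps)
  define h where "h = r\<^sup>2"
  have h: "0 < h" "h \<le> 1" "sqrt h = r" using r by (auto simp: h_def power_le_one)
  define f where "f y = (\<Sum>i\<in>UNIV. exp (\<alpha> * y $ i))" for y :: "real^'n"
  have e_le: "exp (\<alpha> * y $ i) \<le> exp \<alpha>" if "y \<in> S" for y i
    using S[OF that, of i] \<alpha> mult_left_mono[of "y $ i" 1 \<alpha>] by simp
  have f: "0 \<le> f y" "f y \<le> H" if "y \<in> S" for y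
    unfolding f_def H_def using e_le[OF that] sum_bounded_above[of UNIV "\<lambda>i. exp (\<alpha> * y $ i)" "exp \<alpha>"]
    by (auto intro!: sum_nonneg)
  have f_meas [measurable]: "f \<in> borel_measurable borel"
    unfolding f_def by (intro borel_measurable_continuous_onI continuous_intros)
  define E where "E k = stay U h k" for k
  have E_M [measurable]: "E k \<in> events" for k unfolding E_def using stay_events[OF U] h by auto
  have E_sub: "E (Suc k) \<subseteq> E k" for k unfolding E_def stay_def by auto
  have ET: "0 \<le> real k * h" for k using h by simp
  \<comment> \<open>For \<open>k = 0\<close> the event \<open>E k\<close> is the whole space and
    says nothing about the current position; from 1 on it forces \<open>X (real k * h)\<close> into
    \<open>U\<close>, where the drift bound holds.\<close>
  have step: "expectation (\<lambda>\<omega>. indicator (E k) \<omega> * f (X (real k * h) \<omega>)) + h / 2 * prob (E k)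
      \<le> expectation (\<lambda>\<omega>. indicator (E k) \<omega> * f (X (real (Suc k) * h) \<omega>))" if k: "1 \<le> k" for k
  proof -
    define s where "s = real k * h"
    have s0: "0 \<le> s" using h by (simp add: s_def)
    have s': "real (Suc k) * h = s + h" by (simp add: s_def algebra_simps)
    \<comment> \<open>Half the exponent, so that \<open>Z\<^sup>2\<close> is exp(\<alpha> X_i(s))
      localised to \<open>E k\<close>. Multiplied by the relative increment \<open>exp (\<alpha> *
      (X (s + h) \<omega> $ i - X s \<omega> $ i)) - 1\<close> it becomes the increment of the i-th
      summand of \<open>f\<close>.\<close>
    define Z where "Z i \<omega> = indicator (E k) \<omega> * exp (\<alpha> / 2 * X s \<omega> $ i)" for i \<omega>
    have Z2: "(Z i \<omega>)\<^sup>2 = indicator (E k) \<omega> * exp (\<alpha> * X s \<omega> $ i)" for i \<omega>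
      by (auto simp: Z_def power_mult_distrib exp_double[symmetric] indicator_def)
    have EF [measurable]: "E k \<in> sets (F s)" unfolding E_def s_def using stay_F[OF U] h by simp
    have Z_F: "Z i \<in> borel_measurable (F s)" for i
      unfolding Z_def using X_nth_F[OF s0, of i] by measurable
    have Z_b: "\<bar>Z i \<omega>\<bar> \<le> exp (\<alpha> / 2)" if "\<omega> \<in> space M" for i \<omega>
      using S[OF X_in[OF that s0], of i] \<alpha> mult_left_mono[of "X s \<omega> $ i" 1 "\<alpha> / 2"]
      by (auto simp: Z_def indicator_def)
    have diam: "\<bar>y $ i - z $ i\<bar> \<le> 1" if "y \<in> S" "z \<in> S" for y z i
      using S[OF that(1), of i] S[OF that(2), of i] by linarith
    let ?L = "\<lambda>i \<omega>. (Z i \<omega>)\<^sup>2 * (\<alpha> * b (X s \<omega>) $ i + \<alpha>\<^sup>2 / 2 * (c (X s \<omega>) $ i \<bullet> c (X s \<omega>) $ i))"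
    have X: "integrable M (?L i)"
      "integrable M (\<lambda>\<omega>. (Z i \<omega>)\<^sup>2 * (exp (\<alpha> * (X (s + h) \<omega> $ i - X s \<omega> $ i)) - 1))"
      "h * expectation (?L i) - D * (h * sqrt h) * expectation (\<lambda>\<omega>. (Z i \<omega>)\<^sup>2)
        \<le> expectation (\<lambda>\<omega>. (Z i \<omega>)\<^sup>2 * (exp (\<alpha> * (X (s + h) \<omega> $ i - X s \<omega> $ i)) - 1))" for i
      by (rule exp_increment[OF \<alpha> diam h(1,2) s_def Z_F Z_b, folded C1_def, folded D_def]; assumption)+
    have EZ: "expectation (\<lambda>\<omega>. (Z i \<omega>)\<^sup>2) \<le> exp \<alpha> * prob (E k)" for i
    proof -
      have "expectation (\<lambda>\<omega>. (Z i \<omega>)\<^sup>2) \<le> expectation (\<lambda>\<omega>. exp \<alpha> * indicator (E k) \<omega>)"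
      proof (rule integral_mono)
        have "(\<lambda>\<omega>. (Z i \<omega>)\<^sup>2) \<in> borel_measurable (F s)" using Z_F[of i] by measurable
        moreover have "\<bar>(Z i \<omega>)\<^sup>2\<bar> \<le> (exp (\<alpha> / 2))\<^sup>2" if "\<omega> \<in> space M" for \<omega>
          using power_mono[OF Z_b[OF that, of i], of 2] by simp
        ultimately show "integrable M (\<lambda>\<omega>. (Z i \<omega>)\<^sup>2)" by (rule integrable_bounded_F)
        show "integrable M (\<lambda>\<omega>. exp \<alpha> * indicator (E k) \<omega>)" by (simp add: less_top[symmetric])
        show "(Z i \<omega>)\<^sup>2 \<le> exp \<alpha> * indicator (E k) \<omega>" if "\<omega> \<in> space M" for \<omega>
          unfolding Z2 using e_le[OF X_in[OF that s0], of i] by (simp add: indicator_def)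
      qed
      thus ?thesis by simp
    qed
    have "h * prob (E k) = h * expectation (indicator (E k))" by simp
    also have "\<dots> \<le> h * expectation (\<lambda>\<omega>. \<Sum>i\<in>UNIV. ?L i \<omega>)"
    proof (intro mult_left_mono integral_mono Bochner_Integration.integrable_sum X(1))
      show "integrable M (indicat_real (E k))" by (simp add: less_top[symmetric])
      show "indicator (E k) \<omega> \<le> (\<Sum>i\<in>UNIV. ?L i \<omega>)" if w: "\<omega> \<in> space M" for \<omega>
      proof (cases "\<omega> \<in> E k")
        case True
        hence "X s \<omega> \<in> U" using k unfolding E_def stay_def s_def by auto
        from drift[OF X_in[OF w s0] this] True show ?thesis unfolding Z2 by simp
      qed (simp add: Z2)
    qed (use h in auto)
    also have "\<dots> = (\<Sum>i\<in>UNIV. h * expectation (?L i))"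
      unfolding sum_distrib_left[symmetric] by (subst Bochner_Integration.integral_sum[OF X(1)]) (rule refl)
    also have "\<dots> \<le> (\<Sum>i\<in>UNIV. expectation (\<lambda>\<omega>. (Z i \<omega>)\<^sup>2 * (exp (\<alpha> * (X (s + h) \<omega> $ i - X s \<omega> $ i)) - 1)) + D * (h * r) * (exp \<alpha> * prob (E k)))"
    proof (rule sum_mono)
      fix i
      have "D * (h * r) * expectation (\<lambda>\<omega>. (Z i \<omega>)\<^sup>2) \<le> D * (h * r) * (exp \<alpha> * prob (E k))"
        using D0 h r by (intro mult_left_mono EZ) auto
      thus "h * expectation (?L i) \<le> expectation (\<lambda>\<omega>. (Z i \<omega>)\<^sup>2 * (exp (\<alpha> * (X (s + h) \<omega> $ i - X s \<omega> $ i)) - 1)) + D * (h * r) * (exp \<alpha> * prob (E k))"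
        using X(3)[of i] unfolding h(3) by linarith
    qed
    also have "\<dots> = (\<Sum>i\<in>UNIV. expectation (\<lambda>\<omega>. (Z i \<omega>)\<^sup>2 * (exp (\<alpha> * (X (s + h) \<omega> $ i - X s \<omega> $ i)) - 1))) + (D * r * H) * (h * prob (E k))"
      unfolding sum.distrib by (simp add: H_def mult_ac)
    also have "\<dots> \<le> (\<Sum>i\<in>UNIV. expectation (\<lambda>\<omega>. (Z i \<omega>)\<^sup>2 * (exp (\<alpha> * (X (s + h) \<omega> $ i - X s \<omega> $ i)) - 1))) + 1 / 2 * (h * prob (E k))"
      using r(3) h by (intro add_left_mono mult_right_mono) auto
    also have "(\<Sum>i\<in>UNIV. expectation (\<lambda>\<omega>. (Z i \<omega>)\<^sup>2 * (exp (\<alpha> * (X (s + h) \<omega> $ i - X s \<omega> $ i)) - 1))) =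
       expectation (\<lambda>\<omega>. \<Sum>i\<in>UNIV. (Z i \<omega>)\<^sup>2 * (exp (\<alpha> * (X (s + h) \<omega> $ i - X s \<omega> $ i)) - 1))"
      by (rule Bochner_Integration.integral_sum[symmetric, OF X(2)])
    also have "\<dots> = expectation (\<lambda>\<omega>. indicator (E k) \<omega> * f (X (s + h) \<omega>) - indicator (E k) \<omega> * f (X s \<omega>))"
    proof (rule Bochner_Integration.integral_cong[OF refl])
      fix \<omega>
      have "(Z i \<omega>)\<^sup>2 * (exp (\<alpha> * (X (s + h) \<omega> $ i - X s \<omega> $ i)) - 1) =
          indicator (E k) \<omega> * (exp (\<alpha> * X (s + h) \<omega> $ i) - exp (\<alpha> * X s \<omega> $ i))" for i
        unfolding Z2 by (simp add: right_diff_distrib exp_diff field_simps)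
      thus "(\<Sum>i\<in>UNIV. (Z i \<omega>)\<^sup>2 * (exp (\<alpha> * (X (s + h) \<omega> $ i - X s \<omega> $ i)) - 1)) =
          indicator (E k) \<omega> * f (X (s + h) \<omega>) - indicator (E k) \<omega> * f (X s \<omega>)"
        by (simp add: f_def sum_distrib_left[symmetric] sum_subtractf right_diff_distrib)
    qed
    also have "\<dots> = expectation (\<lambda>\<omega>. indicator (E k) \<omega> * f (X (s + h) \<omega>)) - expectation (\<lambda>\<omega>. indicator (E k) \<omega> * f (X s \<omega>))"
    proof (rule Bochner_Integration.integral_diff)
      have i: "integrable M (\<lambda>\<omega>. indicator (E k) \<omega> * f (X t \<omega>))" if "0 \<le> t" for t
      proof (rule integrable_const_bound[where B=H])
        show "AE \<omega> in M. norm (indicator (E k) \<omega> * f (X t \<omega>)) \<le> H"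
          using f[OF X_in[OF _ that]] H0 by (intro AE_I2) (auto simp: indicator_def)
        show "(\<lambda>\<omega>. indicator (E k) \<omega> * f (X t \<omega>)) \<in> borel_measurable M" using X_M[OF that] by measurable
      qed
      show "integrable M (\<lambda>\<omega>. indicator (E k) \<omega> * f (X (s + h) \<omega>))" "integrable M (\<lambda>\<omega>. indicator (E k) \<omega> * f (X s \<omega>))"
        using s0 h by (auto intro!: i)
    qed
    finally show ?thesis unfolding s' s_def[symmetric] by simp
  qed
  \<comment> \<open>Subtracting the upper bound \<open>H\<close> makes the integrand nonpositive, so
    passing from \<open>E k\<close> to the smaller event \<open>E (Suc k)\<close> can only increase
    the expectation. This lets the gains of the single steps telescope.\<close>
  define g where "g k = expectation (\<lambda>\<omega>. indicator (E k) \<omega> * (f (X (real k * h) \<omega>) - H))" for k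
  have i: "integrable M (\<lambda>\<omega>. indicator (E l) \<omega> * f (X (real k * h) \<omega>))" for k l
  proof (rule integrable_const_bound[where B=H])
    show "AE \<omega> in M. norm (indicator (E l) \<omega> * f (X (real k * h) \<omega>)) \<le> H"
      using f[OF X_in[OF _ ET[of k]]] H0 by (intro AE_I2) (auto simp: indicator_def)
    show "(\<lambda>\<omega>. indicator (E l) \<omega> * f (X (real k * h) \<omega>)) \<in> borel_measurable M" using X_M[OF ET[of k]] by measurable
  qed
  have iE: "integrable M (indicat_real (E k))" for k by (simp add: less_top[symmetric])
  have gk: "g k = expectation (\<lambda>\<omega>. indicator (E k) \<omega> * f (X (real k * h) \<omega>)) - H * prob (E k)" for k
  proof -
    have "g k = expectation (\<lambda>\<omega>. indicator (E k) \<omega> * f (X (real k * h) \<omega>) - H * indicator (E k) \<omega>)"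
      unfolding g_def by (simp add: right_diff_distrib mult.commute)
    thus ?thesis using i[of k k] iE[of k] by simp
  qed
  have g_step: "g k + h / 2 * prob (E k) \<le> g (Suc k)" if "1 \<le> k" for k
  proof -
    have "expectation (\<lambda>\<omega>. indicator (E k) \<omega> * f (X (real (Suc k) * h) \<omega>)) - H * prob (E k) =
        expectation (\<lambda>\<omega>. indicator (E k) \<omega> * f (X (real (Suc k) * h) \<omega>) - H * indicator (E k) \<omega>)"
      using i[of k "Suc k"] iE[of k] by simp
    also have "\<dots> \<le> expectation (\<lambda>\<omega>. indicator (E (Suc k)) \<omega> * f (X (real (Suc k) * h) \<omega>) - H * indicator (E (Suc k)) \<omega>)"
    proof (intro integral_mono Bochner_Integration.integrable_diff i integrable_mult_right iE)
      fix \<omega> assume w: "\<omega> \<in> space M"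
      show "indicator (E k) \<omega> * f (X (real (Suc k) * h) \<omega>) - H * indicator (E k) \<omega>
         \<le> indicator (E (Suc k)) \<omega> * f (X (real (Suc k) * h) \<omega>) - H * indicator (E (Suc k)) \<omega>"
        using E_sub[of k] f(2)[OF X_in[OF w ET[of "Suc k"]]] by (auto simp: indicator_def)
    qed
    also have "\<dots> = g (Suc k)" unfolding gk using i[of "Suc k" "Suc k"] iE[of "Suc k"] by simp
    finally show ?thesis using step[OF that] unfolding gk[of k] by linarith
  qed
  have g_bd: "g k \<le> 0" "- H \<le> g k" for k
  proof -
    have "expectation (\<lambda>\<omega>. indicator (E k) \<omega> * f (X (real k * h) \<omega>)) \<le> expectation (\<lambda>\<omega>. H * indicator (E k) \<omega>)"
      using f(2)[OF X_in[OF _ ET[of k]]]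
      by (intro integral_mono i integrable_mult_right iE) (auto simp: indicator_def)
    thus "g k \<le> 0" unfolding gk by simp
    have "0 \<le> expectation (\<lambda>\<omega>. indicator (E k) \<omega> * f (X (real k * h) \<omega>))"
      using f(1)[OF X_in[OF _ ET[of k]]] by (intro integral_nonneg_AE AE_I2) (auto simp: indicator_def)
    moreover have "H * prob (E k) \<le> H * 1" using H0 by (intro mult_left_mono) auto
    ultimately show "- H \<le> g k" unfolding gk by linarith
  qed
  have tele: "h / 2 * (\<Sum>k<N. prob (E (Suc k))) \<le> g (Suc N) - g 1" for N
  proof (induction N)
    case (Suc N)
    thus ?case using g_step[of "Suc N"] by (simp add: distrib_left)
  qed simp
  have "h / 2 * (\<Sum>k<N. prob (E (Suc k))) \<le> H" for N
    using tele[of N] g_bd(1)[of "Suc N"] g_bd(2)[of 1] by linarith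
  hence "(\<Sum>k<N. prob (E (Suc k))) \<le> 2 * H / h" for N using h by (simp add: field_simps)
  thus ?thesis using h(1) unfolding E_def by blast
qed

text \<open>A measurable majorant is produced instead of a mere bound on the integral of
  \<open>hit_time\<close>: for a function not known to be measurable, \<open>nn_integral\<close> is
  a lower integral, and its finiteness would not give the almost sure finiteness wanted for the
  supremum.\<close>

lemma hit_time_dominated:
  assumes \<alpha>: "0 \<le> \<alpha>" and S: "\<And>y i. y \<in> S \<Longrightarrow> 0 \<le> y $ i \<and> y $ i \<le> 1"
    and drift: "\<And>y. y \<in> S \<Longrightarrow> (\<And>i. y $ i < 1 - \<epsilon>) \<Longrightarrow>
      1 \<le> (\<Sum>i\<in>UNIV. exp (\<alpha> * y $ i) * (\<alpha> * b y $ i + \<alpha>\<^sup>2 / 2 * (c y $ i \<bullet> c y $ i)))"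
  shows "\<exists>g\<in>borel_measurable M. (\<integral>\<^sup>+\<omega>. g \<omega> \<partial>M) < \<infinity> \<and> (\<forall>\<omega>\<in>space M. hit_time X \<epsilon> \<omega> \<le> g \<omega>)"
proof -
  define U where "U = {y :: real^'n. \<forall>i. y $ i < 1 - \<epsilon>}"
  have "U = {y \<in> space borel. \<forall>i\<in>UNIV. y $ i < 1 - \<epsilon>}" by (simp add: U_def)
  also have "\<dots> \<in> sets borel" by (intro sets.sets_Collect_finite_All) auto
  finally have U: "U \<in> sets borel" .
  obtain h C where h: "0 < h" and C: "\<And>N. (\<Sum>k<N. prob (stay U h (Suc k))) \<le> C"
    using summable_stay[OF \<alpha> S U] drift unfolding U_def by blast
  have [measurable]: "stay U h k \<in> events" for k using stay_events[OF U] h by simp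
  \<comment> \<open>The summand 1 accounts for the exit step: if \<open>j\<close> is the first
    positive grid index with \<open>X\<close> outside \<open>U\<close>, then \<omega> lies in the
    events for 1 to \<open>j - 1\<close>, and the sum is at least \<open>j - 1\<close>.\<close>
  define g where "g \<omega> = ennreal h * (1 + (\<Sum>k. indicator (stay U h (Suc k)) \<omega>))" for \<omega>
  have gM: "g \<in> borel_measurable M" unfolding g_def by measurable
  have "(\<integral>\<^sup>+\<omega>. g \<omega> \<partial>M) = ennreal h * (1 + (\<Sum>k. emeasure M (stay U h (Suc k))))"
    unfolding g_def by (simp add: nn_integral_cmult nn_integral_add nn_integral_suminf emeasure_space_1)
  also have "(\<Sum>k. emeasure M (stay U h (Suc k))) \<le> ennreal C"
    unfolding suminf_eq_SUP emeasure_eq_measure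
    using C by (intro SUP_least) (simp add: sum_ennreal ennreal_leI)
  finally have "(\<integral>\<^sup>+\<omega>. g \<omega> \<partial>M) \<le> ennreal h * (1 + ennreal C)" by (simp add: mult_left_mono)
  also have "\<dots> < \<infinity>" by (simp add: ennreal_mult_less_top)
  finally have fin: "(\<integral>\<^sup>+\<omega>. g \<omega> \<partial>M) < \<infinity>" .
  have "hit_time X \<epsilon> \<omega> \<le> g \<omega>" if w: "\<omega> \<in> space M" for \<omega>
  proof -
    have count: "of_nat n \<le> (\<Sum>k. indicator (stay U h (Suc k)) \<omega> :: ennreal)"
      if "\<And>j. 1 \<le> j \<Longrightarrow> j \<le> n \<Longrightarrow> X (real j * h) \<omega> \<in> U" for n
    proof -
      have "of_nat n = (\<Sum>k<n. indicator (stay U h (Suc k)) \<omega> :: ennreal)"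
        using that w by (subst sum.cong[OF refl, of _ _ "\<lambda>_. 1"]) (auto simp: stay_def indicator_def)
      also have "\<dots> \<le> (\<Sum>k. indicator (stay U h (Suc k)) \<omega>)" by (rule sum_le_suminf) auto
      finally show ?thesis .
    qed
    show ?thesis
    proof (cases "\<exists>j\<ge>1. X (real j * h) \<omega> \<notin> U")
      case True
      define j where "j = (LEAST j. 1 \<le> j \<and> X (real j * h) \<omega> \<notin> U)"
      have j: "1 \<le> j" "X (real j * h) \<omega> \<notin> U" using LeastI_ex[OF True[unfolded Bex_def]] unfolding j_def by auto
      have lt: "X (real l * h) \<omega> \<in> U" if "1 \<le> l" "l < j" for l
        using not_less_Least[of l "\<lambda>j. 1 \<le> j \<and> X (real j * h) \<omega> \<notin> U"] that unfolding j_def by auto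
      have "hit_time X \<epsilon> \<omega> \<le> ennreal (real j * h)"
        unfolding hit_time_def using j h by (intro INF_lower) (auto simp: U_def not_less)
      also have "\<dots> = ennreal h * of_nat j" using h by (simp add: ennreal_mult' mult.commute ennreal_of_nat_eq_real_of_nat)
      also have "of_nat j = (1 + of_nat (j - 1) :: ennreal)" using j(1) by (metis le_add_diff_inverse of_nat_1 of_nat_add)
      also have "ennreal h * \<dots> \<le> g \<omega>"
        unfolding g_def using lt j by (intro mult_left_mono add_left_mono count) auto
      finally show ?thesis .
    next
      \<comment> \<open>A path that stays in \<open>U\<close> at all positive grid times makes the
        count infinite, so the bound is trivial there; the majorant takes the value
        \<open>\<top>\<close>.\<close>
      case False
      hence "of_nat n \<le> (\<Sum>k. indicator (stay U h (Suc k)) \<omega> :: ennreal)" for n by (intro count) auto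
      hence "(\<Sum>k. indicator (stay U h (Suc k)) \<omega> :: ennreal) = \<top>"
        by (meson ennreal_Ex_less_of_nat less_top not_less)
      thus ?thesis unfolding g_def using h by (simp add: ennreal_mult_top)
    qed
  qed
  with gM fin show ?thesis by blast
qed

end

subsection \<open>The replicator equation\<close>

text \<open>Boundedness belongs to the notion to make it closed under products. Once the coordinates
  have the property, every polynomial in them does.\<close>

definition bounded_lipschitz_on :: "'a::real_normed_vector set \<Rightarrow> ('a \<Rightarrow> real) \<Rightarrow> bool" where
  "bounded_lipschitz_on S f \<longleftrightarrow> (\<exists>K\<ge>0. \<forall>y\<in>S. \<bar>f y\<bar> \<le> K \<and> (\<forall>z\<in>S. \<bar>f y - f z\<bar> \<le> K * norm (y - z)))"

lemma bounded_lipschitz_onE: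
  assumes "bounded_lipschitz_on S f"
  obtains K where "0 \<le> K" "\<And>y. y \<in> S \<Longrightarrow> \<bar>f y\<bar> \<le> K"
    "\<And>y z. y \<in> S \<Longrightarrow> z \<in> S \<Longrightarrow> \<bar>f y - f z\<bar> \<le> K * norm (y - z)"
  using assms unfolding bounded_lipschitz_on_def by auto

lemma bounded_lipschitz_on_const [intro]: "bounded_lipschitz_on S (\<lambda>y. a)"
  unfolding bounded_lipschitz_on_def by (intro exI[of _ "\<bar>a\<bar>"]) auto

lemma bounded_lipschitz_on_add [intro]:
  assumes "bounded_lipschitz_on S f" "bounded_lipschitz_on S g"
  shows "bounded_lipschitz_on S (\<lambda>y. f y + g y)"
proof -
  obtain K where K: "0 \<le> K" "\<And>y. y \<in> S \<Longrightarrow> \<bar>f y\<bar> \<le> K"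
    "\<And>y z. y \<in> S \<Longrightarrow> z \<in> S \<Longrightarrow> \<bar>f y - f z\<bar> \<le> K * norm (y - z)" using assms(1) by (rule bounded_lipschitz_onE) blast
  obtain L where L: "0 \<le> L" "\<And>y. y \<in> S \<Longrightarrow> \<bar>g y\<bar> \<le> L"
    "\<And>y z. y \<in> S \<Longrightarrow> z \<in> S \<Longrightarrow> \<bar>g y - g z\<bar> \<le> L * norm (y - z)" using assms(2) by (rule bounded_lipschitz_onE) blast
  show ?thesis unfolding bounded_lipschitz_on_def
  proof (intro exI[of _ "K + L"] conjI ballI)
    fix y z assume yz: "y \<in> S" "z \<in> S"
    show "\<bar>f y + g y - (f z + g z)\<bar> \<le> (K + L) * norm (y - z)"
      using K(3)[OF yz] L(3)[OF yz] unfolding distrib_right by linarith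
  next
    fix y assume "y \<in> S"
    thus "\<bar>f y + g y\<bar> \<le> K + L" using K(2)[of y] L(2)[of y] by linarith
  qed (use K L in auto)
qed

lemma bounded_lipschitz_on_mult [intro]:
  assumes "bounded_lipschitz_on S f" "bounded_lipschitz_on S g"
  shows "bounded_lipschitz_on S (\<lambda>y. f y * g y)"
proof -
  obtain K where K: "0 \<le> K" "\<And>y. y \<in> S \<Longrightarrow> \<bar>f y\<bar> \<le> K"
    "\<And>y z. y \<in> S \<Longrightarrow> z \<in> S \<Longrightarrow> \<bar>f y - f z\<bar> \<le> K * norm (y - z)" using assms(1) by (rule bounded_lipschitz_onE) blast
  obtain L where L: "0 \<le> L" "\<And>y. y \<in> S \<Longrightarrow> \<bar>g y\<bar> \<le> L"
    "\<And>y z. y \<in> S \<Longrightarrow> z \<in> S \<Longrightarrow> \<bar>g y - g z\<bar> \<le> L * norm (y - z)" using assms(2) by (rule bounded_lipschitz_onE) blast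
  show ?thesis unfolding bounded_lipschitz_on_def
  proof (intro exI[of _ "2 * (K * L)"] conjI ballI)
    fix y z assume yz: "y \<in> S" "z \<in> S"
    have "f y * g y - f z * g z = f y * (g y - g z) + (f y - f z) * g z" by (simp add: algebra_simps)
    also have "\<bar>\<dots>\<bar> \<le> \<bar>f y\<bar> * \<bar>g y - g z\<bar> + \<bar>f y - f z\<bar> * \<bar>g z\<bar>"
      by (rule order_trans[OF abs_triangle_ineq]) (simp add: abs_mult)
    also have "\<dots> \<le> K * (L * norm (y - z)) + (K * norm (y - z)) * L"
      using K L yz by (intro add_mono mult_mono) auto
    finally show "\<bar>f y * g y - f z * g z\<bar> \<le> 2 * (K * L) * norm (y - z)" by (simp add: algebra_simps)
  next
    fix y assume y: "y \<in> S"
    have "\<bar>f y * g y\<bar> \<le> K * L" unfolding abs_mult using K L y by (intro mult_mono) auto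
    thus "\<bar>f y * g y\<bar> \<le> 2 * (K * L)" using mult_nonneg_nonneg[OF K(1) L(1)] by linarith
  qed (use K L in auto)
qed

lemma bounded_lipschitz_on_diff [intro]:
  "bounded_lipschitz_on S f \<Longrightarrow> bounded_lipschitz_on S g \<Longrightarrow> bounded_lipschitz_on S (\<lambda>y. f y - g y)"
  using bounded_lipschitz_on_add[of S f "\<lambda>y. -1 * g y"] bounded_lipschitz_on_mult[of S "\<lambda>_. -1" g] by auto

lemma bounded_lipschitz_on_sum [intro]:
  "(\<And>i. i \<in> I \<Longrightarrow> bounded_lipschitz_on S (f i)) \<Longrightarrow> bounded_lipschitz_on S (\<lambda>y. \<Sum>i\<in>I. f i y)"
  by (induction I rule: infinite_finite_induct) auto

text \<open>The sum of the individual constants serves all indices at once. The index type is any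
  finite type, so pairs can index the entries of a matrix.\<close>

lemma bounded_lipschitz_on_uniform:
  fixes f :: "'i::finite \<Rightarrow> 'a::real_normed_vector \<Rightarrow> real"
  assumes "\<And>i. bounded_lipschitz_on S (f i)"
  obtains K where "0 \<le> K" "\<And>y i. y \<in> S \<Longrightarrow> \<bar>f i y\<bar> \<le> K"
    "\<And>y z i. y \<in> S \<Longrightarrow> z \<in> S \<Longrightarrow> \<bar>f i y - f i z\<bar> \<le> K * norm (y - z)"
proof -
  have "\<forall>i. \<exists>K\<ge>0. \<forall>y\<in>S. \<bar>f i y\<bar> \<le> K \<and> (\<forall>z\<in>S. \<bar>f i y - f i z\<bar> \<le> K * norm (y - z))"
    using assms unfolding bounded_lipschitz_on_def by blast
  then obtain k where k: "\<And>i. 0 \<le> k i" "\<And>i y. y \<in> S \<Longrightarrow> \<bar>f i y\<bar> \<le> k i"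
    "\<And>i y z. y \<in> S \<Longrightarrow> z \<in> S \<Longrightarrow> \<bar>f i y - f i z\<bar> \<le> k i * norm (y - z)" by metis
  have le: "k i \<le> sum k UNIV" for i using k(1) by (intro member_le_sum) auto
  show ?thesis
  proof (rule that[of "sum k UNIV"])
    show "\<bar>f i y\<bar> \<le> sum k UNIV" if "y \<in> S" for i y using k(2)[OF that, of i] le[of i] by linarith
    show "\<bar>f i y - f i z\<bar> \<le> sum k UNIV * norm (y - z)" if "y \<in> S" "z \<in> S" for i y z
      using k(3)[OF that, of i] mult_right_mono[OF le[of i], of "norm (y - z)"] by auto
  qed (use k in \<open>auto intro: sum_nonneg\<close>)
qed

lemma bounded_lipschitz_on_nth [intro]: "bounded_lipschitz_on open_simplex (\<lambda>y :: real^'n. y $ i)"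
  unfolding bounded_lipschitz_on_def
proof (intro exI[of _ 1] conjI ballI)
  fix y z :: "real^'n"
  show "\<bar>y $ i - z $ i\<bar> \<le> 1 * norm (y - z)" using component_le_norm_cart[of "y - z" i] by simp
qed (auto simp: open_simplex_def abs_le_iff less_imp_le intro: order_trans[of _ 0])

section \<open>The coefficients of the replicator equation\<close>

text \<open>The payoff of strategy \<open>i\<close> under the noise-corrected matrix, minus the
  population mean. Splitting off the factor \<open>y $ i\<close> of the drift matters near the faces
  of the simplex: the drift is then at least a multiple of \<open>- y $ i\<close>, which the
  Lyapunov estimate can weigh against a noise term of order \<open>(y $ i)\<^sup>2\<close>
  uniformly.\<close>

definition fitness_gap :: "real^'n^'n \<Rightarrow> real^'n \<Rightarrow> 'n \<Rightarrow> real^'n \<Rightarrow> real" where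
  "fitness_gap A \<sigma> i y =
     (\<Sum>k\<in>UNIV. (A - diagm (\<chi> j. (\<sigma> $ j)\<^sup>2)) $ i $ k * y $ k) -
     (\<Sum>j\<in>UNIV. y $ j * (\<Sum>k\<in>UNIV. (A - diagm (\<chi> j. (\<sigma> $ j)\<^sup>2)) $ j $ k * y $ k))"

lemma repl_drift_nth: "repl_drift A \<sigma> y $ i = y $ i * fitness_gap A \<sigma> i y"
proof -
  define v where "v = (A - diagm (\<chi> j. (\<sigma> $ j)\<^sup>2)) *v y"
  have v: "v $ j = (\<Sum>k\<in>UNIV. (A - diagm (\<chi> j. (\<sigma> $ j)\<^sup>2)) $ j $ k * y $ k)" for j
    by (simp add: v_def matrix_vector_mult_def)
  have "repl_drift A \<sigma> y $ i = (\<Sum>j\<in>UNIV. ((if i = j then y $ i else 0) - y $ i * y $ j) * v $ j)"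
    unfolding repl_drift_def v_def[symmetric] by (simp add: matrix_vector_mult_def diagm_def outerp_def)
  also have "\<dots> = (\<Sum>j\<in>UNIV. (if i = j then y $ i * v $ j else 0)) - (\<Sum>j\<in>UNIV. y $ i * (y $ j * v $ j))"
    by (simp add: left_diff_distrib sum_subtractf if_distrib[of "\<lambda>t. t * _"] mult.assoc cong: if_cong)
  also have "\<dots> = y $ i * (v $ i - (\<Sum>j\<in>UNIV. y $ j * v $ j))"
    by (simp add: sum.delta' right_diff_distrib sum_distrib_left)
  finally show ?thesis by (simp add: fitness_gap_def v)
qed

lemma repl_diff_nth: "repl_diff \<sigma> y $ i $ j = ((if i = j then y $ i else 0) - y $ i * y $ j) * \<sigma> $ j"
  by (simp add: repl_diff_def matrix_matrix_mult_def diagm_def outerp_def if_distrib[of "\<lambda>t. _ * t"] sum.delta cong: if_cong)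

lemma bounded_lipschitz_fitness_gap: "bounded_lipschitz_on open_simplex (fitness_gap A \<sigma> i)"
  unfolding fitness_gap_def[abs_def] by (intro bounded_lipschitz_on_diff bounded_lipschitz_on_sum bounded_lipschitz_on_mult) auto

lemma bounded_lipschitz_repl_drift: "bounded_lipschitz_on open_simplex (\<lambda>y. repl_drift A \<sigma> y $ i)"
  unfolding repl_drift_nth using bounded_lipschitz_fitness_gap by (intro bounded_lipschitz_on_mult) auto

lemma bounded_lipschitz_repl_diff: "bounded_lipschitz_on open_simplex (\<lambda>y. repl_diff \<sigma> y $ i $ j)"
proof -
  have "(\<lambda>y. repl_diff \<sigma> y $ i $ j) = (\<lambda>y. ((if i = j then 1 else 0) * y $ i - y $ i * y $ j) * \<sigma> $ j)"
    by (auto simp: repl_diff_nth)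
  thus ?thesis by (simp only:) (intro bounded_lipschitz_on_diff bounded_lipschitz_on_mult bounded_lipschitz_on_nth bounded_lipschitz_on_const)
qed

lemma continuous_repl_drift: "continuous_on UNIV (repl_drift A \<sigma>)"
proof -
  have "repl_drift A \<sigma> = (\<lambda>y. \<chi> i. y $ i * fitness_gap A \<sigma> i y)"
    by (auto simp: vec_eq_iff repl_drift_nth)
  thus ?thesis by (simp add: fitness_gap_def) (intro continuous_intros)
qed

lemma continuous_repl_diff: "continuous_on UNIV (repl_diff \<sigma>)"
proof -
  have "repl_diff \<sigma> = (\<lambda>y. \<chi> i j. ((if i = j then 1 else 0) * y $ i - y $ i * y $ j) * \<sigma> $ j)"
    by (auto simp: vec_eq_iff repl_diff_nth)
  thus ?thesis by (simp only:) (intro continuous_intros)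
qed

lemma open_simplex_bounds: "y \<in> open_simplex \<Longrightarrow> 0 < y $ i" "y \<in> open_simplex \<Longrightarrow> y $ i < 1"
  by (auto simp: open_simplex_def)

text \<open>The term of the largest coordinate, at least \<open>1/n\<close>, dominates for large \<open>\<alpha>\<close>: its exponential weight
  is maximal and its bracket grows quadratically in \<open>\<alpha>\<close>, while every other bracket is bounded
  below by \<open>- K\<^sup>2 / (2 \<gamma>)\<close> independently of \<open>\<alpha>\<close>.\<close>

lemma exponential_lyapunov:
  fixes \<gamma> K :: real
  assumes \<gamma>: "0 < \<gamma>" and K: "0 \<le> K"
  obtains \<alpha> where "0 \<le> \<alpha>"
    "\<And>(y :: real^'n) \<beta> u. y \<in> open_simplex \<Longrightarrow> (\<And>i. - K * y $ i \<le> \<beta> i) \<Longrightarrow> (\<And>i. \<gamma> * (y $ i)\<^sup>2 \<le> u i) \<Longrightarrow>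
      1 \<le> (\<Sum>i\<in>UNIV. exp (\<alpha> * y $ i) * (\<alpha> * \<beta> i + \<alpha>\<^sup>2 / 2 * u i))"
proof -
  define n where "n = real CARD('n)"
  have n: "n > 0" by (simp add: n_def)
  \<comment> \<open>\<open>- e\<close> is the minimum over q of the parabola -K q + (\<gamma>/2)
    q^2, which bounds the bracket of a coordinate from below with q = \<alpha> y_i.\<close>
  define e where "e = K\<^sup>2 / (2 * \<gamma>)"
  have e: "0 \<le> e" using \<gamma> by (simp add: e_def)
  \<comment> \<open>From this threshold on the parabola is at least \<open>n * e + 1\<close>, enough
    to outweigh the other brackets and leave 1. As the largest coordinate is at least 1/n, the
    factor \<open>n\<close> in \<open>\<alpha>\<close> takes its argument past
    \<open>Q\<close>.\<close>
  define Q where "Q = max 1 (2 / \<gamma> * (K + n * e + 1))"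
  define \<alpha> where "\<alpha> = n * Q"
  have Q: "Q \<ge> 1" "2 / \<gamma> * (K + n * e + 1) \<le> Q" by (auto simp: Q_def)
  have QK: "K + n * e + 1 \<le> \<gamma> / 2 * Q" using Q(2) \<gamma> by (simp add: field_simps)
  have \<alpha>: "0 \<le> \<alpha>" using n Q by (simp add: \<alpha>_def)
  show ?thesis
  proof (rule that[OF \<alpha>])
    fix y :: "real^'n" and \<beta> u
    assume y: "y \<in> open_simplex" and \<beta>: "\<And>i. - K * y $ i \<le> \<beta> i" and u: "\<And>i. \<gamma> * (y $ i)\<^sup>2 \<le> u i"
    have "\<exists>m. \<forall>i. y $ i \<le> y $ m"
      using Max_in[of "range (\<lambda>i. y $ i)"] Max_ge[of "range (\<lambda>i. y $ i)"] by fastforce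
    then obtain m where m: "\<And>i. y $ i \<le> y $ m" by blast
    have "1 = (\<Sum>i\<in>UNIV. y $ i)" using y by (simp add: open_simplex_def)
    also have "\<dots> \<le> (\<Sum>i\<in>(UNIV :: 'n set). y $ m)" by (intro sum_mono m)
    finally have nm: "1 \<le> n * y $ m" by (simp add: n_def)
    define q where "q i = \<alpha> * y $ i" for i
    have qm: "Q \<le> q m" using mult_left_mono[OF nm, of Q] Q(1) by (simp add: q_def \<alpha>_def mult_ac)
    have q_le: "q i \<le> q m" for i unfolding q_def using \<alpha> m by (intro mult_left_mono)
    define t where "t i = \<alpha> * \<beta> i + \<alpha>\<^sup>2 / 2 * u i" for i
    have t: "- K * q i + \<gamma> / 2 * (q i)\<^sup>2 \<le> t i" for i
    proof -
      have "\<alpha> * (- K * y $ i) \<le> \<alpha> * \<beta> i" using \<alpha> \<beta> by (intro mult_left_mono)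
      moreover have "\<alpha>\<^sup>2 / 2 * (\<gamma> * (y $ i)\<^sup>2) \<le> \<alpha>\<^sup>2 / 2 * u i" using u by (intro mult_left_mono) auto
      ultimately show ?thesis by (simp add: t_def q_def power_mult_distrib mult_ac)
    qed
    have te: "- e \<le> t i" for i
    proof -
      have "0 \<le> (\<gamma> * q i - K)\<^sup>2 / (2 * \<gamma>)" using \<gamma> by simp
      also have "\<dots> = - K * q i + \<gamma> / 2 * (q i)\<^sup>2 + e"
        using \<gamma> by (simp add: e_def power2_eq_square field_simps)
      finally show ?thesis using t[of i] by linarith
    qed
    have others: "- (exp (q m) * e) \<le> exp (q i) * t i" for i
    proof -
      have "exp (q i) * (- e) \<le> exp (q i) * t i" by (intro mult_left_mono te) auto
      moreover have "exp (q i) * e \<le> exp (q m) * e" using q_le[of i] e by (intro mult_right_mono) auto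
      ultimately show ?thesis by linarith
    qed
    have "\<gamma> / 2 * Q - K \<le> \<gamma> / 2 * q m - K" using qm \<gamma> by simp
    hence "n * e + 1 \<le> \<gamma> / 2 * q m - K" using QK by linarith
    also have "\<dots> \<le> q m * (\<gamma> / 2 * q m - K)"
    proof -
      have "0 \<le> n * e" using n e by simp
      hence "1 * (\<gamma> / 2 * q m - K) \<le> q m * (\<gamma> / 2 * q m - K)"
        using calculation qm Q(1) by (intro mult_right_mono) linarith+
      thus ?thesis by simp
    qed
    also have "\<dots> = - K * q m + \<gamma> / 2 * (q m)\<^sup>2" by (simp add: power2_eq_square algebra_simps)
    also have "\<dots> \<le> t m" by (rule t)
    finally have tm: "n * e + 1 \<le> t m" .
    have "1 \<le> exp (q m)" using qm Q(1) by simp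
    also have "exp (q m) \<le> exp (q m) * (t m - n * e)" using tm by simp
    also have "\<dots> \<le> exp (q m) * t m + (\<Sum>i\<in>UNIV - {m}. - (exp (q m) * e))"
      using e by (simp add: n_def card_Diff_singleton algebra_simps of_nat_diff)
    also have "\<dots> \<le> exp (q m) * t m + (\<Sum>i\<in>UNIV - {m}. exp (q i) * t i)"
      by (intro add_left_mono sum_mono others)
    also have "\<dots> = (\<Sum>i\<in>UNIV. exp (q i) * t i)" by (simp add: sum.remove[of UNIV m])
    finally show "1 \<le> (\<Sum>i\<in>UNIV. exp (\<alpha> * y $ i) * (\<alpha> * \<beta> i + \<alpha>\<^sup>2 / 2 * u i))"
      by (simp add: q_def t_def)
  qed
qed

section \<open>The event that the supremum equals 1\<close>

text \<open>Two descriptions for two uses. The first, with weak inequalities, is what finite hitting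
  times deliver. The second involves countably many times and shows that the event is measurable;
  its inequality is strict, hence an open condition, which continuity of the path carries over to a
  nearby rational time.\<close>

lemma sup_max_eq_one_iff:
  fixes Y :: "real \<Rightarrow> real^'n"
  assumes Y: "\<And>t. 0 \<le> t \<Longrightarrow> Y t \<in> open_simplex" and cont: "continuous_on {0..} Y"
  shows "(SUP t\<in>{0<..}. Max (range (\<lambda>k. Y t $ k))) = 1 \<longleftrightarrow>
      (\<forall>m::nat. \<exists>t>0. \<exists>k. 1 - 1 / (real m + 1) \<le> Y t $ k)" (is "?l = ?r")
    and "(SUP t\<in>{0<..}. Max (range (\<lambda>k. Y t $ k))) = 1 \<longleftrightarrow>
      (\<forall>m::nat. \<exists>t\<in>\<rat> \<inter> {0<..}. \<exists>k. 1 - 1 / (real m + 1) < Y t $ k)" (is "?l = ?q")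
proof -
  let ?M = "\<lambda>t. Max (range (\<lambda>k. Y t $ k))"
  have M1: "?M t \<le> 1" if "0 < t" for t
    using open_simplex_bounds(2)[OF Y] that by (subst Max_le_iff) (auto intro: less_imp_le)
  have bdd: "bdd_above (?M ` {0<..})" using M1 by (intro bdd_aboveI[of _ 1]) auto
  have "?l \<Longrightarrow> ?q"
  proof
    fix m :: nat
    assume ?l
    hence "1 - 1 / (real m + 1) < (SUP t\<in>{0<..}. ?M t)" by simp
    then obtain t where t: "0 < t" "1 - 1 / (real m + 1) < ?M t"
      by (subst (asm) less_cSUP_iff[OF _ bdd]) auto
    then obtain k where k: "1 - 1 / (real m + 1) < Y t $ k" by (subst (asm) Max_gr_iff) auto
    have "continuous_on {0<..} (\<lambda>s. Y s $ k)"
      by (intro continuous_intros continuous_on_subset[OF cont]) auto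
    hence "open {s \<in> {0<..}. Y s $ k \<in> {1 - 1 / (real m + 1)<..}}"
      by (rule continuous_open_preimage[of _ _ "{1 - 1 / (real m + 1)<..}", unfolded vimage_def Int_def mem_Collect_eq]) auto
    moreover have "t \<in> {s \<in> {0<..}. Y s $ k \<in> {1 - 1 / (real m + 1)<..}}" using t k by simp
    ultimately obtain r where r: "r > 0" "\<And>s. dist s t < r \<Longrightarrow> s \<in> {s \<in> {0<..}. Y s $ k \<in> {1 - 1 / (real m + 1)<..}}"
      unfolding open_dist by blast
    obtain s where "s \<in> \<rat>" "t < s" "s < t + r" using Rats_dense_in_real[of t "t + r"] r by auto
    thus "\<exists>t\<in>\<rat> \<inter> {0<..}. \<exists>k. 1 - 1 / (real m + 1) < Y t $ k"
      using r(2)[of s] by (auto simp: dist_real_def)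
  qed
  moreover have "?q \<Longrightarrow> ?r"
  proof
    fix m :: nat
    assume ?q
    then obtain t k where "t \<in> \<rat> \<inter> {0<..}" "1 - 1 / (real m + 1) < Y t $ k" by blast
    thus "\<exists>t>0. \<exists>k. 1 - 1 / (real m + 1) \<le> Y t $ k" by (auto intro: less_imp_le)
  qed
  moreover have "?r \<Longrightarrow> ?l"
  proof (rule antisym)
    show "(SUP t\<in>{0<..}. ?M t) \<le> 1" by (rule cSUP_least) (use M1 in auto)
    assume r: ?r
    have *: "1 - 1 / (real m + 1) \<le> (SUP t\<in>{0<..}. ?M t)" for m :: nat
    proof -
      obtain t k where t: "0 < t" "1 - 1 / (real m + 1) \<le> Y t $ k" using r by blast
      note t(2)
      also have "Y t $ k \<le> ?M t" by (rule Max_ge) auto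
      also have "\<dots> \<le> (SUP t\<in>{0<..}. ?M t)" using t(1) bdd by (intro cSUP_upper) auto
      finally show ?thesis .
    qed
    show "1 \<le> (SUP t\<in>{0<..}. ?M t)"
    proof (rule field_le_epsilon)
      fix e :: real assume "e > 0"
      then obtain m :: nat where "inverse (real (Suc m)) < e" using reals_Archimedean by blast
      thus "1 \<le> (SUP t\<in>{0<..}. ?M t) + e" using *[of m] by (simp add: inverse_eq_divide add.commute)
    qed
  qed
  ultimately show "?l = ?r" "?l = ?q" by blast+
qed

theorem theorem4p3:
  fixes M :: "'a measure" and F :: "real \<Rightarrow> 'a measure"
    and W :: "real \<Rightarrow> 'a \<Rightarrow> real^'n" and X :: "real \<Rightarrow> 'a \<Rightarrow> real^'n"
    and A :: "real^'n^'n" and \<sigma> :: "real^'n" and x :: "real^'n"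
  assumes "CARD('n) \<ge> 2"
    and "\<forall>j. \<sigma>$j > 0"
    and "x \<in> open_simplex"
    and "std_brownian M F W"
    and "replicator_solution M F W A \<sigma> x X"
  shows "(\<forall>\<epsilon>>0. (\<integral>\<^sup>+ \<omega>. hit_time X \<epsilon> \<omega> \<partial>M) < \<infinity>) \<and>
         measure M {\<omega>\<in>space M. (SUP t\<in>{0<..}. Max (range (\<lambda>k. X t \<omega> $ k))) = 1} = 1"
proof -
  interpret prob_space M using assms(4) by (simp add: std_brownian_def)
  note sol = assms(5)[unfolded replicator_solution_def]
  obtain Kb where Kb: "0 \<le> Kb" "\<And>(y::real^'n) i. y \<in> open_simplex \<Longrightarrow> \<bar>repl_drift A \<sigma> y $ i\<bar> \<le> Kb"
    "\<And>(y::real^'n) z i. y \<in> open_simplex \<Longrightarrow> z \<in> open_simplex \<Longrightarrow> \<bar>repl_drift A \<sigma> y $ i - repl_drift A \<sigma> z $ i\<bar> \<le> Kb * norm (y - z)"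
    by (rule bounded_lipschitz_on_uniform[of open_simplex "\<lambda>i y. repl_drift A \<sigma> y $ i", OF bounded_lipschitz_repl_drift]) blast
  obtain Kc where Kc: "0 \<le> Kc" "\<And>(y::real^'n) p. y \<in> open_simplex \<Longrightarrow> \<bar>repl_diff \<sigma> y $ fst p $ snd p\<bar> \<le> Kc"
    "\<And>(y::real^'n) z p. y \<in> open_simplex \<Longrightarrow> z \<in> open_simplex \<Longrightarrow>
       \<bar>repl_diff \<sigma> y $ fst p $ snd p - repl_diff \<sigma> z $ fst p $ snd p\<bar> \<le> Kc * norm (y - z)"
    by (rule bounded_lipschitz_on_uniform[of open_simplex "\<lambda>p y. repl_diff \<sigma> y $ fst p $ snd p", OF bounded_lipschitz_repl_diff]) blast
  \<comment> \<open>The factor \<open>CARD('n)\<close> leads from a bound on the entries of a row of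
    the diffusion matrix to its Euclidean norm, by way of the l1 norm.\<close>
  define K where "K = Kb + real CARD('n) * Kc"
  have K: "Kb \<le> K" "real CARD('n) * Kc \<le> K" using Kb(1) Kc(1) by (auto simp: K_def)
  have l1: "norm v \<le> K * r" if "\<And>j. \<bar>v $ j\<bar> \<le> Kc * r" "0 \<le> r" for v :: "real^'n" and r
  proof -
    have "norm v \<le> (\<Sum>j\<in>UNIV. \<bar>v $ j\<bar>)" by (rule norm_le_l1_cart)
    also have "\<dots> \<le> (\<Sum>j\<in>(UNIV :: 'n set). Kc * r)" by (intro sum_mono that)
    also have "\<dots> \<le> K * r" using mult_right_mono[OF K(2) that(2)] by (simp add: mult.assoc)
    finally show ?thesis .
  qed
  interpret ito_diffusion M F W X "repl_drift A \<sigma>" "repl_diff \<sigma>" open_simplex K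
  proof unfold_locales
    show "std_brownian M F W" by (rule assms(4))
    show "X t \<in> borel_measurable (F t)" if "0 \<le> t" for t using sol that by blast
    show "continuous_on {0..} (\<lambda>t. X t \<omega>)" if "\<omega> \<in> space M" for \<omega> using sol that by blast
    show "X t \<omega> \<in> open_simplex" if "\<omega> \<in> space M" "0 \<le> t" for t \<omega> using sol that by blast
    show "continuous_on UNIV (repl_drift A \<sigma>)" "continuous_on UNIV (repl_diff \<sigma>)"
      by (rule continuous_repl_drift continuous_repl_diff)+
    fix y z :: "real^'n" and i assume y: "y \<in> open_simplex"
    show "\<bar>repl_drift A \<sigma> y $ i\<bar> \<le> K" using Kb(2)[OF y, of i] K(1) by linarith
    show "norm (repl_diff \<sigma> y $ i) \<le> K" using l1[of "repl_diff \<sigma> y $ i" 1] Kc(2)[OF y, of "(i, _)"] by simp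
    assume z: "z \<in> open_simplex"
    show "\<bar>repl_drift A \<sigma> y $ i - repl_drift A \<sigma> z $ i\<bar> \<le> K * norm (y - z)"
      using Kb(3)[OF y z, of i] mult_right_mono[OF K(1), of "norm (y - z)"] by auto
    show "norm (repl_diff \<sigma> y $ i - repl_diff \<sigma> z $ i) \<le> K * norm (y - z)"
      using Kc(3)[OF y z, of "(i, _)"] by (intro l1) auto
  next
    fix t :: real and i assume t: "0 \<le> t"
    have "conv_in_prob M
        (\<lambda>m \<omega>. \<Sum>j\<in>UNIV. ito_sum W (\<lambda>s \<omega>'. repl_diff \<sigma> (X s \<omega>') $ i $ j) j t m \<omega>)
        (\<lambda>\<omega>. X t \<omega> $ i - x $ i - integral {0..t} (\<lambda>s. repl_drift A \<sigma> (X s \<omega>) $ i))"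
      using sol t by blast
    moreover have "x = X 0 \<omega>" if "\<omega> \<in> space M" for \<omega> using sol that by simp
    ultimately show "conv_in_prob M
        (\<lambda>m \<omega>. \<Sum>j\<in>UNIV. ito_sum W (\<lambda>s \<omega>'. repl_diff \<sigma> (X s \<omega>') $ i $ j) j t m \<omega>)
        (\<lambda>\<omega>. X t \<omega> $ i - X 0 \<omega> $ i - integral {0..t} (\<lambda>s. repl_drift A \<sigma> (X s \<omega>) $ i))"
      unfolding conv_in_prob_def by (simp cong: conj_cong)
  qed
  obtain L where L: "0 \<le> L" "\<And>(y::real^'n) i. y \<in> open_simplex \<Longrightarrow> \<bar>fitness_gap A \<sigma> i y\<bar> \<le> L"
    by (rule bounded_lipschitz_on_uniform[of open_simplex "fitness_gap A \<sigma>", OF bounded_lipschitz_fitness_gap]) blast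
  define s where "s = Min (range (\<lambda>j. \<sigma> $ j))"
  have s: "0 < s" "\<And>j. s \<le> \<sigma> $ j" using assms(2) by (auto simp: s_def)
  have dom: "\<exists>g\<in>borel_measurable M. (\<integral>\<^sup>+\<omega>. g \<omega> \<partial>M) < \<infinity> \<and> (\<forall>\<omega>\<in>space M. hit_time X \<epsilon> \<omega> \<le> g \<omega>)"
    if \<epsilon>: "\<epsilon> > 0" for \<epsilon>
  proof -
    \<comment> \<open>This is the nondegeneracy constant \<gamma> of the Lyapunov estimate. Where
      every coordinate is below 1 - \<epsilon>, the diagonal entry (1 - y_i) \<sigma>_i y_i of the
      diffusion matrix is at least \<epsilon> s y_i, and its square is one summand of the squared
      norm of row i.\<close>
    have pos: "0 < (\<epsilon> * s)\<^sup>2" using \<epsilon> s by simp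
    obtain \<alpha> where \<alpha>: "0 \<le> \<alpha>"
      "\<And>(y :: real^'n) \<beta> u. y \<in> open_simplex \<Longrightarrow> (\<And>i. - L * y $ i \<le> \<beta> i) \<Longrightarrow> (\<And>i. (\<epsilon> * s)\<^sup>2 * (y $ i)\<^sup>2 \<le> u i) \<Longrightarrow>
        1 \<le> (\<Sum>i\<in>UNIV. exp (\<alpha> * y $ i) * (\<alpha> * \<beta> i + \<alpha>\<^sup>2 / 2 * u i))"
      using exponential_lyapunov[OF pos L(1), where 'n='n] by blast
    show ?thesis
    proof (rule hit_time_dominated[OF \<alpha>(1)])
      show "0 \<le> y $ i \<and> y $ i \<le> 1" if "y \<in> open_simplex" for y :: "real^'n" and i
        using open_simplex_bounds[OF that, of i] by simp
    next
      fix y :: "real^'n" assume y: "y \<in> open_simplex" and le: "\<And>i. y $ i < 1 - \<epsilon>"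
      show "1 \<le> (\<Sum>i\<in>UNIV. exp (\<alpha> * y $ i) * (\<alpha> * repl_drift A \<sigma> y $ i + \<alpha>\<^sup>2 / 2 * (repl_diff \<sigma> y $ i \<bullet> repl_diff \<sigma> y $ i)))"
      proof (rule \<alpha>(2)[OF y])
        fix i
        have y0: "0 < y $ i" by (rule open_simplex_bounds[OF y])
        have "y $ i * (- L) \<le> y $ i * fitness_gap A \<sigma> i y"
          using L(2)[OF y, of i] y0 by (intro mult_left_mono) auto
        thus "- L * y $ i \<le> repl_drift A \<sigma> y $ i" by (simp add: repl_drift_nth mult.commute)
        have "\<epsilon> * s \<le> (1 - y $ i) * \<sigma> $ i" using \<epsilon> s le[of i] by (intro mult_mono) (auto intro: less_imp_le)
        hence "(\<epsilon> * s) * y $ i \<le> ((1 - y $ i) * \<sigma> $ i) * y $ i" using y0 by (intro mult_right_mono) auto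
        also have "\<dots> = repl_diff \<sigma> y $ i $ i" by (simp add: repl_diff_nth algebra_simps)
        finally have "((\<epsilon> * s) * y $ i)\<^sup>2 \<le> (repl_diff \<sigma> y $ i $ i)\<^sup>2"
          using \<epsilon> s y0 by (intro power_mono) auto
        also have "\<dots> \<le> repl_diff \<sigma> y $ i \<bullet> repl_diff \<sigma> y $ i"
          unfolding inner_vec_def inner_real_def power2_eq_square
          by (rule member_le_sum) auto
        finally show "(\<epsilon> * s)\<^sup>2 * (y $ i)\<^sup>2 \<le> repl_diff \<sigma> y $ i \<bullet> repl_diff \<sigma> y $ i"
          by (simp add: power_mult_distrib)
      qed
    qed
  qed
  have "(\<integral>\<^sup>+ \<omega>. hit_time X \<epsilon> \<omega> \<partial>M) < \<infinity>" if \<epsilon>: "\<epsilon> > 0" for \<epsilon>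
  proof -
    obtain g where g: "(\<integral>\<^sup>+\<omega>. g \<omega> \<partial>M) < \<infinity>" "\<And>\<omega>. \<omega> \<in> space M \<Longrightarrow> hit_time X \<epsilon> \<omega> \<le> g \<omega>"
      using dom[OF \<epsilon>] by blast
    have "(\<integral>\<^sup>+ \<omega>. hit_time X \<epsilon> \<omega> \<partial>M) \<le> (\<integral>\<^sup>+\<omega>. g \<omega> \<partial>M)" by (rule nn_integral_mono) (rule g(2))
    thus ?thesis using g(1) by (rule le_less_trans)
  qed
  moreover have "prob {\<omega>\<in>space M. (SUP t\<in>{0<..}. Max (range (\<lambda>k. X t \<omega> $ k))) = 1} = 1"
  proof -
    have sup: "(SUP t\<in>{0<..}. Max (range (\<lambda>k. X t \<omega> $ k))) = 1 \<longleftrightarrow>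
        (\<forall>m::nat. \<exists>t>0. \<exists>k. 1 - 1 / (real m + 1) \<le> X t \<omega> $ k)"
      "(SUP t\<in>{0<..}. Max (range (\<lambda>k. X t \<omega> $ k))) = 1 \<longleftrightarrow>
        (\<forall>m::nat. \<exists>t\<in>\<rat> \<inter> {0<..}. \<exists>k. 1 - 1 / (real m + 1) < X t \<omega> $ k)" if "\<omega> \<in> space M" for \<omega>
      by (rule sup_max_eq_one_iff[OF X_in[OF that] X_cont[OF that]]; assumption)+
    \<comment> \<open>An integrable majorant is almost surely finite, so the infimum defining
      \<open>hit_time\<close> runs over a nonempty set of times. The exceptional null set depends on
      \<open>m\<close>, and there are countably many of them.\<close>
    have "AE \<omega> in M. \<exists>t>0. \<exists>k. 1 - 1 / (real m + 1) \<le> X t \<omega> $ k" for m :: nat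
    proof -
      have "0 < 1 / (real m + 1)" by simp
      from dom[OF this] obtain g where g: "g \<in> borel_measurable M" "(\<integral>\<^sup>+\<omega>. g \<omega> \<partial>M) < \<infinity>"
        "\<And>\<omega>. \<omega> \<in> space M \<Longrightarrow> hit_time X (1 / (real m + 1)) \<omega> \<le> g \<omega>" by blast
      have "AE \<omega> in M. g \<omega> \<noteq> \<infinity>" using g(1,2) by (intro nn_integral_noteq_infinite) auto
      with AE_space show ?thesis
      proof eventually_elim
        case (elim \<omega>)
        have "hit_time X (1 / (real m + 1)) \<omega> < \<top>" using g(3)[OF elim(1)] elim(2) by (auto simp: less_top[symmetric] top_unique)
        thus ?case unfolding hit_time_def by (auto simp: INF_less_iff)
      qed
    qed
    hence "AE \<omega> in M. \<forall>m::nat. \<exists>t>0. \<exists>k. 1 - 1 / (real m + 1) \<le> X t \<omega> $ k"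
      by (simp add: AE_all_countable)
    with AE_space have ae: "AE \<omega> in M. (SUP t\<in>{0<..}. Max (range (\<lambda>k. X t \<omega> $ k))) = 1"
    proof eventually_elim
      case (elim \<omega>)
      show ?case using sup(1)[OF elim(1)] elim(2) by blast
    qed
    have "{\<omega>\<in>space M. (SUP t\<in>{0<..}. Max (range (\<lambda>k. X t \<omega> $ k))) = 1} =
       {\<omega>\<in>space M. \<forall>m::nat. \<exists>t\<in>\<rat> \<inter> {0<..}. \<exists>k\<in>UNIV. 1 - 1 / (real m + 1) < X t \<omega> $ k}"
      using sup(2) by auto
    also have "\<dots> \<in> events"
    proof (intro sets.sets_Collect_countable_All sets.sets_Collect_countable_Ex' sets.sets_Collect_finite_Ex)
      show "countable (\<rat> \<inter> {0<..} :: real set)" using countable_rat by blast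
      fix m :: nat and t :: real and k :: 'n assume "t \<in> \<rat> \<inter> {0<..}"
      hence [measurable]: "(\<lambda>\<omega>. X t \<omega> $ k) \<in> borel_measurable M" using measurable_F_M[OF X_nth_F] by simp
      show "{\<omega> \<in> space M. 1 - 1 / (real m + 1) < X t \<omega> $ k} \<in> events" by measurable
    qed auto
    finally have "{\<omega>\<in>space M. (SUP t\<in>{0<..}. Max (range (\<lambda>k. X t \<omega> $ k))) = 1} \<in> events" .
    from prob_Collect_eq_1[OF this] ae show ?thesis by (rule iffD2)
  qed
  ultimately show ?thesis by blast
qed

end
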